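(* (i) Any Galois extension of fields of degree $60$ with (soluble) Galois group $\Gamma=A_4\times C_5$ admits a Hopf-Galois structure of (simple) type $A_5$. (ii) Any Galois extension of fields of degree $168$ with (soluble) Galois group $\Gamma=S_4\times C_7$ admits a Hopf-Galois structure of (simple) type $\mathrm{PSL}_3(2)\cong \mathrm{PSL}_2(7)$. (iii) If $p=2^e-1\geq 7$ is a Mersenne prime, then any Galois extension of fields of degree $\frac{1}{2}(p-1)p(p+1)$ with (soluble) Galois group $\Gamma=F_{\frac{1}{2}p(p-1)}\times D_{2^e}$ admits a Hopf-Galois structure of (simple) type $\mathrm{PSL}_2(p)$.
   Context: Groups. $C_n$, $S_n$, $A_n$ denote the cyclic group of order $n$ and the symmetric and alternating groups of degree $n$; $D_{2n}$ denotes the dihedral group of order $2n$ (so $D_{2^e}$ has order $2^e$). $\mathrm{PSL}_m(p)$ is the projective special linear group of dimension $m$ over the field $\mathbb{F}_p$ of $p$ elements. For an odd prime $p$, $F_{\frac{1}{2}p(p-1)}$ is the unique Frobenius group of order $\frac{1}{2}p(p-1)$ with a faithful permutation representation of degree $p$, namely the semidirect product $C_p\rtimes C_{\frac{1}{2}(p-1)}$ in which the second factor acts faithfully on the first. Hopf-Galois structures. Let $L/K$ be a finite field extension and $H$ a $K$-Hopf algebra with comultiplication $\Delta(h)=\sum_{(h)}h_{(1)}\otimes h_{(2)}$ and counit $\epsilon$. $L$ is an $H$-module algebra if $H$ acts on $L$ with $h\cdot(xy)=\sum_{(h)}(h_{(1)}\cdot x)(h_{(2)}\cdot y)$ and $h\cdot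 k=\epsilon(h)k$ for all $h\in H$, $x,y\in L$, $k\in K$. If moreover the $K$-linear map $L\otimes_K L\to \mathrm{Hom}_K(H,L)$, $x\otimes y\mapsto (h\mapsto x(h\cdot y))$, is bijective, then $L$ is an $H$-Galois extension of $K$, and $H$ is said to endow $L/K$ with a Hopf-Galois structure. Type. If $L/K$ is a finite Galois extension with group $\Gamma$, then by Greither and Pareigis the Hopf-Galois structures on $L/K$, up to isomorphism, correspond bijectively to the regular subgroups $G$ of $\mathrm{Perm}(\Gamma)$ (the group of all permutations of the set $\Gamma$) that are normalized by the group $\lambda(\Gamma)$ of left translations by elements of $\Gamma$; the Hopf algebra corresponding to $G$ is the fixed-point algebra $L[G]^\Gamma$, where $\Gamma$ acts on $L$ by field automorphisms and on $G$ by conjugation via $\lambda(\Gamma)$. (A permutation group on a set is regular if it is transitive and all point stabilizers are trivial.) The type of the Hopf-Galois structure is the isomorphism type of $G$. Thus "$L/K$ admits a Hopf-Galois structure of type $G$" means that some regular subgroup of $\mathrm{Perm}(\Gamma)$ normalized by $\lambda(\Gamma)$ is isomorphic to $G$. *)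

theory Defs
  imports
    "Jordan_Normal_Form.Determinant"
    "HOL-Algebra.Algebra"
begin

definition left_translations :: "('a, 'b) monoid_scheme \<Rightarrow> ('a \<Rightarrow> 'a) set" where
  "left_translations G = (\<lambda>g. \<lambda>x\<in>carrier G. g \<otimes>\<^bsub>G\<^esub> x) ` carrier G"

definition regular_permutation_group :: "'a set \<Rightarrow> ('a \<Rightarrow> 'a) set \<Rightarrow> bool" where
  "regular_permutation_group S N \<longleftrightarrow>
     subgroup N (BijGroup S) \<and>
     transitive_action ((BijGroup S)\<lparr>carrier := N\<rparr>) S (\<lambda>g. g) \<and>
     (\<forall>x\<in>S. stabilizer ((BijGroup S)\<lparr>carrier := N\<rparr>) (\<lambda>g. g) x = {\<one>\<^bsub>BijGroup S\<^esub>})"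

definition galois_group :: "('a, 'b) ring_scheme \<Rightarrow> 'a set \<Rightarrow> ('a \<Rightarrow> 'a) monoid" where
  "galois_group L K =
     (BijGroup (carrier L))\<lparr>carrier :=
        {\<sigma> \<in> Bij (carrier L). \<sigma> \<in> Ring.ring_hom L L \<and> (\<forall>k\<in>K. \<sigma> k = k)}\<rparr>"

definition galois_extension :: "('a, 'b) ring_scheme \<Rightarrow> 'a set \<Rightarrow> bool" where
  "galois_extension L K \<longleftrightarrow>
     field L \<and> subfield K L \<and> ring.finite_dimension L K (carrier L) \<and>
     {x \<in> carrier L. \<forall>\<sigma>\<in>carrier (galois_group L K). \<sigma> x = x} = K"

definition extension_degree :: "('a, 'b) ring_scheme \<Rightarrow> 'a set \<Rightarrow> nat" where
  "extension_degree L K = ring.dim L K (carrier L)"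

text \<open>
  Existence of a Hopf-Galois structure of a given type on a finite Galois extension,
  in the sense of Greither and Pareigis: with \<open>\<Gamma>\<close> the Galois group, the structures on
  \<open>L/K\<close> are the fixed-point Hopf algebras \<open>L[N]\<^sup>\<Gamma>\<close> for the regular subgroups \<open>N\<close> of
  \<open>Perm(\<Gamma>)\<close> normalized by the left translations, and the type is the isomorphism
  class of \<open>N\<close>.
\<close>
definition admits_hopf_galois_structure_of_type ::
    "('a, 'b) ring_scheme \<Rightarrow> 'a set \<Rightarrow> ('c, 'd) monoid_scheme \<Rightarrow> bool" where
  "admits_hopf_galois_structure_of_type L K G \<longleftrightarrow>
     (let \<Gamma> = galois_group L K; P = BijGroup (carrier \<Gamma>) in
       \<exists>N. regular_permutation_group (carrier \<Gamma>) N \<and>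
           left_translations \<Gamma> \<subseteq> normalizer P N \<and>
           P\<lparr>carrier := N\<rparr> \<cong> G)"

definition semidirect_product ::
    "('a, 'm) monoid_scheme \<Rightarrow> ('b, 'n) monoid_scheme \<Rightarrow> ('b \<Rightarrow> 'a \<Rightarrow> 'a) \<Rightarrow> ('a \<times> 'b) monoid" where
  "semidirect_product N H \<phi> =
     \<lparr>carrier = carrier N \<times> carrier H,
      mult = (\<lambda>(a, h) (b, k). (a \<otimes>\<^bsub>N\<^esub> \<phi> h b, h \<otimes>\<^bsub>H\<^esub> k)),
      one = (\<one>\<^bsub>N\<^esub>, \<one>\<^bsub>H\<^esub>)\<rparr>"

text \<open>The dihedral group of order \<open>2 n\<close>, for \<open>n > 0\<close>.\<close>
definition dihedral_group :: "nat \<Rightarrow> (int \<times> int) monoid" where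
  "dihedral_group n =
     semidirect_product (integer_mod_group n) (integer_mod_group 2)
       (\<lambda>s. \<lambda>x\<in>carrier (integer_mod_group n). if s = 0 then x else inv\<^bsub>integer_mod_group n\<^esub> x)"

text \<open>
  For a prime \<open>p\<close>, the field of \<open>p\<close> elements is represented by the residues \<open>{0..<p}\<close>, so
  matrices over it are integer matrices with entries in that range, multiplied modulo \<open>p\<close>.
  The determinant modulo \<open>p\<close> is the integer determinant reduced modulo \<open>p\<close>.
\<close>
definition SL :: "nat \<Rightarrow> nat \<Rightarrow> int mat monoid" where
  "SL m p =
     \<lparr>carrier = {A \<in> carrier_mat m m. elements_mat A \<subseteq> {0..<int p} \<and> det A mod int p = 1},
      mult = (\<lambda>A B. map_mat (\<lambda>x. x mod int p) (A * B)),
      one = 1\<^sub>m m\<rparr>"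

definition SL_scalars :: "nat \<Rightarrow> nat \<Rightarrow> int mat set" where
  "SL_scalars m p = {A \<in> carrier (SL m p). \<exists>a. A = a \<cdot>\<^sub>m 1\<^sub>m m}"

definition PSL :: "nat \<Rightarrow> nat \<Rightarrow> int mat set monoid" where
  "PSL m p = SL m p Mod SL_scalars m p"

end

(*
  Suppose that a finite group G has subgroups A and B of coprime orders with |G| = |A| |B|. Then
  (a, b) |-> a b^-1 is a bijection from A x B onto G which carries left translation by (a, b) to
  the map g |-> a g b^-1. Such a map normalizes the left translations of G, and transporting these
  to A x B gives a regular subgroup of Perm(A x B) that is isomorphic to G and normalized by the
  left translations of A x B. So the claims come down to three factorizations with coprime factors.

  (i) A_5 = A_4 C_5.

  (ii) PSL_3(2) = S_4 C_7, with S_4 acting on the even subsets of a set of four points modulo 2.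
  The isomorphism with PSL_2(7) comes from the action of SL_2(7) on the extended quadratic residue
  code of length 8 modulo the constant words.

  (iii) PSL_2(p) = F D with p + 1 = 2^e, where F is the image of the upper triangular matrices. The
  dihedral factor D is generated by a reflection and by the image of multiplication by 2 + sqrt 3.
  As 3 is not a square modulo p, (1 + sqrt 3)^(p+1) is the norm -2 of 1 + sqrt 3; since
  (1 + sqrt 3)^2 = 2 (2 + sqrt 3) and 2 is a square modulo p, it follows that
  (2 + sqrt 3)^(2^(e-1)) = -1, so the rotation has order 2^(e-1) in PSL_2(p).
*)
theory Submission
  imports Defs
    "HOL-Number_Theory.Number_Theory"
begin

section \<open>Hopf-Galois structures from exact factorizations\<close>

text \<open>Coprime orders force the two embedded factors to meet trivially, so each case needs only
  two injective homomorphisms into G and a comparison of orders. The factors of order 5 and 7 come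
  from Cauchy's theorem, with no explicit elements.

  The Frobenius factor is given by an arbitrary faithful action on C_p, so its embedding has to be
  built from that action. This works because p = 3 modulo 4 makes the complement of odd order,
  whence multipliers have square roots.

  Simplicity of PSL_2(p) rests on one fact: for p at least 7, a normal subgroup of SL_2(p) with a
  nonscalar element contains all transvections. The same fact shows that the code representation of
  SL_2(7) has only scalars in its kernel. An enumeration bounds the order of SL_3(2) by 168, so the
  representation is onto, and PSL_3(2) inherits simplicity. For A_5, a check of all 120 permutations
  of five points leads from any nontrivial one to a 3-cycle.

  Arithmetic in F_p is carried out with integer congruences, read as divisibilities, so that matrix
  identities become ideal membership problems.\<close>

lemma (in group) subgroup_of_transported_left_translations:
  fixes \<theta> :: "'c \<Rightarrow> 'a" and S
  assumes bij: "bij_betw \<theta> S (carrier G)"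
  defines "\<psi> \<equiv> \<lambda>g. \<lambda>x\<in>S. inv_into S \<theta> (g \<otimes> \<theta> x)"
  shows "group_hom G (BijGroup S) \<psi>" and "inj_on \<psi> (carrier G)"
    and "\<And>g x. g \<in> carrier G \<Longrightarrow> x \<in> S \<Longrightarrow> \<theta> (\<psi> g x) = g \<otimes> \<theta> x"
    and "regular_permutation_group S (\<psi> ` carrier G)"
    and "(BijGroup S)\<lparr>carrier := \<psi> ` carrier G\<rparr> \<cong> G"
proof -
  have th: "\<theta> x \<in> carrier G" if "x \<in> S" for x
    using bij that by (auto simp: bij_betw_def)
  have inS: "inv_into S \<theta> g \<in> S" "\<theta> (inv_into S \<theta> g) = g" if "g \<in> carrier G" for g
    using bij that by (auto simp: bij_betw_def inv_into_into f_inv_into_f)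
  \<comment> \<open>Points of \<open>S\<close> are compared through \<theta>, where \<psi> g is
    multiplication by g; simple transitivity on \<open>S\<close> is then that of G acting on
    itself.\<close>
  have theq: "x = y" if "x \<in> S" "y \<in> S" "\<theta> x = \<theta> y" for x y
    using bij that by (auto simp: bij_betw_def inj_on_def)
  have psi: "\<psi> g x \<in> S" "\<theta> (\<psi> g x) = g \<otimes> \<theta> x" if "g \<in> carrier G" "x \<in> S" for g x
    using that inS[of "g \<otimes> \<theta> x"] th by (auto simp: \<psi>_def)
  show A: "\<And>g x. g \<in> carrier G \<Longrightarrow> x \<in> S \<Longrightarrow> \<theta> (\<psi> g x) = g \<otimes> \<theta> x"
    by (rule psi)
  have Bij: "\<psi> g \<in> Bij S" if g: "g \<in> carrier G" for g
  proof -
    have "bij_betw (\<psi> g) S S"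
    proof (rule bij_betw_byWitness[where f' = "\<psi> (inv g)"])
      show "\<forall>a\<in>S. \<psi> (inv g) (\<psi> g a) = a"
        using g psi th by (auto intro!: theq simp: m_assoc[symmetric])
      show "\<forall>a\<in>S. \<psi> g (\<psi> (inv g) a) = a"
        using g psi th by (auto intro!: theq simp: m_assoc[symmetric])
    qed (use g psi in auto)
    then show ?thesis by (auto simp: Bij_def \<psi>_def)
  qed
  have mult: "\<psi> (g \<otimes> h) = \<psi> g \<otimes>\<^bsub>BijGroup S\<^esub> \<psi> h" if gh: "g \<in> carrier G" "h \<in> carrier G" for g h
  proof -
    have "\<psi> (g \<otimes> h) = compose S (\<psi> g) (\<psi> h)"
    proof (rule extensionalityI[of _ S])
      fix x assume x: "x \<in> S"
      show "\<psi> (g \<otimes> h) x = compose S (\<psi> g) (\<psi> h) x"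
        using gh x psi th by (auto intro!: theq simp: compose_def m_assoc)
    qed (auto simp: \<psi>_def)
    then show ?thesis using Bij gh by (simp add: BijGroup_def)
  qed
  show hom: "group_hom G (BijGroup S) \<psi>"
    unfolding group_hom_def group_hom_axioms_def
    using group_BijGroup Bij mult is_group by (auto simp: hom_def BijGroup_def)
  obtain z where z: "z \<in> S" using inS[of \<one>] by auto
  show inj: "inj_on \<psi> (carrier G)"
  proof (rule inj_onI)
    fix g h assume gh: "g \<in> carrier G" "h \<in> carrier G" "\<psi> g = \<psi> h"
    then have "g \<otimes> \<theta> z = h \<otimes> \<theta> z" using psi z by metis
    then show "g = h" using gh th z by simp
  qed
  interpret P: group_hom G "BijGroup S" \<psi> by (rule hom)
  let ?N = "\<psi> ` carrier G" and ?P = "BijGroup S"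
  have sub: "subgroup ?N ?P"
    by (rule P.img_is_subgroup)
  have grp: "group (?P\<lparr>carrier := ?N\<rparr>)"
    by (rule P.H.subgroup_imp_group[OF sub])
  show "regular_permutation_group S ?N"
    unfolding regular_permutation_group_def
  proof (intro conjI ballI sub)
    have "group_action (?P\<lparr>carrier := ?N\<rparr>) S (\<lambda>g. g)"
      unfolding group_action_def group_hom_def group_hom_axioms_def
      using grp group_BijGroup sub[THEN subgroup.subset] by (auto simp: hom_def)
    moreover have "\<exists>g\<in>?N. g x = y" if "x \<in> S" "y \<in> S" for x y
    proof -
      have "\<psi> (\<theta> y \<otimes> inv (\<theta> x)) x = y"
        using that th psi by (auto intro!: theq simp: m_assoc simp del: P.hom_mult P.hom_inv)
      moreover have "\<psi> (\<theta> y \<otimes> inv (\<theta> x)) \<in> ?N" using that th by (intro imageI) simp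
      ultimately show ?thesis by blast
    qed
    ultimately show "transitive_action (?P\<lparr>carrier := ?N\<rparr>) S (\<lambda>g. g)"
      unfolding transitive_action_def transitive_action_axioms_def by auto
    fix x assume x: "x \<in> S"
    have "g = \<one>" if "g \<in> carrier G" "\<psi> g x = x" for g
    proof -
      have "g \<otimes> \<theta> x = \<one> \<otimes> \<theta> x" using psi(2)[OF that(1) x] that(2) th[OF x] by simp
      then show ?thesis using that(1) th[OF x] by simp
    qed
    moreover have "\<one>\<^bsub>?P\<^esub> = \<psi> \<one>" by simp
    moreover have "\<psi> \<one> x = x" using x psi(1)[of \<one> x] psi(2)[of \<one> x] th[of x] by (intro theq) (simp_all del: P.hom_one)
    ultimately have "{g \<in> ?N. g x = x} = {\<one>\<^bsub>?P\<^esub>}"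
      by (force simp del: P.hom_one)
    then show "stabilizer (?P\<lparr>carrier := ?N\<rparr>) (\<lambda>g. g) x = {\<one>\<^bsub>?P\<^esub>}"
      by (simp add: stabilizer_def)
  qed
  have "\<psi> \<in> iso G (?P\<lparr>carrier := ?N\<rparr>)"
    using inj mult by (auto simp: iso_def hom_def bij_betw_def)
  then show "?P\<lparr>carrier := ?N\<rparr> \<cong> G"
    using iso_sym is_isoI by blast
qed

text \<open>If translation by \<gamma> reads g |-> u g v after transport, conjugating multiplication
  by g with it gives multiplication by u g u^-1: the right factor v cancels because left and right
  multiplications commute.\<close>

lemma (in group) left_translations_normalize:
  fixes \<theta> :: "'c \<Rightarrow> 'a" and \<Gamma> :: "('c, 'd) monoid_scheme" and u v :: "'c \<Rightarrow> 'a"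
  assumes \<Gamma>: "group \<Gamma>"
    and bij: "bij_betw \<theta> (carrier \<Gamma>) (carrier G)"
    and uv: "\<And>\<gamma>. \<gamma> \<in> carrier \<Gamma> \<Longrightarrow> u \<gamma> \<in> carrier G \<and> v \<gamma> \<in> carrier G"
    and th_mult: "\<And>\<gamma> x. \<lbrakk>\<gamma> \<in> carrier \<Gamma>; x \<in> carrier \<Gamma>\<rbrakk> \<Longrightarrow> \<theta> (\<gamma> \<otimes>\<^bsub>\<Gamma>\<^esub> x) = u \<gamma> \<otimes> \<theta> x \<otimes> v \<gamma>"
  defines "\<psi> \<equiv> \<lambda>g. \<lambda>x\<in>carrier \<Gamma>. inv_into (carrier \<Gamma>) \<theta> (g \<otimes> \<theta> x)"
  shows "left_translations \<Gamma> \<subseteq> normalizer (BijGroup (carrier \<Gamma>)) (\<psi> ` carrier G)"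
proof
  let ?S = "carrier \<Gamma>" and ?P = "BijGroup (carrier \<Gamma>)"
  note psi = subgroup_of_transported_left_translations[OF bij, folded \<psi>_def]
  interpret P: group_hom G ?P \<psi> by (rule psi(1))
  interpret \<Gamma>: group \<Gamma> by (rule \<Gamma>)
  have th: "\<theta> x \<in> carrier G" if "x \<in> ?S" for x
    using bij that by (auto simp: bij_betw_def)
  have theq: "x = y" if "x \<in> ?S" "y \<in> ?S" "\<theta> x = \<theta> y" for x y
    using bij that by (auto simp: bij_betw_def inj_on_def)
  fix \<rho> assume "\<rho> \<in> left_translations \<Gamma>"
  then obtain \<gamma> where \<gamma>: "\<gamma> \<in> ?S" and \<rho>: "\<rho> = (\<lambda>x\<in>?S. \<gamma> \<otimes>\<^bsub>\<Gamma>\<^esub> x)"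
    by (auto simp: left_translations_def)
  have "bij_betw \<rho> ?S ?S"
    by (rule bij_betw_byWitness[where f' = "\<lambda>x. inv\<^bsub>\<Gamma>\<^esub> \<gamma> \<otimes>\<^bsub>\<Gamma>\<^esub> x"])
      (use \<gamma> in \<open>auto simp: \<rho> \<Gamma>.m_assoc[symmetric]\<close>)
  then have \<rho>B: "\<rho> \<in> Bij ?S" by (auto simp: Bij_def \<rho>)
  then have \<rho>P: "\<rho> \<in> carrier ?P" by (simp add: BijGroup_def)
  have psiB: "\<psi> g \<in> Bij ?S" if "g \<in> carrier G" for g
    using P.hom_closed[OF that] by (simp add: BijGroup_def)
  have u: "u \<gamma> \<in> carrier G" "v \<gamma> \<in> carrier G" using uv \<gamma> by auto
  have psi3: "\<theta> (\<psi> g x) = g \<otimes> \<theta> x" if "g \<in> carrier G" "x \<in> ?S" for g x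
    using psi(3)[OF that] that by (simp add: \<psi>_def)
  have comm: "\<rho> \<otimes>\<^bsub>?P\<^esub> \<psi> g = \<psi> (u \<gamma> \<otimes> g \<otimes> inv (u \<gamma>)) \<otimes>\<^bsub>?P\<^esub> \<rho>" if g: "g \<in> carrier G" for g
  proof -
    have "compose ?S \<rho> (\<psi> g) = compose ?S (\<psi> (u \<gamma> \<otimes> g \<otimes> inv (u \<gamma>))) \<rho>"
    proof (rule extensionalityI[of _ ?S])
      fix x assume x: "x \<in> ?S"
      have px: "\<psi> h x \<in> ?S" if "h \<in> carrier G" "x \<in> ?S" for h x
        using psiB[OF that(1)] that(2) by (auto simp: Bij_def bij_betw_def)
      have "\<theta> (\<rho> (\<psi> g x)) = u \<gamma> \<otimes> (g \<otimes> \<theta> x) \<otimes> v \<gamma>"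
        using g x \<gamma> px psi3 by (simp add: \<rho> th_mult)
      also have "\<dots> = (u \<gamma> \<otimes> g \<otimes> inv (u \<gamma>)) \<otimes> (u \<gamma> \<otimes> \<theta> x \<otimes> v \<gamma>)"
        using g x u th by (simp add: m_assoc inv_solve_left)
      also have "\<dots> = \<theta> (\<psi> (u \<gamma> \<otimes> g \<otimes> inv (u \<gamma>)) (\<rho> x))"
        using g x u \<gamma> psi3 by (simp add: \<rho> th_mult del: P.hom_mult P.hom_inv)
      finally have "\<rho> (\<psi> g x) = \<psi> (u \<gamma> \<otimes> g \<otimes> inv (u \<gamma>)) (\<rho> x)"
        using g x u \<gamma> px by (intro theq) (auto simp: \<rho> simp del: P.hom_mult P.hom_inv)
      then show "compose ?S \<rho> (\<psi> g) x = compose ?S (\<psi> (u \<gamma> \<otimes> g \<otimes> inv (u \<gamma>))) \<rho> x"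
        using x by (simp add: compose_def)
    qed auto
    moreover have "u \<gamma> \<otimes> g \<otimes> inv (u \<gamma>) \<in> carrier G" using g u by simp
    ultimately show ?thesis
      using \<rho>B psiB[OF g] psiB[of "u \<gamma> \<otimes> g \<otimes> inv (u \<gamma>)"]
      by (simp add: BijGroup_def del: P.hom_mult P.hom_inv m_closed)
  qed
  have conj: "\<rho> \<otimes>\<^bsub>?P\<^esub> \<psi> g \<otimes>\<^bsub>?P\<^esub> inv\<^bsub>?P\<^esub> \<rho> = \<psi> (u \<gamma> \<otimes> g \<otimes> inv (u \<gamma>))" if g: "g \<in> carrier G" for g
    unfolding comm[OF g] using g u \<rho>P P.hom_closed by (simp add: P.H.m_assoc del: P.hom_mult)
  have "\<rho> <#\<^bsub>?P\<^esub> (\<psi> ` carrier G) #>\<^bsub>?P\<^esub> inv\<^bsub>?P\<^esub> \<rho>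
      = (\<lambda>g. \<rho> \<otimes>\<^bsub>?P\<^esub> \<psi> g \<otimes>\<^bsub>?P\<^esub> inv\<^bsub>?P\<^esub> \<rho>) ` carrier G"
    by (auto simp: l_coset_def r_coset_def)
  also have "\<dots> = (\<lambda>g. \<psi> (u \<gamma> \<otimes> g \<otimes> inv (u \<gamma>))) ` carrier G"
    using conj by (rule image_cong[OF refl])
  also have "\<dots> = \<psi> ` carrier G"
  proof -
    have "\<psi> g \<in> (\<lambda>g. \<psi> (u \<gamma> \<otimes> g \<otimes> inv (u \<gamma>))) ` carrier G" if "g \<in> carrier G" for g
    proof (rule image_eqI)
      have "u \<gamma> \<otimes> (inv (u \<gamma>) \<otimes> g \<otimes> u \<gamma>) \<otimes> inv (u \<gamma>) = g"
        using that u by (simp add: m_assoc) (simp add: m_assoc[symmetric])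
      then show "\<psi> g = \<psi> (u \<gamma> \<otimes> (inv (u \<gamma>) \<otimes> g \<otimes> u \<gamma>) \<otimes> inv (u \<gamma>))" by simp
    qed (use that u in auto)
    then show ?thesis using u by blast
  qed
  finally show "\<rho> \<in> normalizer ?P (\<psi> ` carrier G)"
    using \<rho>P P.hom_closed by (auto simp: normalizer_def stabilizer_def)
qed

lemma group_galois_group:
  assumes "field L" "K \<subseteq> carrier L"
  shows "group (galois_group L K)"
proof -
  let ?S = "carrier L" and ?P = "BijGroup (carrier L)"
  let ?H = "{\<sigma> \<in> Bij ?S. \<sigma> \<in> Ring.ring_hom L L \<and> (\<forall>k\<in>K. \<sigma> k = k)}"
  interpret L: field L by fact
  interpret P: group ?P by (rule group_BijGroup)
  have "subgroup ?H ?P"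
  proof (rule P.subgroupI)
    show "?H \<subseteq> carrier ?P" by (auto simp: BijGroup_def)
    have "(\<lambda>x\<in>?S. x) \<in> ?H" using assms by (auto simp: id_Bij ring_hom_def)
    then show "?H \<noteq> {}" by blast
  next
    fix a assume a: "a \<in> ?H"
    define b where "b = (\<lambda>x\<in>?S. inv_into ?S a x)"
    have aB: "a \<in> Bij ?S" using a by simp
    have bB: "b \<in> Bij ?S" unfolding b_def by (rule restrict_inv_into_Bij[OF aB])
    have ab: "a (b x) = x" "b x \<in> ?S" if "x \<in> ?S" for x
      using aB that by (auto simp: b_def Bij_def bij_betw_def f_inv_into_f inv_into_into)
    have ba: "b (a x) = x" if "x \<in> ?S" for x
      using aB that by (auto simp: b_def Bij_def bij_betw_def)
    have hom: "a \<in> Ring.ring_hom L L" using a by simp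
    have "b (x \<otimes>\<^bsub>L\<^esub> y) = b x \<otimes>\<^bsub>L\<^esub> b y" "b (x \<oplus>\<^bsub>L\<^esub> y) = b x \<oplus>\<^bsub>L\<^esub> b y"
      if "x \<in> ?S" "y \<in> ?S" for x y
    proof -
      have "a (b x \<otimes>\<^bsub>L\<^esub> b y) = x \<otimes>\<^bsub>L\<^esub> y" "a (b x \<oplus>\<^bsub>L\<^esub> b y) = x \<oplus>\<^bsub>L\<^esub> y"
        using hom that ab by (auto simp: ring_hom_def)
      then show "b (x \<otimes>\<^bsub>L\<^esub> y) = b x \<otimes>\<^bsub>L\<^esub> b y" "b (x \<oplus>\<^bsub>L\<^esub> y) = b x \<oplus>\<^bsub>L\<^esub> b y"
        using ba that ab by (metis L.m_closed, metis L.a_closed)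
    qed
    moreover have "b \<one>\<^bsub>L\<^esub> = \<one>\<^bsub>L\<^esub>" using ba[of "\<one>\<^bsub>L\<^esub>"] hom by (auto simp: ring_hom_def)
    moreover have "b k = k" if "k \<in> K" for k
      using ba[of k] a that assms(2) by auto
    ultimately have "b \<in> ?H" using bB ab by (auto simp: ring_hom_def)
    then show "inv\<^bsub>?P\<^esub> a \<in> ?H" unfolding inv_BijGroup[OF aB] b_def .
  next
    fix a b assume "a \<in> ?H" "b \<in> ?H"
    then show "a \<otimes>\<^bsub>?P\<^esub> b \<in> ?H"
      using compose_Bij[of a ?S b] assms(2)
      by (auto simp: BijGroup_def ring_hom_def compose_def Pi_def subset_iff)
  qed
  then show ?thesis unfolding galois_group_def by (rule P.subgroup_imp_group)
qed

text \<open>The order of x divides both group orders, by Lagrange in each factor.\<close>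

lemma coprime_order_images_Int:
  assumes "group_hom A G \<alpha>" "group_hom B G \<beta>"
    and "finite (carrier A)" "finite (carrier B)" and "coprime (order A) (order B)"
    and x: "x \<in> \<alpha> ` carrier A" "x \<in> \<beta> ` carrier B"
  shows "x = \<one>\<^bsub>G\<^esub>"
proof -
  interpret a: group_hom A G \<alpha> by fact
  interpret b: group_hom B G \<beta> by fact
  obtain a b where ab: "a \<in> carrier A" "x = \<alpha> a" "b \<in> carrier B" "x = \<beta> b" using x by auto
  have xG: "x \<in> carrier G" using ab by simp
  have "x [^]\<^bsub>G\<^esub> order A = \<one>\<^bsub>G\<^esub>"
    using ab a.G.pow_order_eq_1[of a] a.hom_nat_pow[of a "order A"] by simp
  then have 1: "a.H.ord x dvd order A" using xG by (simp add: a.H.pow_eq_id)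
  have "x [^]\<^bsub>G\<^esub> order B = \<one>\<^bsub>G\<^esub>"
    using ab b.G.pow_order_eq_1[of b] b.hom_nat_pow[of b "order B"] by simp
  then have 2: "a.H.ord x dvd order B" using xG by (simp add: a.H.pow_eq_id)
  have "a.H.ord x = 1" using 1 2 assms(5) by (metis coprime_common_divisor_nat)
  then show ?thesis using xG a.H.ord_eq_1 by blast
qed

text \<open>
  The bijection \<open>\<theta> (a, b) = a b\<inverse>\<close> from \<open>A \<times> B\<close> to \<open>G = A B\<close> carries left translation by
  \<open>(a, b)\<close> to the map \<open>g \<mapsto> a g b\<inverse>\<close>, which normalizes the left translations of \<open>G\<close>.
\<close>
theorem exact_factorization_hopf_galois:
  fixes L :: "('l, 'm) ring_scheme" and G :: "('g, 'n) monoid_scheme"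
  assumes ext: "galois_extension L K"
    and iso: "galois_group L K \<cong> A \<times>\<times> B"
    and G: "finite (carrier G)"
    and homA: "group_hom A G \<alpha>" and homB: "group_hom B G \<beta>"
    and injA: "inj_on \<alpha> (carrier A)" and injB: "inj_on \<beta> (carrier B)"
    and cop: "coprime (order A) (order B)"
    and card: "order G \<le> order A * order B"
  shows "admits_hopf_galois_structure_of_type L K G"
proof -
  interpret a: group_hom A G \<alpha> by fact
  interpret b: group_hom B G \<beta> by fact
  let ?\<Gamma> = "galois_group L K"
  have grp: "group ?\<Gamma>"
    using ext group_galois_group[of L K] subfieldE(3)[of K L] by (auto simp: galois_extension_def)
  interpret \<Gamma>: group ?\<Gamma> by (rule grp)
  obtain h where h: "h \<in> iso ?\<Gamma> (A \<times>\<times> B)" using iso by (auto simp: is_iso_def)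
  then have hbij: "bij_betw h (carrier ?\<Gamma>) (carrier A \<times> carrier B)"
    and hmult: "\<And>x y. x \<in> carrier ?\<Gamma> \<Longrightarrow> y \<in> carrier ?\<Gamma> \<Longrightarrow> h (x \<otimes>\<^bsub>?\<Gamma>\<^esub> y) = h x \<otimes>\<^bsub>A \<times>\<times> B\<^esub> h y"
    by (auto simp: iso_def hom_def)
  have finA: "finite (carrier A)" and finB: "finite (carrier B)"
    using injA injB G a.hom_closed b.hom_closed
    by (meson finite_imageD finite_subset image_subsetI)+
  define m where "m = (\<lambda>(x, y). \<alpha> x \<otimes>\<^bsub>G\<^esub> inv\<^bsub>G\<^esub> (\<beta> y))"
  have m_inj: "inj_on m (carrier A \<times> carrier B)"
  proof (rule inj_onI; clarify)
    fix x y x' y'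
    assume xy: "x \<in> carrier A" "y \<in> carrier B" "x' \<in> carrier A" "y' \<in> carrier B"
      and eq: "m (x, y) = m (x', y')"
    \<comment> \<open>Equal values of \<open>m\<close> give an element lying in both images, which
      is trivial by coprimality.\<close>
    have "inv\<^bsub>G\<^esub> (\<alpha> x') \<otimes>\<^bsub>G\<^esub> \<alpha> x = inv\<^bsub>G\<^esub> (\<beta> y') \<otimes>\<^bsub>G\<^esub> \<beta> y"
    proof -
      have "inv\<^bsub>G\<^esub> (\<alpha> x') \<otimes>\<^bsub>G\<^esub> \<alpha> x = inv\<^bsub>G\<^esub> (\<alpha> x') \<otimes>\<^bsub>G\<^esub> (m (x, y) \<otimes>\<^bsub>G\<^esub> \<beta> y)"
        using xy by (simp add: m_def a.H.m_assoc del: a.hom_inv b.hom_inv)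
      also have "\<dots> = inv\<^bsub>G\<^esub> (\<beta> y') \<otimes>\<^bsub>G\<^esub> \<beta> y"
        using xy unfolding eq
        by (simp add: m_def a.H.m_assoc[symmetric] del: a.hom_inv b.hom_inv)
      finally show ?thesis .
    qed
    moreover have "inv\<^bsub>G\<^esub> (\<alpha> x') \<otimes>\<^bsub>G\<^esub> \<alpha> x = \<alpha> (inv\<^bsub>A\<^esub> x' \<otimes>\<^bsub>A\<^esub> x)"
      "inv\<^bsub>G\<^esub> (\<beta> y') \<otimes>\<^bsub>G\<^esub> \<beta> y = \<beta> (inv\<^bsub>B\<^esub> y' \<otimes>\<^bsub>B\<^esub> y)" using xy by auto
    ultimately have "inv\<^bsub>G\<^esub> (\<alpha> x') \<otimes>\<^bsub>G\<^esub> \<alpha> x \<in> \<alpha> ` carrier A"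
      "inv\<^bsub>G\<^esub> (\<alpha> x') \<otimes>\<^bsub>G\<^esub> \<alpha> x \<in> \<beta> ` carrier B"
      using xy a.G.m_closed a.G.inv_closed b.G.m_closed b.G.inv_closed
      by (metis imageI)+
    from coprime_order_images_Int[OF homA homB finA finB cop this]
    have one: "inv\<^bsub>G\<^esub> (\<alpha> x') \<otimes>\<^bsub>G\<^esub> \<alpha> x = \<one>\<^bsub>G\<^esub>" "inv\<^bsub>G\<^esub> (\<beta> y') \<otimes>\<^bsub>G\<^esub> \<beta> y = \<one>\<^bsub>G\<^esub>"
      using \<open>inv\<^bsub>G\<^esub> (\<alpha> x') \<otimes>\<^bsub>G\<^esub> \<alpha> x = inv\<^bsub>G\<^esub> (\<beta> y') \<otimes>\<^bsub>G\<^esub> \<beta> y\<close> by simp_all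
    then have "\<alpha> x = \<alpha> x'" "\<beta> y = \<beta> y'"
      using xy a.H.inv_solve_left[of "\<one>\<^bsub>G\<^esub>" "\<alpha> x'" "\<alpha> x"] a.H.inv_solve_left[of "\<one>\<^bsub>G\<^esub>" "\<beta> y'" "\<beta> y"]
      by (simp_all del: a.hom_inv b.hom_inv)
    then show "x = x' \<and> y = y'" using injA injB xy by (auto simp: inj_on_def)
  qed
  have m_sub: "m ` (carrier A \<times> carrier B) \<subseteq> carrier G" by (auto simp: m_def)
  \<comment> \<open>An injection into a finite set that is not larger than its domain is onto; hence
    the assumption on orders is only an inequality.\<close>
  have "card (m ` (carrier A \<times> carrier B)) = order A * order B"
    using m_inj by (simp add: card_image order_def card_cartesian_product)
  then have "m ` (carrier A \<times> carrier B) = carrier G"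
    using card m_sub G by (metis card_seteq order_def)
  then have mbij: "bij_betw m (carrier A \<times> carrier B) (carrier G)"
    using m_inj by (simp add: bij_betw_def)
  define \<theta> where "\<theta> = m \<circ> h"
  have bij: "bij_betw \<theta> (carrier ?\<Gamma>) (carrier G)"
    unfolding \<theta>_def by (rule bij_betw_trans[OF hbij mbij])
  let ?u = "\<lambda>\<gamma>. \<alpha> (fst (h \<gamma>))" and ?v = "\<lambda>\<gamma>. inv\<^bsub>G\<^esub> (\<beta> (snd (h \<gamma>)))"
  have hin: "fst (h x) \<in> carrier A" "snd (h x) \<in> carrier B" if "x \<in> carrier ?\<Gamma>" for x
    using bij_betw_apply[OF hbij that] by (simp_all add: mem_Times_iff)
  note T = a.H.subgroup_of_transported_left_translations[OF bij]
  have m_mult: "m (x \<otimes>\<^bsub>A\<^esub> x', y \<otimes>\<^bsub>B\<^esub> y') = \<alpha> x \<otimes>\<^bsub>G\<^esub> m (x', y') \<otimes>\<^bsub>G\<^esub> inv\<^bsub>G\<^esub> (\<beta> y)"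
    if "x \<in> carrier A" "y \<in> carrier B" "x' \<in> carrier A" "y' \<in> carrier B" for x y x' y'
    using that by (simp add: m_def a.H.inv_mult_group a.H.m_assoc del: a.hom_inv b.hom_inv)
  have "left_translations ?\<Gamma> \<subseteq> normalizer (BijGroup (carrier ?\<Gamma>))
      ((\<lambda>g. \<lambda>x\<in>carrier ?\<Gamma>. inv_into (carrier ?\<Gamma>) \<theta> (g \<otimes>\<^bsub>G\<^esub> \<theta> x)) ` carrier G)"
  proof (rule a.H.left_translations_normalize[OF grp bij, where u = ?u and v = ?v])
    fix \<gamma> x assume gx: "\<gamma> \<in> carrier ?\<Gamma>" "x \<in> carrier ?\<Gamma>"
    have "h (\<gamma> \<otimes>\<^bsub>?\<Gamma>\<^esub> x) = (fst (h \<gamma>) \<otimes>\<^bsub>A\<^esub> fst (h x), snd (h \<gamma>) \<otimes>\<^bsub>B\<^esub> snd (h x))"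
      using hmult[OF gx] by (simp add: DirProd_def split_def)
    then show "\<theta> (\<gamma> \<otimes>\<^bsub>?\<Gamma>\<^esub> x) = ?u \<gamma> \<otimes>\<^bsub>G\<^esub> \<theta> x \<otimes>\<^bsub>G\<^esub> ?v \<gamma>"
      using m_mult[of "fst (h \<gamma>)" "snd (h \<gamma>)" "fst (h x)" "snd (h x)"] hin gx by (simp add: \<theta>_def)
  next
    fix \<gamma> assume "\<gamma> \<in> carrier ?\<Gamma>"
    then show "?u \<gamma> \<in> carrier G \<and> ?v \<gamma> \<in> carrier G"
      using hin by (intro conjI a.hom_closed a.H.inv_closed b.hom_closed)
  qed
  with T(4,5) show ?thesis
    unfolding admits_hopf_galois_structure_of_type_def Let_def by metis
qed

section \<open>Special linear groups over prime fields\<close>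

abbreviation reduce_mat :: "nat \<Rightarrow> int mat \<Rightarrow> int mat" where
  "reduce_mat p \<equiv> map_mat (\<lambda>x. x mod int p)"

lemma carrier_SL_iff:
  "A \<in> carrier (SL m p) \<longleftrightarrow> A \<in> carrier_mat m m \<and>
     (\<forall>i<m. \<forall>j<m. A $$ (i, j) \<in> {0..<int p}) \<and> det A mod int p = 1"
  by (auto simp: SL_def elements_mat_def UN_subset_iff image_subset_iff)

lemma mult_SL: "mult (SL m p) = (\<lambda>A B. reduce_mat p (A * B))"
  and one_SL: "one (SL m p) = 1\<^sub>m m"
  by (simp_all add: SL_def)

lemma reduce_mat_idem: "A \<in> carrier (SL m p) \<Longrightarrow> reduce_mat p A = A"
  by (rule eq_matI) (auto simp: carrier_SL_iff)

lemma reduce_mat_eq_iff: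
  assumes "A \<in> carrier_mat n m" "B \<in> carrier_mat n m"
  shows "reduce_mat p A = reduce_mat p B \<longleftrightarrow> (\<forall>i<n. \<forall>j<m. [A $$ (i, j) = B $$ (i, j)] (mod int p))"
  using assms by (auto simp: mat_eq_iff cong_def)

lemma reduce_mat_mult:
  assumes "A \<in> carrier_mat n m" "B \<in> carrier_mat m k"
  shows "reduce_mat p (reduce_mat p A * B) = reduce_mat p (A * B)"
    and "reduce_mat p (A * reduce_mat p B) = reduce_mat p (A * B)"
proof -
  have [simp]: "[x mod int p = x] (mod int p)" for x by (simp add: cong_def)
  show "reduce_mat p (reduce_mat p A * B) = reduce_mat p (A * B)"
    using assms by (subst reduce_mat_eq_iff[of _ n k])
      (auto simp: scalar_prod_def intro!: cong_sum cong_mult)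
  show "reduce_mat p (A * reduce_mat p B) = reduce_mat p (A * B)"
    using assms by (subst reduce_mat_eq_iff[of _ n k])
      (auto simp: scalar_prod_def intro!: cong_sum cong_mult)
qed

lemma det_reduce_mat:
  assumes "A \<in> carrier_mat n n"
  shows "[det (reduce_mat p A) = det A] (mod int p)"
proof -
  have [simp]: "[x mod int p = x] (mod int p)" for x by (simp add: cong_def)
  show ?thesis
    using assms by (auto simp: det_def permutes_in_image intro!: cong_sum cong_mult cong_prod)
qed

lemma reduce_mat_in_SL:
  assumes "A \<in> carrier_mat m m" "[det A = 1] (mod int p)" "p > 1"
  shows "reduce_mat p A \<in> carrier (SL m p)"
  using assms det_reduce_mat[OF assms(1), of p]
  by (auto simp: carrier_SL_iff cong_def)

lemma finite_carrier_SL: "finite (carrier (SL m p))"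
proof -
  let ?f = "\<lambda>A. \<lambda>(i,j)\<in>{..<m} \<times> {..<m}. (A :: int mat) $$ (i, j)"
  have "?f ` carrier (SL m p) \<subseteq> ({..<m} \<times> {..<m}) \<rightarrow>\<^sub>E {0..<int p}"
    by (auto simp: carrier_SL_iff)
  moreover have "finite (({..<m} \<times> {..<m}) \<rightarrow>\<^sub>E {0..<int p})"
    by (intro finite_PiE) auto
  moreover have "inj_on ?f (carrier (SL m p))"
  proof (rule inj_onI)
    fix A B assume AB: "A \<in> carrier (SL m p)" "B \<in> carrier (SL m p)" "?f A = ?f B"
    have "A $$ (i, j) = B $$ (i, j)" if "i < m" "j < m" for i j
      using fun_cong[OF AB(3), of "(i, j)"] that by simp
    then show "A = B" using AB(1,2) by (intro eq_matI) (auto simp: carrier_SL_iff)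
  qed
  ultimately show ?thesis using finite_imageD finite_subset by blast
qed

lemma group_SL:
  assumes p: "p > 1"
  shows "group (SL m p)"
proof (rule groupI)
  have detm: "[det (A * B) = 1] (mod int p)" if "A \<in> carrier (SL m p)" "B \<in> carrier (SL m p)" for A B
    using that p det_mult[of A m B] cong_mult[of "det A" 1 "int p" "det B" 1]
    by (auto simp: carrier_SL_iff cong_def)
  then show "A \<otimes>\<^bsub>SL m p\<^esub> B \<in> carrier (SL m p)"
    if "A \<in> carrier (SL m p)" "B \<in> carrier (SL m p)" for A B
    using that p reduce_mat_in_SL[of "A * B" m p] by (auto simp: mult_SL carrier_SL_iff)
  show one: "\<one>\<^bsub>SL m p\<^esub> \<in> carrier (SL m p)"
    using p by (auto simp: one_SL carrier_SL_iff)
  show "A \<otimes>\<^bsub>SL m p\<^esub> B \<otimes>\<^bsub>SL m p\<^esub> C = A \<otimes>\<^bsub>SL m p\<^esub> (B \<otimes>\<^bsub>SL m p\<^esub> C)"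
    if "A \<in> carrier (SL m p)" "B \<in> carrier (SL m p)" "C \<in> carrier (SL m p)" for A B C
  proof -
    have "A \<in> carrier_mat m m" "B \<in> carrier_mat m m" "C \<in> carrier_mat m m"
      using that by (auto simp: carrier_SL_iff)
    then show ?thesis
      by (simp add: mult_SL reduce_mat_mult[of _ m m _ m] assoc_mult_mat[of _ m m _ m _ m])
  qed
  show "\<one>\<^bsub>SL m p\<^esub> \<otimes>\<^bsub>SL m p\<^esub> A = A" if "A \<in> carrier (SL m p)" for A
    using that reduce_mat_idem[OF that] by (auto simp: mult_SL one_SL carrier_SL_iff)
  show "\<exists>B\<in>carrier (SL m p). B \<otimes>\<^bsub>SL m p\<^esub> A = \<one>\<^bsub>SL m p\<^esub>" if A: "A \<in> carrier (SL m p)" for A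
  proof -
    have Am: "A \<in> carrier_mat m m" and dA: "[det A = 1] (mod int p)"
      using A p by (auto simp: carrier_SL_iff cong_def)
    \<comment> \<open>The adjugate is an integer matrix with product det A times the identity, so it
      inverts A modulo p without division. Its own determinant is 1 modulo p because that product
      has determinant 1 modulo p.\<close>
    let ?B = "adj_mat A"
    note adj = adj_mat[OF Am]
    have prod: "reduce_mat p (?B * A) = 1\<^sub>m m"
    proof (rule eq_matI)
      fix i j assume ij: "i < dim_row (1\<^sub>m m :: int mat)" "j < dim_col (1\<^sub>m m :: int mat)"
      then show "reduce_mat p (?B * A) $$ (i, j) = 1\<^sub>m m $$ (i, j)"
        using adj(3) dA p Am by (auto simp: cong_def)
    qed (use adj Am in auto)
    have "[det ?B * det A = 1] (mod int p)"
    proof -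
      have "det ?B * det A = det (?B * A)" using det_mult[OF adj(1) Am] by simp
      moreover have "[det (?B * A) = det (reduce_mat p (?B * A))] (mod int p)"
        using adj(1) Am by (intro cong_sym[OF det_reduce_mat[of _ m]]) auto
      ultimately show ?thesis unfolding prod by simp
    qed
    moreover have "[det ?B * det A = det ?B * 1] (mod int p)"
      using dA by (intro cong_mult) auto
    ultimately have "[det ?B = 1] (mod int p)" by (metis cong_sym cong_trans mult.right_neutral)
    then have "reduce_mat p ?B \<in> carrier (SL m p)" using adj(1) p by (intro reduce_mat_in_SL)
    moreover have "reduce_mat p ?B \<otimes>\<^bsub>SL m p\<^esub> A = \<one>\<^bsub>SL m p\<^esub>"
      using reduce_mat_mult(1)[OF adj(1) Am] prod by (simp add: mult_SL one_SL)
    ultimately show ?thesis by blast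
  qed
qed

lemma normal_SL_scalars:
  assumes p: "p > 1" and m: "m > 0"
  shows "SL_scalars m p \<lhd> SL m p"
proof -
  interpret G: group "SL m p" by (rule group_SL[OF p])
  have comm: "A \<otimes>\<^bsub>SL m p\<^esub> Y = Y \<otimes>\<^bsub>SL m p\<^esub> A" if "A \<in> SL_scalars m p" "Y \<in> carrier (SL m p)" for A Y
  proof -
    obtain a where a: "A = a \<cdot>\<^sub>m 1\<^sub>m m" using \<open>A \<in> SL_scalars m p\<close> by (auto simp: SL_scalars_def)
    have "Y \<in> carrier_mat m m" using that by (auto simp: carrier_SL_iff)
    then show ?thesis by (simp add: mult_SL a mult_smult_assoc_mat[of _ m m _ m] mult_smult_distrib[of _ m m _ m])
  qed
  have sub: "subgroup (SL_scalars m p) (SL m p)"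
  proof (rule G.subgroupI)
    show "SL_scalars m p \<subseteq> carrier (SL m p)" by (auto simp: SL_scalars_def)
    have "1\<^sub>m m \<in> SL_scalars m p"
      using G.one_closed by (auto simp: SL_scalars_def one_SL intro!: exI[of _ 1] eq_matI)
    then show "SL_scalars m p \<noteq> {}" by blast
  next
    fix A assume A: "A \<in> SL_scalars m p"
    then have AG: "A \<in> carrier (SL m p)" by (auto simp: SL_scalars_def)
    obtain a where a: "A = a \<cdot>\<^sub>m 1\<^sub>m m" using A by (auto simp: SL_scalars_def)
    define Y where "Y = inv\<^bsub>SL m p\<^esub> A"
    have Y: "Y \<in> carrier (SL m p)" unfolding Y_def using AG by simp
    then have Ym: "Y \<in> carrier_mat m m" and Yr: "\<And>i j. i < m \<Longrightarrow> j < m \<Longrightarrow> Y $$ (i, j) \<in> {0..<int p}"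
      by (auto simp: carrier_SL_iff)
    have "A \<otimes>\<^bsub>SL m p\<^esub> Y = 1\<^sub>m m" unfolding Y_def using AG by (simp add: one_SL)
    then have "reduce_mat p (a \<cdot>\<^sub>m Y) = 1\<^sub>m m"
      using Ym by (simp add: mult_SL a mult_smult_assoc_mat[of _ m m _ m])
    then have aY: "[a * Y $$ (i, j) = (if i = j then 1 else 0)] (mod int p)" if "i < m" "j < m" for i j
      using that Ym p by (auto simp: mat_eq_iff cong_def)
    \<comment> \<open>The congruences say that a Y is the identity modulo p. So \<open>?x\<close>
      inverts a, and multiplying by it shows that Y is the scalar \<open>?x\<close>.\<close>
    let ?x = "Y $$ (0, 0)"
    have "Y $$ (i, j) = (if i = j then ?x else 0)" if ij: "i < m" "j < m" for i j
    proof -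
      have "[Y $$ (i, j) = Y $$ (i, j) * (a * ?x)] (mod int p)"
        using cong_mult[OF cong_refl aY[OF m m], of "Y $$ (i, j)"] by (simp add: cong_sym)
      also have "Y $$ (i, j) * (a * ?x) = ?x * (a * Y $$ (i, j))" by simp
      also have "[?x * (a * Y $$ (i, j)) = ?x * (if i = j then 1 else 0)] (mod int p)"
        using aY[OF ij] by (intro cong_mult) auto
      finally have "[Y $$ (i, j) = (if i = j then ?x else 0)] (mod int p)"
        by (cases "i = j") auto
      then show ?thesis using Yr[OF ij] Yr[OF m m] p by (auto simp: cong_def)
    qed
    then obtain y where "\<And>i j. i < m \<Longrightarrow> j < m \<Longrightarrow> Y $$ (i, j) = (if i = j then y else 0)" by blast
    then have "Y = y \<cdot>\<^sub>m 1\<^sub>m m" using Ym by (intro eq_matI) auto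
    then show "inv\<^bsub>SL m p\<^esub> A \<in> SL_scalars m p" using Y by (auto simp: SL_scalars_def Y_def)
  next
    fix A B assume AB: "A \<in> SL_scalars m p" "B \<in> SL_scalars m p"
    then obtain a b where ab: "A = a \<cdot>\<^sub>m 1\<^sub>m m" "B = b \<cdot>\<^sub>m 1\<^sub>m m" by (auto simp: SL_scalars_def)
    have "A \<otimes>\<^bsub>SL m p\<^esub> B = (a * b mod int p) \<cdot>\<^sub>m 1\<^sub>m m"
      by (rule eq_matI) (auto simp: mult_SL ab mult_smult_assoc_mat[of _ m m _ m])
    moreover have "A \<otimes>\<^bsub>SL m p\<^esub> B \<in> carrier (SL m p)" using AB by (auto simp: SL_scalars_def)
    ultimately show "A \<otimes>\<^bsub>SL m p\<^esub> B \<in> SL_scalars m p" by (auto simp: SL_scalars_def)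
  qed
  show ?thesis
  proof (rule G.normal_invI[OF sub])
    fix Y A assume YA: "Y \<in> carrier (SL m p)" "A \<in> SL_scalars m p"
    then have "Y \<otimes>\<^bsub>SL m p\<^esub> A \<otimes>\<^bsub>SL m p\<^esub> inv\<^bsub>SL m p\<^esub> Y = A"
      using comm[OF YA(2,1)] by (auto simp: SL_scalars_def G.m_assoc simp flip: comm)
    then show "Y \<otimes>\<^bsub>SL m p\<^esub> A \<otimes>\<^bsub>SL m p\<^esub> inv\<^bsub>SL m p\<^esub> Y \<in> SL_scalars m p" using YA by simp
  qed
qed

lemma group_PSL: "p > 1 \<Longrightarrow> m > 0 \<Longrightarrow> group (PSL m p)"
  unfolding PSL_def by (intro normal.factorgroup_is_group normal_SL_scalars)

section \<open>Normal subgroups of \<open>SL 2 p\<close>\<close>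

lemma det_2:
  assumes "A \<in> carrier_mat 2 2"
  shows "det A = A $$ (0, 0) * A $$ (1, 1) - A $$ (0, 1) * A $$ (1, 0)"
proof -
  have "mat_delete A 0 j \<in> carrier_mat 1 1" for j using assms by (simp add: mat_delete_def)
  then have "det A = (\<Sum>j<2. A $$ (0, j) * ((-1) ^ (0 + j) * mat_delete A 0 j $$ (0, 0)))"
    using assms by (simp add: laplace_expansion_row[of A 2 0] cofactor_def det_single)
  then show ?thesis
    using assms by (simp add: numeral_2_eq_2 mat_delete_def)
qed

definition sl2 :: "nat \<Rightarrow> int \<Rightarrow> int \<Rightarrow> int \<Rightarrow> int \<Rightarrow> int mat" where
  "sl2 p a b c d = reduce_mat p (mat 2 2 (\<lambda>(i, j). if i = 0 then if j = 0 then a else b else if j = 0 then c else d))"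

abbreviation (input) mat2 :: "int \<Rightarrow> int \<Rightarrow> int \<Rightarrow> int \<Rightarrow> int mat" where
  "mat2 a b c d \<equiv> mat 2 2 (\<lambda>(i, j). if i = 0 then if j = 0 then a else b else if j = 0 then c else d)"

lemma less_2_cases_iff': "(\<forall>i<2. P i) \<longleftrightarrow> P 0 \<and> P (1::nat)"
  by (metis less_2_cases_iff One_nat_def)

lemma sl2_dim: "mat2 a b c d \<in> carrier_mat 2 2"
  by auto

lemma sl2_eq_iff: "sl2 p a b c d = sl2 p a' b' c' d' \<longleftrightarrow>
    [a = a'] (mod int p) \<and> [b = b'] (mod int p) \<and> [c = c'] (mod int p) \<and> [d = d'] (mod int p)"
  unfolding sl2_def reduce_mat_eq_iff[OF sl2_dim sl2_dim]
  by (auto simp: less_2_cases_iff')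

lemma sl2_in_carrier:
  assumes "p > 1" "[a * d - b * c = 1] (mod int p)"
  shows "sl2 p a b c d \<in> carrier (SL 2 p)"
  unfolding sl2_def using assms sl2_dim
  by (intro reduce_mat_in_SL) (auto simp: det_2)

lemma sl2_cases:
  assumes "A \<in> carrier (SL 2 p)"
  obtains a b c d where "A = sl2 p a b c d" "[a * d - b * c = 1] (mod int p)"
    "{a, b, c, d} \<subseteq> {0..<int p}"
proof
  show "A = sl2 p (A $$ (0, 0)) (A $$ (0, 1)) (A $$ (1, 0)) (A $$ (1, 1))"
    using assms by (auto simp: carrier_SL_iff mat_eq_iff sl2_def less_2_cases_iff)
  show "[A $$ (0, 0) * A $$ (1, 1) - A $$ (0, 1) * A $$ (1, 0) = 1] (mod int p)"
    using assms by (auto simp: carrier_SL_iff det_2 cong_def) (metis mod_mod_trivial)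
qed (use assms in \<open>auto simp: carrier_SL_iff\<close>)

lemma sl2_mult: "sl2 p a b c d \<otimes>\<^bsub>SL 2 p\<^esub> sl2 p a' b' c' d' =
    sl2 p (a * a' + b * c') (a * b' + b * d') (c * a' + d * c') (c * b' + d * d')"
proof -
  have "mat2 a b c d * mat2 a' b' c' d'
      = mat2 (a * a' + b * c') (a * b' + b * d') (c * a' + d * c') (c * b' + d * d')"
    by (rule eq_matI)
      (auto simp: scalar_prod_def less_2_cases_iff numeral_2_eq_2)
  moreover have "reduce_mat p (mat2 a b c d) \<in> carrier_mat 2 2"
    using sl2_dim by simp
  ultimately show ?thesis
    using reduce_mat_mult[OF sl2_dim sl2_dim] reduce_mat_mult(2)[of "sl2 p a b c d" 2 2 _ 2 p, OF _ sl2_dim]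
    by (simp add: sl2_def mult_SL)
qed

lemma sl2_one: "p > 1 \<Longrightarrow> \<one>\<^bsub>SL 2 p\<^esub> = sl2 p 1 0 0 1"
  unfolding one_SL sl2_def
  by (rule eq_matI) (auto simp: less_2_cases_iff)

lemma sl2_inv:
  assumes p: "p > 1" and "[a * d - b * c = 1] (mod int p)"
  shows "inv\<^bsub>SL 2 p\<^esub> (sl2 p a b c d) = sl2 p d (- b) (- c) a"
proof -
  interpret G: group "SL 2 p" by (rule group_SL[OF p])
  have "[d * a + - b * c = 1] (mod int p)" "[- c * b + a * d = 1] (mod int p)"
    using assms(2) by (simp_all add: mult.commute)
  then show ?thesis
    using assms by (intro G.inv_equality sl2_in_carrier)
      (auto simp: sl2_mult sl2_one sl2_eq_iff mult.commute)
qed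

lemma cong_inverse_prime:
  fixes c :: int
  assumes "Factorial_Ring.prime p" "\<not> [c = 0] (mod int p)"
  obtains c' where "[c * c' = 1] (mod int p)"
proof -
  have "coprime c (int p)"
    using assms by (metis cong_0_iff coprime_commute prime_imp_coprime prime_nat_int_transfer)
  then show ?thesis using that cong_solve_coprime_int by blast
qed

lemma not_cong_1_0: "Factorial_Ring.prime p \<Longrightarrow> \<not> [1 = 0] (mod int p)"
  using prime_gt_1_nat[of p] by (simp add: cong_def)

text \<open>If the lower left entry c is a unit, the element is upper times lower times upper with
  parameters (a - 1)/c, c, (d - 1)/c. If c = 0 then a is a unit, and adding the first row to the
  second leads to the first case. Closure of \<open>H\<close> under products is enough, which suits
  sets that are not yet known to be subgroups.\<close>

lemma transvections_generate_SL2: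
  assumes p: "Factorial_Ring.prime p"
    and closed: "\<And>A B. A \<in> H \<Longrightarrow> B \<in> H \<Longrightarrow> A \<otimes>\<^bsub>SL 2 p\<^esub> B \<in> H"
    and upper: "\<And>t. sl2 p 1 t 0 1 \<in> H" and lower: "\<And>t. sl2 p 1 0 t 1 \<in> H"
  shows "carrier (SL 2 p) \<subseteq> H"
proof
  have main: "sl2 p a b c d \<in> H" if det: "[a * d - b * c = 1] (mod int p)" and c: "\<not> [c = 0] (mod int p)"
    for a b c d
  proof -
    obtain c' where c': "[c * c' = 1] (mod int p)" using cong_inverse_prime[OF p c] .
    have "sl2 p a b c d = sl2 p 1 ((a - 1) * c') 0 1 \<otimes>\<^bsub>SL 2 p\<^esub> sl2 p 1 0 c 1 \<otimes>\<^bsub>SL 2 p\<^esub> sl2 p 1 ((d - 1) * c') 0 1"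
      unfolding sl2_mult sl2_eq_iff using det c' unfolding cong_iff_dvd_diff by (intro conjI; (simp; fail | Groebner_Basis.algebra))
    then show ?thesis using closed upper lower by simp
  qed
  fix A assume "A \<in> carrier (SL 2 p)"
  then obtain a b c d where A: "A = sl2 p a b c d" and det: "[a * d - b * c = 1] (mod int p)"
    by (rule sl2_cases)
  show "A \<in> H"
  proof (cases "[c = 0] (mod int p)")
    case True
    have "\<not> [c + a = 0] (mod int p)"
    proof
      assume "[c + a = 0] (mod int p)"
      then have "[1 = 0] (mod int p)" using True det unfolding cong_iff_dvd_diff by Groebner_Basis.algebra
      then show False using not_cong_1_0[OF p] by simp
    qed
    moreover have "[a * (d + b) - b * (c + a) = 1] (mod int p)" using det by (simp add: algebra_simps)
    ultimately have "sl2 p a b (c + a) (d + b) \<in> H" by (rule main[rotated])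
    moreover have "A = sl2 p 1 0 (- 1) 1 \<otimes>\<^bsub>SL 2 p\<^esub> sl2 p a b (c + a) (d + b)"
      by (simp add: A sl2_mult)
    ultimately show ?thesis using closed lower by simp
  qed (use main A det in simp)
qed

text \<open>
  Conjugation turns a nonscalar element of \<open>N\<close> into one with entries \<open>0, - 1/c, c, e\<close>. Its
  commutator with \<open>diag (2, 1/2)\<close> is upper triangular with diagonal \<open>1/4, 4\<close>, and the commutators
  of that element with transvections give all upper transvections, unless \<open>16 = 1\<close>, that is,
  unless \<open>p\<close> divides \<open>15\<close>.
\<close>
lemma normal_SL2_nonscalar:
  assumes p: "Factorial_Ring.prime p" "p \<ge> 7"
    and N: "N \<lhd> SL 2 p" and A: "A \<in> N" "A \<notin> SL_scalars 2 p"
  shows "N = carrier (SL 2 p)"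
proof -
  have p1: "p > 1" using p by simp
  interpret N: normal N "SL 2 p" by (rule N)
  have conj: "sl2 p a b c d \<otimes>\<^bsub>SL 2 p\<^esub> B \<otimes>\<^bsub>SL 2 p\<^esub> sl2 p d (- b) (- c) a \<in> N"
    if "B \<in> N" "[a * d - b * c = 1] (mod int p)" for a b c d B
    using N.inv_op_closed2[OF sl2_in_carrier[OF p1 that(2)] that(1)] sl2_inv[OF p1 that(2)] by simp
  have inv: "sl2 p d (- b) (- c) a \<in> N"
    if "sl2 p a b c d \<in> N" "[a * d - b * c = 1] (mod int p)" for a b c d
    using subgroup.m_inv_closed[OF normal_imp_subgroup[OF N] that(1)] sl2_inv[OF p1 that(2)] by simp
  note closed = subgroup.m_closed[OF normal_imp_subgroup[OF N]]
  obtain a b c d where A_def: "A = sl2 p a b c d" and det: "[a * d - b * c = 1] (mod int p)"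
    using N.subset A(1) sl2_cases by (metis subsetD)
  have "\<exists>a b c d. sl2 p a b c d \<in> N \<and> [a * d - b * c = 1] (mod int p) \<and> \<not> [c = 0] (mod int p)"
  proof -
    \<comment> \<open>The aim is an invertible lower left entry. A nonzero b is moved there by
      conjugation with the Weyl element; a nonscalar diagonal element gets a - d there by
      conjugation with a lower transvection.\<close>
    consider "\<not> [c = 0] (mod int p)" | "\<not> [b = 0] (mod int p)"
      | "[b = 0] (mod int p)" "[c = 0] (mod int p)" "\<not> [a = d] (mod int p)"
      | "[b = 0] (mod int p)" "[c = 0] (mod int p)" "[a = d] (mod int p)" by blast
    then show ?thesis
    proof cases
      case 2
      have "sl2 p 0 1 (- 1) 0 \<otimes>\<^bsub>SL 2 p\<^esub> sl2 p a b c d \<otimes>\<^bsub>SL 2 p\<^esub> sl2 p 0 (- 1) (- (- 1)) 0 \<in> N"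
        using A(1) by (intro conj) (auto simp: A_def)
      then have "sl2 p d (- c) (- b) a \<in> N" by (simp add: sl2_mult)
      moreover have "[d * a - - c * - b = 1] (mod int p)" using det by (simp add: mult.commute)
      moreover have "\<not> [- b = 0] (mod int p)" using 2 by (simp add: cong_0_iff)
      ultimately show ?thesis by blast
    next
      case 3
      have "sl2 p 1 0 1 1 \<otimes>\<^bsub>SL 2 p\<^esub> sl2 p a b c d \<otimes>\<^bsub>SL 2 p\<^esub> sl2 p 1 (- 0) (- 1) 1 \<in> N"
        using A(1) by (intro conj) (auto simp: A_def)
      then have "sl2 p (a - b) b (a + c - (b + d)) (b + d) \<in> N" by (simp add: sl2_mult algebra_simps)
      moreover have "[(a - b) * (b + d) - b * (a + c - (b + d)) = 1] (mod int p)"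
        using det by (simp add: algebra_simps)
      moreover have "\<not> [a + c - (b + d) = 0] (mod int p)"
      proof
        assume "[a + c - (b + d) = 0] (mod int p)"
        then have "[a = d] (mod int p)"
          using 3(1,2) unfolding cong_iff_dvd_diff by Groebner_Basis.algebra
        then show False using 3 by simp
      qed
      ultimately show ?thesis by blast
    next
      case 4
      have "A = sl2 p a 0 0 a" using 4 by (auto simp: A_def sl2_eq_iff cong_sym)
      also have "\<dots> = (a mod int p) \<cdot>\<^sub>m 1\<^sub>m 2" by (rule eq_matI) (auto simp: sl2_def)
      finally have False using A N.subset by (auto simp: SL_scalars_def)
      then show ?thesis ..
    qed (use A(1) A_def det in blast)
  qed
  then obtain a b c d where B: "sl2 p a b c d \<in> N" and det: "[a * d - b * c = 1] (mod int p)"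
    and c: "\<not> [c = 0] (mod int p)" by blast
  obtain c' where c': "[c * c' = 1] (mod int p)" using cong_inverse_prime[OF p(1) c] .
  \<comment> \<open>Conjugation by the upper transvection t adds t c to the upper left entry, so t =
    - a / c clears it.\<close>
  define t where "t = - a * c'"
  have "sl2 p 1 t 0 1 \<otimes>\<^bsub>SL 2 p\<^esub> sl2 p a b c d \<otimes>\<^bsub>SL 2 p\<^esub> sl2 p 1 (- t) (- 0) 1 \<in> N"
    using B by (intro conj) auto
  also have "sl2 p 1 t 0 1 \<otimes>\<^bsub>SL 2 p\<^esub> sl2 p a b c d \<otimes>\<^bsub>SL 2 p\<^esub> sl2 p 1 (- t) (- 0) 1 = sl2 p 0 (- c') c (d - t * c)"
    unfolding sl2_mult sl2_eq_iff t_def using det c' unfolding cong_iff_dvd_diff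
    by (intro conjI; ((simp; fail) | Groebner_Basis.algebra))
  finally obtain e where C: "sl2 p 0 (- c') c e \<in> N" by blast
  have detC: "[0 * e - - c' * c = 1] (mod int p)" using c' by (simp add: mult.commute)
  have "\<not> [2 = 0] (mod int p)" using p(2) by (auto simp: cong_def)
  then obtain h where h: "[2 * h = 1] (mod int p)" using cong_inverse_prime[OF p(1)] by blast
  \<comment> \<open>The first factor is the inverse of the element just found and the bracket is its
    conjugate by diag (2, h) with h = 1/2.\<close>
  have "sl2 p e (- (- c')) (- c) 0 \<otimes>\<^bsub>SL 2 p\<^esub>
      (sl2 p 2 0 0 h \<otimes>\<^bsub>SL 2 p\<^esub> sl2 p 0 (- c') c e \<otimes>\<^bsub>SL 2 p\<^esub> sl2 p h (- 0) (- 0) 2) \<in> N"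
    using C h detC by (intro closed inv conj) auto
  also have "sl2 p e (- (- c')) (- c) 0 \<otimes>\<^bsub>SL 2 p\<^esub>
      (sl2 p 2 0 0 h \<otimes>\<^bsub>SL 2 p\<^esub> sl2 p 0 (- c') c e \<otimes>\<^bsub>SL 2 p\<^esub> sl2 p h (- 0) (- 0) 2)
      = sl2 p (c * c' * (h * h)) ((2 * h) * (c' * e) - 4 * (c' * e)) 0 (4 * (c * c'))"
    unfolding sl2_mult by (simp add: algebra_simps)
  also have "\<dots> = sl2 p (1 * (h * h)) (1 * (c' * e) - 4 * (c' * e)) 0 (4 * 1)"
    unfolding sl2_eq_iff using h c' by (intro conjI cong_mult cong_diff cong_refl)
  finally obtain z where D: "sl2 p (h * h) z 0 4 \<in> N" by auto
  have detD: "[h * h * 4 - z * 0 = 1] (mod int p)"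
    using h unfolding cong_iff_dvd_diff by Groebner_Basis.algebra
  have "\<not> [- 15 = 0] (mod int p)"
  proof
    assume "[- 15 = 0] (mod int p)"
    then have "p dvd 3 * 5" by (simp add: cong_0_iff) presburger
    then have "p dvd 3 \<or> p dvd 5" using p(1) prime_dvd_mult_iff by blast
    then show False using p(2) by (auto dest!: dvd_imp_le)
  qed
  then obtain f where f: "[- 15 * f = 1] (mod int p)" using cong_inverse_prime[OF p(1)] by blast
  have upper: "sl2 p 1 s 0 1 \<in> N" for s
  proof -
    \<comment> \<open>Conjugation by an upper triangular element with diagonal 1/4, 4 divides t by
      16, so the commutator has entry t/16 - t = - 15 t/16. With f = - 1/15 this is s.\<close>
    define t where "t = 16 * f * s"
    have "sl2 p (h * h) z 0 4 \<otimes>\<^bsub>SL 2 p\<^esub>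
      (sl2 p 1 t 0 1 \<otimes>\<^bsub>SL 2 p\<^esub> sl2 p 4 (- z) (- 0) (h * h) \<otimes>\<^bsub>SL 2 p\<^esub> sl2 p 1 (- t) (- 0) 1) \<in> N"
      using D detD by (intro closed inv conj) auto
    also have "sl2 p (h * h) z 0 4 \<otimes>\<^bsub>SL 2 p\<^esub>
      (sl2 p 1 t 0 1 \<otimes>\<^bsub>SL 2 p\<^esub> sl2 p 4 (- z) (- 0) (h * h) \<otimes>\<^bsub>SL 2 p\<^esub> sl2 p 1 (- t) (- 0) 1) = sl2 p 1 s 0 1"
      unfolding sl2_mult sl2_eq_iff t_def using h f unfolding cong_iff_dvd_diff
      by (intro conjI; ((simp; fail) | Groebner_Basis.algebra))
    finally show ?thesis .
  qed
  have lower: "sl2 p 1 0 s 1 \<in> N" for s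
  proof -
    have "sl2 p 0 1 (- 1) 0 \<otimes>\<^bsub>SL 2 p\<^esub> sl2 p 1 (- s) 0 1 \<otimes>\<^bsub>SL 2 p\<^esub> sl2 p 0 (- 1) (- (- 1)) 0 \<in> N"
      using upper by (intro conj) auto
    then show ?thesis by (simp add: sl2_mult)
  qed
  show ?thesis
    using transvections_generate_SL2[OF p(1), of N] closed upper lower N.subset by blast
qed

section \<open>Simplicity and order of \<open>PSL 2 p\<close>\<close>

lemma (in normal) group_hom_FactGroup: "group_hom G (G Mod H) (\<lambda>a. H #> a)"
  unfolding group_hom_def group_hom_axioms_def
  using is_group factorgroup_is_group r_coset_hom_Mod by simp

lemma (in normal) coset_eq_one_iff:
  assumes "x \<in> carrier G"
  shows "H #> x = \<one>\<^bsub>G Mod H\<^esub> \<longleftrightarrow> x \<in> H"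
  using assms coset_join1[OF _ _ subgroup_axioms, of x] coset_join2[OF _ subgroup_axioms, of x] by auto

lemma (in normal) order_FactGroup:
  assumes "finite (carrier G)"
  shows "order (G Mod H) * card H = order G"
  using lagrange[OF subgroup_axioms] by (simp add: order_def FactGroup_def)

text \<open>A normal subgroup M of the quotient is pulled back to the kernel of the composite map
  from G to the quotient by M. If the pullback lies in H then M is trivial; otherwise it is all of G
  by \<open>max\<close>, and M is the whole quotient.\<close>

lemma (in normal) simple_FactGroup:
  assumes fin: "finite (carrier G)" and proper: "H \<noteq> carrier G"
    and max: "\<And>N. N \<lhd> G \<Longrightarrow> \<not> N \<subseteq> H \<Longrightarrow> N = carrier G"
  shows "simple_group (G Mod H)"
proof -
  let ?\<pi> = "\<lambda>a. H #> a"
  interpret Q: group_hom G "G Mod H" ?\<pi> by (rule group_hom_FactGroup)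
  have surj: "M = {H #> x | x. x \<in> carrier G \<and> H #> x \<in> M}" if "M \<subseteq> carrier (G Mod H)" for M
    using that by (auto simp: FactGroup_def RCOSETS_def)
  have finQ: "finite (carrier (G Mod H))"
  proof -
    have "carrier (G Mod H) = ?\<pi> ` carrier G" by (auto simp: FactGroup_def RCOSETS_def)
    then show ?thesis using fin by simp
  qed
  show ?thesis
  proof (intro simple_group.intro simple_group_axioms.intro)
    show "group (G Mod H)" by (rule factorgroup_is_group)
    obtain x where x: "x \<in> carrier G" "x \<notin> H" using proper subset by blast
    then have "{\<one>\<^bsub>G Mod H\<^esub>, H #> x} \<subseteq> carrier (G Mod H)" "\<one>\<^bsub>G Mod H\<^esub> \<noteq> H #> x"
      using coset_eq_one_iff[of x] Q.hom_closed[of x] Q.H.one_closed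
      by (metis empty_subsetI insert_subset, metis)
    then have "card {\<one>\<^bsub>G Mod H\<^esub>, H #> x} \<le> order (G Mod H)" "card {\<one>\<^bsub>G Mod H\<^esub>, H #> x} = 2"
      using finQ unfolding order_def by (blast intro: card_mono, simp)
    then show "order (G Mod H) > 1" by simp
  next
    fix M assume M: "M \<lhd> G Mod H"
    then interpret M: normal M "G Mod H" .
    let ?N = "{x \<in> carrier G. H #> x \<in> M}"
    interpret QM: group_hom G "(G Mod H) Mod M" "(\<lambda>a. M #>\<^bsub>G Mod H\<^esub> a) \<circ> ?\<pi>"
      unfolding group_hom_def group_hom_axioms_def
      using is_group M.factorgroup_is_group Group.hom_compose[OF r_coset_hom_Mod M.r_coset_hom_Mod] by simp
    have "?N = kernel G ((G Mod H) Mod M) ((\<lambda>a. M #>\<^bsub>G Mod H\<^esub> a) \<circ> ?\<pi>)"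
      unfolding kernel_def using M.coset_eq_one_iff[OF Q.hom_closed] by auto
    then have N: "?N \<lhd> G" using QM.normal_kernel by simp
    show "M = carrier (G Mod H) \<or> M = {\<one>\<^bsub>G Mod H\<^esub>}"
    proof (cases "?N \<subseteq> H")
      case True
      then have "M \<subseteq> {\<one>\<^bsub>G Mod H\<^esub>}" using surj[OF M.subset] coset_eq_one_iff by blast
      then show ?thesis using M.one_closed by blast
    next
      case False
      then have "?N = carrier G" using max[OF N] by simp
      then have "carrier (G Mod H) \<subseteq> M" by (auto simp: FactGroup_def RCOSETS_def)
      then show ?thesis using M.subset by blast
    qed
  qed
qed

text \<open>A scalar a of determinant 1 satisfies (a - 1) (a + 1) = 0, and p is prime.\<close>

lemma sl2_scalar_iff:
  assumes p: "Factorial_Ring.prime p" and det: "[a * d - b * c = 1] (mod int p)"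
  shows "sl2 p a b c d \<in> SL_scalars 2 p \<longleftrightarrow>
    sl2 p a b c d = sl2 p 1 0 0 1 \<or> sl2 p a b c d = sl2 p (- 1) 0 0 (- 1)"
proof
  assume A: "sl2 p a b c d \<in> SL_scalars 2 p"
  then obtain s where s: "sl2 p a b c d = s \<cdot>\<^sub>m 1\<^sub>m 2" by (auto simp: SL_scalars_def)
  have "sl2 p a b c d $$ (i, j) = (s \<cdot>\<^sub>m 1\<^sub>m 2) $$ (i, j)" if "i < 2" "j < 2" for i j
    using s by simp
  from this[of 0 0] this[of 0 1] this[of 1 0] this[of 1 1]
  have e: "[b = 0] (mod int p)" "[c = 0] (mod int p)" "[a = d] (mod int p)"
    by (auto simp: sl2_def cong_def)
  then have "int p dvd (a - 1) * (a + 1)"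
    using det unfolding cong_iff_dvd_diff by Groebner_Basis.algebra
  then have "[a = 1] (mod int p) \<or> [a = - 1] (mod int p)"
    using p by (simp add: prime_dvd_mult_iff cong_iff_dvd_diff)
  then show "sl2 p a b c d = sl2 p 1 0 0 1 \<or> sl2 p a b c d = sl2 p (- 1) 0 0 (- 1)"
    unfolding sl2_eq_iff using e by (meson cong_sym cong_trans)
next
  have p1: "p > 1" using p by (rule prime_gt_1_nat)
  have *: "sl2 p x 0 0 x = (x mod int p) \<cdot>\<^sub>m 1\<^sub>m 2" for x by (rule eq_matI) (auto simp: sl2_def)
  have "sl2 p 1 0 0 1 \<in> SL_scalars 2 p" "sl2 p (- 1) 0 0 (- 1) \<in> SL_scalars 2 p"
    unfolding SL_scalars_def using sl2_in_carrier[OF p1] *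
    by (metis (mono_tags, lifting) cong_refl diff_zero mem_Collect_eq mult_1 mult_minus1 minus_minus mult_zero_left)+
  then show "sl2 p a b c d \<in> SL_scalars 2 p"
    if "sl2 p a b c d = sl2 p 1 0 0 1 \<or> sl2 p a b c d = sl2 p (- 1) 0 0 (- 1)"
    using that by auto
qed

theorem simple_PSL2:
  assumes p: "Factorial_Ring.prime p" "p \<ge> 7"
  shows "simple_group (PSL 2 p)"
proof -
  have p1: "p > 1" using p by simp
  interpret Z: normal "SL_scalars 2 p" "SL 2 p" by (rule normal_SL_scalars[OF p1]) simp
  have "sl2 p 1 1 0 1 \<in> carrier (SL 2 p)" using p1 by (intro sl2_in_carrier) auto
  moreover have "sl2 p 1 1 0 1 \<notin> SL_scalars 2 p"
    using p not_cong_1_0[OF p(1)] by (auto simp: sl2_scalar_iff sl2_eq_iff)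
  ultimately have "SL_scalars 2 p \<noteq> carrier (SL 2 p)" by auto
  then show ?thesis unfolding PSL_def
    using normal_SL2_nonscalar[OF p] by (intro Z.simple_FactGroup finite_carrier_SL) blast+
qed

lemma order_SL2:
  assumes p: "Factorial_Ring.prime p"
  shows "order (SL 2 p) = (p - 1) * p * (p + 1)"
proof -
  have p1: "p > 1" using p by (rule prime_gt_1_nat)
  obtain iv where iv: "\<And>c. \<not> [c = 0] (mod int p) \<Longrightarrow> [c * iv c = 1] (mod int p)"
  proof
    show "[c * (SOME c'. [c * c' = 1] (mod int p)) = 1] (mod int p)" if "\<not> [c = 0] (mod int p)" for c
    proof -
      obtain c' where "[c * c' = 1] (mod int p)" using cong_inverse_prime[OF p \<open>\<not> [c = 0] (mod int p)\<close>] .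
      then show ?thesis by (rule someI)
    qed
  qed
  let ?f = "\<lambda>(a, d, c). sl2 p a ((a * d - 1) * iv c) c d" and ?g = "\<lambda>(a, b). sl2 p a b 0 (iv a)"
  let ?R = "{0..<int p}" and ?U = "{1..<int p}"
  have unit: "\<not> [x = 0] (mod int p)" if "x \<in> ?U" for x using that by (auto simp: cong_def)
  have R_eq: "x = y" if "[x = y] (mod int p)" "x \<in> ?R" "y \<in> ?R" for x y
    using that by (simp add: cong_def)
  have UR: "x \<in> ?R" if "x \<in> ?U" for x using that by simp
  \<comment> \<open>The matrices with lower left entry \<open>c \<noteq> 0\<close> come from \<open>?f\<close>, those with \<open>c = 0\<close> from \<open>?g\<close>.\<close>
  have "carrier (SL 2 p) = ?f ` (?R \<times> ?R \<times> ?U) \<union> ?g ` (?U \<times> ?R)"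
  proof (intro equalityI subsetI)
    fix A assume "A \<in> carrier (SL 2 p)"
    then obtain a b c d where A: "A = sl2 p a b c d" and det: "[a * d - b * c = 1] (mod int p)"
      and R: "{a, b, c, d} \<subseteq> {0..<int p}" by (rule sl2_cases)
    have nz: "x \<in> ?U" if "\<not> [x = 0] (mod int p)" "x \<in> {a, c}" for x
      using that R by (cases "x = 0") auto
    show "A \<in> ?f ` (?R \<times> ?R \<times> ?U) \<union> ?g ` (?U \<times> ?R)"
    proof (cases "[c = 0] (mod int p)")
      case False
      have "A = ?f (a, d, c)"
        unfolding A split sl2_eq_iff using iv[OF False] det unfolding cong_iff_dvd_diff
        by (intro conjI; (simp; fail | Groebner_Basis.algebra))
      then show ?thesis using nz[OF False] R by blast
    next
      case True
      have a: "\<not> [a = 0] (mod int p)"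
      proof
        assume "[a = 0] (mod int p)"
        then have "[1 = 0] (mod int p)"
          using True det unfolding cong_iff_dvd_diff by Groebner_Basis.algebra
        then show False using not_cong_1_0[OF p] by simp
      qed
      have "[d = iv a] (mod int p)"
        using True iv[OF a] det unfolding cong_iff_dvd_diff by Groebner_Basis.algebra
      then have "A = ?g (a, b)" using True by (simp add: A sl2_eq_iff)
      then show ?thesis using nz[OF a] R by blast
    qed
  next
    fix A assume "A \<in> ?f ` (?R \<times> ?R \<times> ?U) \<union> ?g ` (?U \<times> ?R)"
    then show "A \<in> carrier (SL 2 p)"
    proof
      assume "A \<in> ?f ` (?R \<times> ?R \<times> ?U)"
      then obtain a d c where A: "A = sl2 p a ((a * d - 1) * iv c) c d" and c: "c \<in> ?U" by auto
      have "[a * d - ((a * d - 1) * iv c) * c = 1] (mod int p)"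
        using iv[OF unit[OF c]] unfolding cong_iff_dvd_diff by Groebner_Basis.algebra
      then show ?thesis unfolding A by (rule sl2_in_carrier[OF p1])
    next
      assume "A \<in> ?g ` (?U \<times> ?R)"
      then obtain a b where A: "A = sl2 p a b 0 (iv a)" and a: "a \<in> ?U" by auto
      show ?thesis unfolding A using iv[OF unit[OF a]] by (intro sl2_in_carrier[OF p1]) simp
    qed
  qed
  moreover have "?f ` (?R \<times> ?R \<times> ?U) \<inter> ?g ` (?U \<times> ?R) = {}"
  proof -
    have "?f x \<noteq> ?g y" if "x \<in> ?R \<times> ?R \<times> ?U" for x y
      using that unit by (auto simp: sl2_eq_iff split_def)
    then show ?thesis by blast
  qed
  moreover have "inj_on ?f (?R \<times> ?R \<times> ?U)" by (rule inj_onI) (auto simp: sl2_eq_iff intro!: R_eq)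
  moreover have "inj_on ?g (?U \<times> ?R)" by (rule inj_onI) (auto simp: sl2_eq_iff intro!: R_eq)
  ultimately have "order (SL 2 p) = card (?R \<times> ?R \<times> ?U) + card (?U \<times> ?R)"
    unfolding order_def by (simp add: card_Un_disjoint card_image)
  also have "\<dots> = p * (p * (p - 1)) + (p - 1) * p"
    using p1 by (simp add: card_cartesian_product nat_diff_distrib)
  also have "\<dots> = (p - 1) * p * (p + 1)" by (simp add: algebra_simps)
  finally show ?thesis .
qed

lemma order_PSL2:
  assumes p: "Factorial_Ring.prime p" "p > 2"
  shows "order (PSL 2 p) = (p - 1) * p * (p + 1) div 2"
proof -
  have p1: "p > 1" using p by simp
  interpret Z: normal "SL_scalars 2 p" "SL 2 p" by (rule normal_SL_scalars[OF p1]) simp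
  have "\<not> [1 = - 1] (mod int p)" using p(2) by (auto simp: cong_iff_dvd_diff dest: zdvd_imp_le)
  then have "card {sl2 p 1 0 0 1, sl2 p (- 1) 0 0 (- 1)} = 2" by (simp add: sl2_eq_iff)
  moreover have "SL_scalars 2 p = {sl2 p 1 0 0 1, sl2 p (- 1) 0 0 (- 1)}"
  proof
    show "{sl2 p 1 0 0 1, sl2 p (- 1) 0 0 (- 1)} \<subseteq> SL_scalars 2 p"
      using p(1) by (simp add: sl2_scalar_iff)
    show "SL_scalars 2 p \<subseteq> {sl2 p 1 0 0 1, sl2 p (- 1) 0 0 (- 1)}"
    proof
      fix A assume A: "A \<in> SL_scalars 2 p"
      then obtain a b c d where "A = sl2 p a b c d" "[a * d - b * c = 1] (mod int p)"
        using Z.subset sl2_cases by (metis subsetD)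
      then show "A \<in> {sl2 p 1 0 0 1, sl2 p (- 1) 0 0 (- 1)}" using A sl2_scalar_iff[OF p(1)] by auto
    qed
  qed
  ultimately have "order (PSL 2 p) * 2 = (p - 1) * p * (p + 1)"
    using Z.order_FactGroup[OF finite_carrier_SL] order_SL2[OF p(1)] by (simp add: PSL_def)
  then show ?thesis by (metis nonzero_mult_div_cancel_right zero_neq_numeral)
qed

section \<open>Semidirect products, dihedral groups and solvability\<close>

lemma semidirect_product_simps:
  "carrier (semidirect_product N H \<phi>) = carrier N \<times> carrier H"
  "mult (semidirect_product N H \<phi>) (a, h) (b, k) = (a \<otimes>\<^bsub>N\<^esub> \<phi> h b, h \<otimes>\<^bsub>H\<^esub> k)"
  "one (semidirect_product N H \<phi>) = (\<one>\<^bsub>N\<^esub>, \<one>\<^bsub>H\<^esub>)"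
  by (simp_all add: semidirect_product_def)

lemma hom_AutoGroupD:
  assumes \<phi>: "\<phi> \<in> hom H (AutoGroup N)" and h: "h \<in> carrier H"
  shows "\<phi> h \<in> hom N N" "\<phi> h \<in> Bij (carrier N)"
    and "a \<in> carrier N \<Longrightarrow> k \<in> carrier H \<Longrightarrow> \<phi> (h \<otimes>\<^bsub>H\<^esub> k) a = \<phi> h (\<phi> k a)"
proof -
  have *: "\<phi> x \<in> hom N N" "\<phi> x \<in> Bij (carrier N)" if "x \<in> carrier H" for x
    using \<phi> that by (auto simp: hom_def AutoGroup_def auto_def)
  then show "\<phi> h \<in> hom N N" "\<phi> h \<in> Bij (carrier N)" using h by auto
  assume "a \<in> carrier N" "k \<in> carrier H"
  moreover have "\<phi> (h \<otimes>\<^bsub>H\<^esub> k) = \<phi> h \<otimes>\<^bsub>AutoGroup N\<^esub> \<phi> k"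
    using \<phi> h \<open>k \<in> carrier H\<close> by (auto simp: hom_def)
  ultimately show "\<phi> (h \<otimes>\<^bsub>H\<^esub> k) a = \<phi> h (\<phi> k a)"
    using * h by (simp add: AutoGroup_def BijGroup_def compose_def)
qed

lemma group_semidirect_product:
  assumes N: "group N" and H: "group H" and \<phi>: "\<phi> \<in> hom H (AutoGroup N)"
  shows "group (semidirect_product N H \<phi>)"
proof -
  interpret N: group N by fact
  interpret H: group H by fact
  note \<phi>D = hom_AutoGroupD[OF \<phi>]
  have cl: "\<phi> h a \<in> carrier N" if "h \<in> carrier H" "a \<in> carrier N" for h a
    using \<phi>D(1)[OF that(1)] that(2) by (auto simp: hom_def)
  have mult: "\<phi> h (a \<otimes>\<^bsub>N\<^esub> b) = \<phi> h a \<otimes>\<^bsub>N\<^esub> \<phi> h b" if "h \<in> carrier H" "a \<in> carrier N" "b \<in> carrier N" for h a b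
    using \<phi>D(1)[OF that(1)] that(2,3) by (auto simp: hom_def)
  have one: "\<phi> \<one>\<^bsub>H\<^esub> a = a" if "a \<in> carrier N" for a
  proof -
    interpret P: group_hom H "AutoGroup N" \<phi>
      unfolding group_hom_def group_hom_axioms_def using \<phi> H N.AutoGroup by simp
    show ?thesis using P.hom_one that by (simp add: AutoGroup_def BijGroup_def)
  qed
  have one': "\<phi> h \<one>\<^bsub>N\<^esub> = \<one>\<^bsub>N\<^esub>" if "h \<in> carrier H" for h
    using mult[OF that N.one_closed N.one_closed] cl[OF that N.one_closed] by simp
  show ?thesis
  proof (rule groupI)
    fix x y z
    assume "x \<in> carrier (semidirect_product N H \<phi>)" "y \<in> carrier (semidirect_product N H \<phi>)"
      "z \<in> carrier (semidirect_product N H \<phi>)"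
    then show "x \<otimes>\<^bsub>semidirect_product N H \<phi>\<^esub> y \<otimes>\<^bsub>semidirect_product N H \<phi>\<^esub> z
        = x \<otimes>\<^bsub>semidirect_product N H \<phi>\<^esub> (y \<otimes>\<^bsub>semidirect_product N H \<phi>\<^esub> z)"
      by (auto simp: semidirect_product_simps cl mult \<phi>D(3) N.m_assoc H.m_assoc)
  next
    fix x assume "x \<in> carrier (semidirect_product N H \<phi>)"
    then obtain a h where x: "x = (a, h)" "a \<in> carrier N" "h \<in> carrier H"
      by (auto simp: semidirect_product_simps)
    let ?y = "(\<phi> (inv\<^bsub>H\<^esub> h) (inv\<^bsub>N\<^esub> a), inv\<^bsub>H\<^esub> h)"
    have "?y \<otimes>\<^bsub>semidirect_product N H \<phi>\<^esub> x = \<one>\<^bsub>semidirect_product N H \<phi>\<^esub>"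
      using x one' by (simp add: semidirect_product_simps flip: mult)
    moreover have "?y \<in> carrier (semidirect_product N H \<phi>)"
      using x cl by (simp add: semidirect_product_simps)
    ultimately show "\<exists>y\<in>carrier (semidirect_product N H \<phi>). y \<otimes>\<^bsub>semidirect_product N H \<phi>\<^esub> x = \<one>\<^bsub>semidirect_product N H \<phi>\<^esub>"
      by blast
  qed (auto simp: semidirect_product_simps cl one)
qed

lemma semidirect_product_hom:
  assumes N: "group N" and H: "group H" and \<phi>: "\<phi> \<in> hom H (AutoGroup N)"
    and \<alpha>: "group_hom N G \<alpha>" and \<beta>: "group_hom H G \<beta>"
    and conj: "\<And>a h. a \<in> carrier N \<Longrightarrow> h \<in> carrier H \<Longrightarrow> \<beta> h \<otimes>\<^bsub>G\<^esub> \<alpha> a = \<alpha> (\<phi> h a) \<otimes>\<^bsub>G\<^esub> \<beta> h"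
  shows "group_hom (semidirect_product N H \<phi>) G (\<lambda>(a, h). \<alpha> a \<otimes>\<^bsub>G\<^esub> \<beta> h)"
proof -
  interpret a: group_hom N G \<alpha> by fact
  interpret b: group_hom H G \<beta> by fact
  have cl: "\<phi> h a \<in> carrier N" if "h \<in> carrier H" "a \<in> carrier N" for h a
    using hom_AutoGroupD(1)[OF \<phi> that(1)] that(2) by (auto simp: hom_def)
  have "\<alpha> (a \<otimes>\<^bsub>N\<^esub> \<phi> h b) \<otimes>\<^bsub>G\<^esub> \<beta> (h \<otimes>\<^bsub>H\<^esub> k) = (\<alpha> a \<otimes>\<^bsub>G\<^esub> \<beta> h) \<otimes>\<^bsub>G\<^esub> (\<alpha> b \<otimes>\<^bsub>G\<^esub> \<beta> k)"
    if that: "a \<in> carrier N" "h \<in> carrier H" "b \<in> carrier N" "k \<in> carrier H" for a h b k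
  proof -
    have "\<alpha> (a \<otimes>\<^bsub>N\<^esub> \<phi> h b) \<otimes>\<^bsub>G\<^esub> \<beta> (h \<otimes>\<^bsub>H\<^esub> k) = \<alpha> a \<otimes>\<^bsub>G\<^esub> (\<alpha> (\<phi> h b) \<otimes>\<^bsub>G\<^esub> \<beta> h) \<otimes>\<^bsub>G\<^esub> \<beta> k"
      using that cl by (simp add: a.H.m_assoc)
    also have "\<dots> = \<alpha> a \<otimes>\<^bsub>G\<^esub> (\<beta> h \<otimes>\<^bsub>G\<^esub> \<alpha> b) \<otimes>\<^bsub>G\<^esub> \<beta> k" using conj[OF that(3,2)] by simp
    finally show ?thesis using that by (simp add: a.H.m_assoc)
  qed
  then show ?thesis
    unfolding group_hom_def group_hom_axioms_def hom_def
    using group_semidirect_product[OF N H \<phi>] by (auto simp: semidirect_product_simps)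
qed

lemma (in comm_group) solvable_comm_group: "solvable G"
proof -
  have "{\<one>} \<lhd> G" by (rule one_is_normal)
  moreover have "comm_group (G Mod {\<one>})" by (rule abelian_FactGroup[OF triv_subgroup])
  ultimately show ?thesis
    unfolding solvable_def by (intro solvable_seq.extension[OF solvable_seq.unity]) (auto intro: subgroup_self)
qed

lemma solvable_integer_mod_group: "solvable (integer_mod_group n)"
  using comm_group.solvable_comm_group abelian_integer_mod_group .

lemma solvable_semidirect_product:
  assumes N: "group N" and H: "group H" and \<phi>: "\<phi> \<in> hom H (AutoGroup N)"
    and sol: "solvable N" "solvable H"
  shows "solvable (semidirect_product N H \<phi>)"
proof (rule solvable_condition[OF _ _ _ _ sol])
  let ?S = "semidirect_product N H \<phi>"
  have S: "group ?S" by (rule group_semidirect_product[OF N H \<phi>])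
  interpret N: group N by fact
  interpret H: group H by fact
  interpret P: group_hom H "AutoGroup N" \<phi>
    unfolding group_hom_def group_hom_axioms_def using \<phi> H N.AutoGroup by simp
  have one: "\<phi> \<one>\<^bsub>H\<^esub> a = a" if "a \<in> carrier N" for a
    using P.hom_one that by (simp add: AutoGroup_def BijGroup_def)
  show "group_hom N ?S (\<lambda>a. (a, \<one>\<^bsub>H\<^esub>))"
    unfolding group_hom_def group_hom_axioms_def using N S
    by (auto simp: hom_def semidirect_product_simps one simp del: P.hom_one)
  show "group_hom ?S H snd"
    unfolding group_hom_def group_hom_axioms_def using H S
    by (auto simp: hom_def semidirect_product_simps)
  show "snd ` carrier ?S = carrier H" using N.one_closed by (force simp: semidirect_product_simps)
  show "kernel ?S H snd \<subseteq> (\<lambda>a. (a, \<one>\<^bsub>H\<^esub>)) ` carrier N"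
    by (auto simp: kernel_def semidirect_product_simps)
qed

lemma solvable_DirProd:
  assumes N: "group N" and H: "group H" and sol: "solvable N" "solvable H"
  shows "solvable (N \<times>\<times> H)"
proof (rule solvable_condition[OF _ _ _ _ sol])
  interpret N: group N by fact
  interpret H: group H by fact
  show "group_hom N (N \<times>\<times> H) (\<lambda>a. (a, \<one>\<^bsub>H\<^esub>))"
    unfolding group_hom_def group_hom_axioms_def using N DirProd_group[OF N H]
    by (auto simp: hom_def)
  show "group_hom (N \<times>\<times> H) H snd"
    unfolding group_hom_def group_hom_axioms_def using H DirProd_group[OF N H]
    by (auto simp: hom_def)
  show "snd ` carrier (N \<times>\<times> H) = carrier H" using N.one_closed by force
  show "kernel (N \<times>\<times> H) H snd \<subseteq> (\<lambda>a. (a, \<one>\<^bsub>H\<^esub>)) ` carrier N"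
    by (auto simp: kernel_def)
qed

section \<open>Cyclic and dihedral groups and their embeddings\<close>

lemma order_integer_mod_group: "n > 0 \<Longrightarrow> order (integer_mod_group n) = n"
  by (simp add: order_def carrier_integer_mod_group)

lemma (in group) integer_mod_group_hom:
  assumes x: "x \<in> carrier G" and n: "n > 0" and xn: "x [^] n = \<one>"
  shows "group_hom (integer_mod_group n) G (\<lambda>k. x [^] k)"
proof -
  have "x [^] (j mod int n) = x [^] j" for j :: int
  proof -
    have "x [^] j = x [^] (int n * (j div int n) + j mod int n)" by simp
    also have "\<dots> = (x [^] int n) [^] (j div int n) \<otimes> x [^] (j mod int n)"
      using x by (simp only: int_pow_mult int_pow_pow)
    also have "x [^] int n = \<one>" using xn by (simp add: int_pow_int)
    finally show ?thesis using x by simp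
  qed
  then show ?thesis
    unfolding group_hom_def group_hom_axioms_def hom_def
    using x by (auto simp: int_pow_mult is_group)
qed

lemma (in group) inj_integer_mod_group_hom:
  assumes x: "x \<in> carrier G" and n: "n > 0" and ord: "ord x = n"
  shows "inj_on (\<lambda>k. x [^] k) (carrier (integer_mod_group n))"
proof (rule inj_onI)
  fix j k :: int
  assume jk: "j \<in> carrier (integer_mod_group n)" "k \<in> carrier (integer_mod_group n)" "x [^] j = x [^] k"
  then have "j mod int n = k mod int n" using int_pow_eq[OF x] ord by (simp add: mod_eq_dvd_iff dvd_diff_commute)
  then show "j = k" using jk(1,2) n by (simp add: carrier_integer_mod_group)
qed

lemma (in group) ord_prime:
  assumes "x \<in> carrier G" "x \<noteq> \<one>" "x [^] q = \<one>" "Factorial_Ring.prime q"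
  shows "ord x = q"
  using assms pow_eq_id[of x q] ord_eq_1[of x] prime_nat_iff[of q] by metis

abbreviation dihedral_action :: "nat \<Rightarrow> int \<Rightarrow> int \<Rightarrow> int" where
  "dihedral_action n \<equiv> (\<lambda>s. \<lambda>x\<in>carrier (integer_mod_group n). if s = 0 then x else inv\<^bsub>integer_mod_group n\<^esub> x)"

lemma dihedral_action_hom:
  assumes n: "n > 0"
  shows "dihedral_action n \<in> hom (integer_mod_group 2) (AutoGroup (integer_mod_group n))"
proof -
  let ?C = "integer_mod_group n" and ?\<phi> = "dihedral_action n"
  interpret C: comm_group ?C by simp
  have two: "carrier (integer_mod_group 2) = {0, 1}" by (auto simp: carrier_integer_mod_group)
  have Bij: "?\<phi> s \<in> Bij (carrier ?C)" for s
  proof -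
    have "bij_betw (?\<phi> s) (carrier ?C) (carrier ?C)"
      by (rule bij_betw_byWitness[where f' = "?\<phi> s"]) (auto simp del: inv_integer_mod_group)
    then show ?thesis by (simp add: Bij_def)
  qed
  have hom: "?\<phi> s \<in> hom ?C ?C" for s
    using C.inv_closed C.m_closed C.inv_mult C.m_comm
    by (auto simp: hom_def simp del: inv_integer_mod_group mult_integer_mod_group)
  have "?\<phi> (s \<otimes>\<^bsub>integer_mod_group 2\<^esub> t) = compose (carrier ?C) (?\<phi> s) (?\<phi> t)"
    if "s \<in> {0, 1}" "t \<in> {0, 1}" for s t
    by (rule extensionalityI[of _ "carrier ?C"])
      (use that C.inv_closed C.inv_inv in \<open>auto simp: compose_def simp del: inv_integer_mod_group\<close>)
  note 1 = this
  have 2: "?\<phi> s \<otimes>\<^bsub>AutoGroup ?C\<^esub> ?\<phi> t = compose (carrier ?C) (?\<phi> s) (?\<phi> t)" for s t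
    using Bij[of s] Bij[of t] by (simp add: AutoGroup_def BijGroup_def del: inv_integer_mod_group)
  have 3: "?\<phi> s \<in> carrier (AutoGroup ?C)" for s
    using Bij[of s] hom[of s] by (simp add: AutoGroup_def auto_def)
  show ?thesis
    unfolding hom_def mem_Collect_eq
  proof (intro conjI funcsetI ballI)
    fix s t :: int assume "s \<in> carrier (integer_mod_group 2)" "t \<in> carrier (integer_mod_group 2)"
    then show "?\<phi> (s \<otimes>\<^bsub>integer_mod_group 2\<^esub> t) = ?\<phi> s \<otimes>\<^bsub>AutoGroup ?C\<^esub> ?\<phi> t"
      unfolding 2 two by (rule 1)
  qed (rule 3)
qed

lemma group_dihedral: "n > 0 \<Longrightarrow> group (dihedral_group n)"
  unfolding dihedral_group_def by (intro group_semidirect_product dihedral_action_hom) simp_all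

lemma solvable_dihedral: "n > 0 \<Longrightarrow> solvable (dihedral_group n)"
  unfolding dihedral_group_def
  by (intro solvable_semidirect_product dihedral_action_hom solvable_integer_mod_group) simp_all

lemma order_dihedral: "n > 0 \<Longrightarrow> order (dihedral_group n) = 2 * n"
  by (simp add: order_def dihedral_group_def semidirect_product_simps carrier_integer_mod_group card_cartesian_product)

text \<open>Injectivity can fail only if s is a power of t. Then s commutes with t, so t equals its
  inverse and n divides 2.\<close>

lemma (in group) dihedral_embedding:
  assumes t: "t \<in> carrier G" and s: "s \<in> carrier G" and n: "n > 2" and ord: "ord t = n"
    and ss: "s \<otimes> s = \<one>" and sts: "s \<otimes> t \<otimes> s = inv t"
  shows "\<exists>\<delta>. group_hom (dihedral_group n) G \<delta> \<and> inj_on \<delta> (carrier (dihedral_group n))"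
proof -
  let ?C = "integer_mod_group n"
  have sub: "inv s = s" using inv_equality[OF ss s s] .
  have tn: "t [^] n = \<one>" using t ord pow_ord_eq_1 by blast
  interpret a: group_hom ?C G "\<lambda>k. t [^] k" using integer_mod_group_hom[OF t _ tn] n by simp
  interpret b: group_hom "integer_mod_group 2" G "\<lambda>k. s [^] k"
    using integer_mod_group_hom[OF s, of 2] s ss by (simp add: numeral_2_eq_2)
  have conj: "s \<otimes> t [^] k \<otimes> s = inv (t [^] k)" for k :: int
  proof -
    interpret c: group_hom G G "\<lambda>x. s \<otimes> x \<otimes> inv s"
      unfolding group_hom_def group_hom_axioms_def hom_def
      using s is_group by (auto simp: m_assoc inv_solve_left)
    have "s \<otimes> t [^] k \<otimes> inv s = (s \<otimes> t \<otimes> inv s) [^] k"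
      using c.hom_int_pow[OF t, of k] by simp
    then show ?thesis using sts t by (simp add: sub int_pow_inv)
  qed
  have two: "carrier (integer_mod_group 2) = {0, 1}" by (auto simp: carrier_integer_mod_group)
  let ?\<delta> = "\<lambda>(k, h). t [^] (k::int) \<otimes> s [^] (h::int)"
  have hom: "group_hom (dihedral_group n) G ?\<delta>"
    unfolding dihedral_group_def
  proof (rule semidirect_product_hom)
    show "dihedral_action n \<in> hom (integer_mod_group 2) (AutoGroup (integer_mod_group n))"
      using dihedral_action_hom n by simp
    fix k h assume k: "k \<in> carrier ?C" and h: "h \<in> carrier (integer_mod_group 2)"
    show "s [^] h \<otimes> t [^] k = t [^] (dihedral_action n h k) \<otimes> s [^] h"
    proof (cases "h = 0")
      case False
      then have "h = 1" using h two by simp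
      moreover have "s \<otimes> t [^] k = inv (t [^] k) \<otimes> s"
        using conj[of k] s t ss by (metis int_pow_closed inv_closed m_assoc m_closed r_one)
      ultimately show ?thesis using k t s a.hom_inv[OF k] by (simp del: inv_integer_mod_group a.hom_inv)
    qed (use k t in simp)
  qed (use a.group_hom_axioms b.group_hom_axioms in simp_all)
  interpret D: group_hom "dihedral_group n" G ?\<delta> by (rule hom)
  have "inj_on ?\<delta> (carrier (dihedral_group n))"
    unfolding D.inj_on_one_iff
  proof (intro allI ballI impI)
    fix x assume "x \<in> carrier (dihedral_group n)" and one: "?\<delta> x = \<one>"
    then obtain k h where x: "x = (k, h)" "k \<in> carrier ?C" "h \<in> {0, 1}"
      by (auto simp: dihedral_group_def semidirect_product_simps two)
    have "h = 0"
    proof (rule ccontr)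
      assume "h \<noteq> 0"
      then have "t [^] k \<otimes> s = \<one>" using one x s by simp
      then have "inv s = t [^] k" using inv_equality s t by simp
      then have st: "s = t [^] k" by (simp add: sub)
      have "s \<otimes> t = t \<otimes> s"
        unfolding st using t int_pow_mult[of t k 1] int_pow_mult[of t 1 k] by (simp add: add.commute)
      then have "inv t = t" using sts s t ss by (simp add: m_assoc)
      then have "t [^] (2::nat) = \<one>" using t by (metis l_inv numeral_2_eq_2 nat_pow_Suc nat_pow_0 l_one)
      then have "n dvd 2" using pow_eq_id[OF t] ord by simp
      then show False using n by (auto dest: dvd_imp_le)
    qed
    then have "t [^] k = t [^] (0::int)" using one x t by simp
    then have "k = 0"
      using inj_integer_mod_group_hom[OF t _ ord] x(2) n by (auto simp: inj_on_def)
    then show "x = \<one>\<^bsub>dihedral_group n\<^esub>"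
      using x \<open>h = 0\<close> by (simp add: dihedral_group_def semidirect_product_simps)
  qed
  with hom show ?thesis by blast
qed

section \<open>Mersenne primes and powers of \<open>2 + \<surd>3\<close>\<close>

text \<open>Pascal's rule with weights. Taking for f the rational or irrational coordinates of the
  powers of sqrt 3 gives a recursion for powers of 1 + sqrt 3 that stays inside the
  integers.\<close>

lemma binomial_sum_Suc:
  fixes f :: "nat \<Rightarrow> int"
  shows "(\<Sum>k\<le>Suc n. int (Suc n choose k) * f k)
       = (\<Sum>k\<le>n. int (n choose k) * f k) + (\<Sum>k\<le>n. int (n choose k) * f (Suc k))"
proof -
  have "(\<Sum>k\<le>Suc n. int (Suc n choose k) * f k)
      = (f 0 + (\<Sum>k\<le>n. int (n choose Suc k) * f (Suc k))) + (\<Sum>k\<le>n. int (n choose k) * f (Suc k))"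
    by (subst sum.atMost_Suc_shift) (simp add: algebra_simps sum.distrib)
  also have "f 0 + (\<Sum>k\<le>n. int (n choose Suc k) * f (Suc k)) = (\<Sum>k\<le>Suc n. int (n choose k) * f k)"
    by (subst sum.atMost_Suc_shift) simp
  finally show ?thesis by simp
qed

lemma binomial_sum_prime_cong:
  fixes f :: "nat \<Rightarrow> int"
  assumes p: "Factorial_Ring.prime p"
  shows "[(\<Sum>k\<le>p. int (p choose k) * f k) = f 0 + f p] (mod int p)"
proof -
  have p0: "p > 0" using p by (rule prime_gt_0_nat)
  have "{..p} = insert 0 (insert p {1..<p})" using p0 by auto
  then have "(\<Sum>k\<le>p. int (p choose k) * f k) = f 0 + f p + (\<Sum>k\<in>{1..<p}. int (p choose k) * f k)"
    using p0 by simp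
  moreover have "int p dvd (\<Sum>k\<in>{1..<p}. int (p choose k) * f k)"
    using p by (intro dvd_sum dvd_mult2) (auto intro: dvd_choose_prime)
  ultimately show ?thesis by (simp add: cong_iff_dvd_diff)
qed

text \<open>\<open>sqrt3_re n\<close> and \<open>sqrt3_im n\<close> are the coordinates of \<open>(1 + \<surd>3)\<^sup>n\<close>.\<close>
definition sqrt3_re :: "nat \<Rightarrow> int" where
  "sqrt3_re n = (\<Sum>k\<le>n. int (n choose k) * (if even k then 3 ^ (k div 2) else 0))"
definition sqrt3_im :: "nat \<Rightarrow> int" where
  "sqrt3_im n = (\<Sum>k\<le>n. int (n choose k) * (if odd k then 3 ^ (k div 2) else 0))"

lemma sqrt3_Suc: "sqrt3_re (Suc n) = sqrt3_re n + 3 * sqrt3_im n"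
  "sqrt3_im (Suc n) = sqrt3_re n + sqrt3_im n"
proof -
  have "(if even (Suc k) then 3 ^ (Suc k div 2) else 0 :: int) = 3 * (if odd k then 3 ^ (k div 2) else 0)" for k
    by (cases "even k") (auto elim!: oddE)
  then show "sqrt3_re (Suc n) = sqrt3_re n + 3 * sqrt3_im n"
    unfolding sqrt3_re_def sqrt3_im_def
    by (subst binomial_sum_Suc) (simp only: sum_distrib_left mult.left_commute)
  have "(if odd (Suc k) then 3 ^ (Suc k div 2) else 0 :: int) = (if even k then 3 ^ (k div 2) else 0)" for k
    by auto
  then show "sqrt3_im (Suc n) = sqrt3_re n + sqrt3_im n"
    unfolding sqrt3_re_def sqrt3_im_def
    by (subst binomial_sum_Suc) (simp only: add.commute)
qed

text \<open>The Frobenius map in coordinates, (1 + sqrt 3)^p = 1 + 3^((p-1)/2) sqrt 3: only the even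
  index 0 and the odd index p survive modulo p.\<close>

lemma sqrt3_prime:
  assumes p: "Factorial_Ring.prime p" "odd p"
  shows "[sqrt3_re p = 1] (mod int p)" "[sqrt3_im p = 3 ^ (p div 2)] (mod int p)"
  using binomial_sum_prime_cong[OF p(1), of "\<lambda>k. if even k then 3 ^ (k div 2) else 0"]
    binomial_sum_prime_cong[OF p(1), of "\<lambda>k. if odd k then 3 ^ (k div 2) else 0"] p(2)
  by (simp_all add: sqrt3_re_def sqrt3_im_def)

text \<open>The coordinates of \<open>(2 + \<surd>3)\<^sup>n\<close>; note that \<open>(1 + \<surd>3)\<^sup>2 = 2 (2 + \<surd>3)\<close>.\<close>
fun lucas_lehmer_coords :: "nat \<Rightarrow> int \<times> int" where
  "lucas_lehmer_coords 0 = (1, 0)"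
| "lucas_lehmer_coords (Suc n) = (let (a, b) = lucas_lehmer_coords n in (2 * a + 3 * b, a + 2 * b))"

lemma lucas_lehmer_coords_sqrt3:
  "sqrt3_re (2 * n) = 2 ^ n * fst (lucas_lehmer_coords n) \<and> sqrt3_im (2 * n) = 2 ^ n * snd (lucas_lehmer_coords n)"
proof (induction n)
  case 0
  show ?case by (simp add: sqrt3_re_def sqrt3_im_def)
next
  case (Suc n)
  then show ?case
    by (simp add: sqrt3_Suc split_def Let_def algebra_simps)
qed

text \<open>\<open>sl2 p a (3 * b) b a\<close> is the matrix of multiplication by a + b sqrt 3 in
  the basis 1, sqrt 3; the base of the power belongs to 2 + sqrt 3.\<close>

lemma sl2_power_lucas_lehmer:
  assumes "p > 1"
  shows "sl2 p 2 3 1 2 [^]\<^bsub>SL 2 p\<^esub> n = (let (a, b) = lucas_lehmer_coords n in sl2 p a (3 * b) b a)"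
proof (induction n)
  case 0
  show ?case using assms by (simp add: sl2_one nat_pow_def)
next
  case (Suc n)
  then show ?case
    by (simp add: nat_pow_def split_def Let_def sl2_mult algebra_simps)
qed

locale mersenne_prime =
  fixes p e :: nat
  assumes prime: "Factorial_Ring.prime p" and p_eq: "p = 2 ^ e - 1" and p_ge: "p \<ge> 7"
begin

lemma p_gt_1: "p > 1" using p_ge by simp

lemma p_Suc: "p + 1 = 2 ^ e" using p_eq p_ge by simp

lemma int_p: "int p = 2 ^ e - 1"
  using arg_cong[OF p_Suc, of int] by simp

lemma e_ge: "e \<ge> 3"
proof (rule ccontr)
  assume "\<not> e \<ge> 3"
  then have "2 ^ e \<le> (2 :: nat) ^ 2" by (intro power_increasing) auto
  then show False using p_Suc p_ge by simp
qed

text \<open>For even e the number 2^e - 1 is a multiple of 3, as 4 = 1 modulo 3.\<close>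

lemma odd_e: "odd e"
proof
  assume "even e"
  then obtain k where k: "e = 2 * k" ..
  have "[(4::nat) ^ k = 1 ^ k] (mod 3)" by (intro cong_pow) (simp add: cong_def)
  then have "[p + 1 = 1] (mod 3)" unfolding p_Suc k by (simp add: power_mult)
  then have "[p = 0] (mod 3)" by (metis add_0 cong_add_rcancel_nat)
  then have "3 dvd p" by (simp add: cong_0_iff)
  then show False using prime p_ge by (auto simp: prime_nat_iff)
qed

lemma half_p: "(p - 1) div 2 + 1 = 2 ^ (e - 1)" "p div 2 = (p - 1) div 2" "odd p"
  "odd ((p - 1) div 2)"
proof -
  have *: "2 * 2 ^ (e - 1) = p + 1" using p_Suc e_ge by (cases e) auto
  then show "(p - 1) div 2 + 1 = 2 ^ (e - 1)" "p div 2 = (p - 1) div 2" "odd p" by presburger+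
  moreover have "even ((2::nat) ^ (e - 1))" using e_ge by simp
  ultimately show "odd ((p - 1) div 2)" by presburger
qed

text \<open>Since e + 1 is even, 2^(e+1) is a square, and it equals 2 (p + 1).\<close>

lemma square_root_two: "\<exists>x. [x * x = 2] (mod int p)"
proof -
  obtain k where k: "e = 2 * k + 1" using odd_e by (rule oddE)
  have "(2 ^ (k + 1)) * 2 ^ (k + 1) = (2 ^ Suc e :: int)"
    unfolding power_add[symmetric] k by (rule arg_cong[of _ _ "power 2"]) simp
  also have "\<dots> = 2 * int p + 2" by (simp add: int_p)
  finally have "[2 ^ (k + 1) * 2 ^ (k + 1) = 2] (mod int p)" by (simp add: cong_iff_dvd_diff)
  then show ?thesis by blast
qed

lemma two_power_half: "[2 ^ ((p - 1) div 2) = 1] (mod int p)"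
proof -
  obtain x where x: "[x * x = 2] (mod int p)" using square_root_two by blast
  have "\<not> [2 = 0] (mod int p)" using p_ge by (auto simp: cong_0_iff dest: zdvd_imp_le)
  moreover have "QuadRes (int p) 2" unfolding QuadRes_def power2_eq_square using x by blast
  ultimately have "Legendre 2 (int p) = 1" by (simp add: Legendre_def)
  then show ?thesis using euler_criterion[of p 2] prime p_ge by (simp add: cong_sym)
qed

text \<open>As e is odd, p = 1 modulo 3 and is a square there. Reciprocity flips the sign because (p
  - 1)/2 and (3 - 1)/2 are both odd; Euler's criterion turns the symbol into the power.\<close>

lemma three_power_half: "[3 ^ ((p - 1) div 2) = - 1] (mod int p)"
proof -
  have "[int p = 1] (mod 3)"
  proof -
    obtain k where k: "e = 2 * k + 1" using odd_e by (rule oddE)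
    have "[(4::int) ^ k = 1 ^ k] (mod 3)" by (intro cong_pow) (simp add: cong_def)
    then have "[2 * (4::int) ^ k - 1 = 2 * 1 - 1] (mod 3)" by (intro cong_diff cong_mult) auto
    moreover have "int p = 2 * 4 ^ k - 1"
      unfolding int_p k by (simp add: power_mult)
    ultimately show ?thesis by simp
  qed
  then have "[1\<^sup>2 = int p] (mod 3)" "\<not> [int p = 0] (mod 3)"
    by (simp_all add: cong_def)
  then have "QuadRes 3 (int p)" "\<not> [int p = 0] (mod 3)"
    unfolding QuadRes_def by blast+
  then have "Legendre (int p) 3 = 1" by (simp add: Legendre_def)
  moreover have "Legendre (int p) 3 * Legendre 3 (int p) = (- 1) ^ ((p - 1) div 2 * ((3 - 1) div 2))"
    using Quadratic_Reciprocity[of p 3] prime p_ge by simp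
  ultimately have "Legendre 3 (int p) = - 1" using half_p(4) by simp
  then show ?thesis using euler_criterion[of p 3] prime p_ge by (simp add: cong_sym)
qed

lemma lucas_lehmer:
  "[fst (lucas_lehmer_coords (2 ^ (e - 1))) = - 1] (mod int p)"
  "[snd (lucas_lehmer_coords (2 ^ (e - 1))) = 0] (mod int p)"
proof -
  let ?n = "2 ^ (e - 1) :: nat"
  obtain a b where ab: "lucas_lehmer_coords ?n = (a, b)" by force
  have n: "2 * ?n = Suc p" "?n = Suc ((p - 1) div 2)" using half_p by presburger+
  \<comment> \<open>From (1 + sqrt 3)^2 = 2 (2 + sqrt 3), raising to the power n = (p + 1)/2
    produces a factor 2^n. It reduces to 2 and is cancelled at the end, p being odd.\<close>
  have "[2 ^ ?n = 2 * 1] (mod int p)" unfolding n(2) power_Suc by (intro cong_mult two_power_half) simp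
  then have 2: "[2 ^ ?n * x = 2 * x] (mod int p)" for x using cong_mult[OF _ cong_refl, of "2 ^ ?n" "2 * 1"] by simp
  have 3: "[sqrt3_im p = - 1] (mod int p)"
    using sqrt3_prime(2)[OF prime half_p(3)] three_power_half unfolding half_p(2) by (rule cong_trans)
  note 1 = sqrt3_prime(1)[OF prime half_p(3)]
  have ll: "sqrt3_re p + 3 * sqrt3_im p = 2 ^ ?n * a" "sqrt3_re p + sqrt3_im p = 2 ^ ?n * b"
    using lucas_lehmer_coords_sqrt3[of ?n] unfolding n(1) sqrt3_Suc ab by simp_all
  have "[2 ^ ?n * a = 1 + 3 * - 1] (mod int p)"
    using cong_add[OF 1 cong_mult[OF cong_refl[of 3] 3]] unfolding ll .
  then have "[2 * a = 2 * - 1] (mod int p)" using cong_trans[OF cong_sym[OF 2]] by simp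
  moreover have cop: "coprime 2 (int p)" using half_p(3) by simp
  ultimately show "[fst (lucas_lehmer_coords ?n) = - 1] (mod int p)"
    unfolding ab fst_conv using cong_mult_lcancel by blast
  have "[2 ^ ?n * b = 1 + - 1] (mod int p)"
    using cong_add[OF 1 3] unfolding ll .
  then have "[2 * b = 2 * 0] (mod int p)" using cong_trans[OF cong_sym[OF 2]] by simp
  then show "[snd (lucas_lehmer_coords ?n) = 0] (mod int p)"
    unfolding ab snd_conv using cop cong_mult_lcancel by blast
qed

lemma sl2_power_eq_minus_one: "sl2 p 2 3 1 2 [^]\<^bsub>SL 2 p\<^esub> (2 ^ (e - 1) :: nat) = sl2 p (- 1) 0 0 (- 1)"
  unfolding sl2_power_lucas_lehmer[OF p_gt_1]
  using lucas_lehmer cong_mult[OF cong_refl[of 3] lucas_lehmer(2)] by (simp add: split_def Let_def sl2_eq_iff)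

end

section \<open>The factorization of \<open>PSL 2 p\<close> for Mersenne primes\<close>

lemma PSL_projection:
  assumes "p > 1" "m > 0"
  shows "group_hom (SL m p) (PSL m p) (\<lambda>A. SL_scalars m p #>\<^bsub>SL m p\<^esub> A)"
    and "A \<in> carrier (SL m p) \<Longrightarrow> SL_scalars m p #>\<^bsub>SL m p\<^esub> A = \<one>\<^bsub>PSL m p\<^esub> \<longleftrightarrow> A \<in> SL_scalars m p"
proof -
  interpret Z: normal "SL_scalars m p" "SL m p" by (rule normal_SL_scalars[OF assms])
  show "group_hom (SL m p) (PSL m p) (\<lambda>A. SL_scalars m p #>\<^bsub>SL m p\<^esub> A)"
    unfolding PSL_def by (rule Z.group_hom_FactGroup)
  show "A \<in> carrier (SL m p) \<Longrightarrow> SL_scalars m p #>\<^bsub>SL m p\<^esub> A = \<one>\<^bsub>PSL m p\<^esub> \<longleftrightarrow> A \<in> SL_scalars m p"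
    unfolding PSL_def by (rule Z.coset_eq_one_iff)
qed

lemma finite_carrier_PSL: "finite (carrier (PSL m p))"
proof -
  have "carrier (PSL m p) = (\<lambda>A. SL_scalars m p #>\<^bsub>SL m p\<^esub> A) ` carrier (SL m p)"
    by (auto simp: PSL_def FactGroup_def RCOSETS_def)
  then show ?thesis using finite_carrier_SL by simp
qed

lemma group_hom_trans:
  assumes "group_hom G H f" "group_hom H K g"
  shows "group_hom G K (g \<circ> f)"
  using assms Group.hom_compose[of f G H g K] by (auto simp: group_hom_def group_hom_axioms_def)

context mersenne_prime
begin

abbreviation proj :: "int mat \<Rightarrow> int mat set" where
  "proj A \<equiv> SL_scalars 2 p #>\<^bsub>SL 2 p\<^esub> A"

text \<open>
  The rotation is multiplication by the norm one element \<open>2 + \<surd>3\<close>; the reflection is a trace zero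
  matrix whose product with the rotation again has trace zero, so that it inverts the rotation.
\<close>
lemma dihedral_in_PSL2:
  "\<exists>\<delta>. group_hom (dihedral_group (2 ^ (e - 1))) (PSL 2 p) \<delta> \<and> inj_on \<delta> (carrier (dihedral_group (2 ^ (e - 1))))"
proof -
  obtain x where x: "[x * x = 2] (mod int p)" using square_root_two by blast
  \<comment> \<open>The root x of 2 gives \<open>?S\<close> the determinant 3 - x^2 = 1. Trace 0 and
    determinant 1 mean square -1, both for \<open>?S\<close> and for \<open>?S\<close> times
    \<open>?T\<close>; the squares appear as the scalar x^2 - 3.\<close>
  let ?T = "sl2 p 2 3 1 2" and ?S = "sl2 p x (- 3) 1 (- x)"
  interpret \<pi>: group_hom "SL 2 p" "PSL 2 p" proj using PSL_projection(1)[OF p_gt_1] by simp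
  note one_iff = PSL_projection(2)[OF p_gt_1, of 2, simplified]
  have T: "?T \<in> carrier (SL 2 p)" by (rule sl2_in_carrier[OF p_gt_1]) simp
  have "[x * (- x) - (- 3) * 1 = 1] (mod int p)"
    using cong_diff[OF cong_refl[of 3] x] by simp
  then have S: "?S \<in> carrier (SL 2 p)" by (rule sl2_in_carrier[OF p_gt_1])
  have minus_one: "sl2 p (- 1) 0 0 (- 1) \<in> SL_scalars 2 p" using prime by (simp add: sl2_scalar_iff)
  have pminus: "proj (sl2 p (- 1) 0 0 (- 1)) = \<one>\<^bsub>PSL 2 p\<^esub>"
    using one_iff[of "sl2 p (- 1) 0 0 (- 1)"] minus_one by (simp add: SL_scalars_def)
  have x3: "sl2 p (x * x - 3) 0 0 (x * x - 3) = sl2 p (- 1) 0 0 (- 1)"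
    using cong_diff[OF x cong_refl[of 3]] by (simp add: sl2_eq_iff)
  have "?S \<otimes>\<^bsub>SL 2 p\<^esub> ?S = sl2 p (- 1) 0 0 (- 1)"
    unfolding x3[symmetric] sl2_mult by (simp add: algebra_simps)
  then have ss: "proj ?S \<otimes>\<^bsub>PSL 2 p\<^esub> proj ?S = \<one>\<^bsub>PSL 2 p\<^esub>" using S pminus by (simp flip: \<pi>.hom_mult)
  have "?S \<otimes>\<^bsub>SL 2 p\<^esub> ?T \<otimes>\<^bsub>SL 2 p\<^esub> ?S \<otimes>\<^bsub>SL 2 p\<^esub> ?T = sl2 p (- 1) 0 0 (- 1)"
    unfolding x3[symmetric] sl2_mult by (simp add: algebra_simps)
  then have "proj ?S \<otimes>\<^bsub>PSL 2 p\<^esub> proj ?T \<otimes>\<^bsub>PSL 2 p\<^esub> proj ?S \<otimes>\<^bsub>PSL 2 p\<^esub> proj ?T = \<one>\<^bsub>PSL 2 p\<^esub>"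
    using S T pminus by (simp flip: \<pi>.hom_mult)
  then have sts: "proj ?S \<otimes>\<^bsub>PSL 2 p\<^esub> proj ?T \<otimes>\<^bsub>PSL 2 p\<^esub> proj ?S = inv\<^bsub>PSL 2 p\<^esub> proj ?T"
    using S T by (intro \<pi>.H.inv_equality[symmetric]) auto
  have "proj ?T [^]\<^bsub>PSL 2 p\<^esub> (2 ^ (e - 1) :: nat) = proj (?T [^]\<^bsub>SL 2 p\<^esub> (2 ^ (e - 1) :: nat))"
    using \<pi>.hom_nat_pow[OF T] by simp
  then have tn: "proj ?T [^]\<^bsub>PSL 2 p\<^esub> (2 ^ (e - 1) :: nat) = \<one>\<^bsub>PSL 2 p\<^esub>"
    unfolding sl2_power_eq_minus_one pminus .
  \<comment> \<open>Otherwise the power would be 1 or -1 in \<open>SL 2 p\<close> and its square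
    would be 1 instead of -1. So the order, a divisor of 2^(e-1), is not a divisor of
    2^(e-2).\<close>
  have "proj ?T [^]\<^bsub>PSL 2 p\<^esub> (2 ^ (e - 2) :: nat) \<noteq> \<one>\<^bsub>PSL 2 p\<^esub>"
  proof
    let ?R = "?T [^]\<^bsub>SL 2 p\<^esub> (2 ^ (e - 2) :: nat)"
    assume "proj ?T [^]\<^bsub>PSL 2 p\<^esub> (2 ^ (e - 2) :: nat) = \<one>\<^bsub>PSL 2 p\<^esub>"
    then have "proj ?R = \<one>\<^bsub>PSL 2 p\<^esub>" using \<pi>.hom_nat_pow[OF T, of "2 ^ (e - 2)"] by simp
    moreover have RG: "?R \<in> carrier (SL 2 p)" using T by simp
    ultimately have "?R \<in> SL_scalars 2 p" using one_iff by blast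
    moreover obtain a b c d where R: "?R = sl2 p a b c d" and det: "[a * d - b * c = 1] (mod int p)"
      using RG by (rule sl2_cases)
    ultimately have "?R = sl2 p 1 0 0 1 \<or> ?R = sl2 p (- 1) 0 0 (- 1)"
      using sl2_scalar_iff[OF prime det] by simp
    then have "?R \<otimes>\<^bsub>SL 2 p\<^esub> ?R = sl2 p 1 0 0 1" by (auto simp: sl2_mult)
    moreover have "?R \<otimes>\<^bsub>SL 2 p\<^esub> ?R = ?T [^]\<^bsub>SL 2 p\<^esub> (2 ^ (e - 2) + 2 ^ (e - 2) :: nat)"
      using T by (simp add: \<pi>.G.nat_pow_mult)
    moreover have "(2 ^ (e - 2) + 2 ^ (e - 2) :: nat) = 2 ^ (e - 1)"
      using e_ge by (simp flip: mult_2 power_Suc)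
    ultimately have "sl2 p (- 1) 0 0 (- 1) = sl2 p 1 0 0 1" using sl2_power_eq_minus_one by simp
    then show False using p_ge by (auto simp: sl2_eq_iff cong_iff_dvd_diff dest: zdvd_imp_le)
  qed
  then have "\<not> \<pi>.H.ord (proj ?T) dvd 2 ^ (e - 2)" "\<pi>.H.ord (proj ?T) dvd 2 ^ (e - 1)"
    using \<pi>.H.pow_eq_id[of "proj ?T"] T tn by auto
  moreover from this(2) obtain i where i: "i \<le> e - 1" "\<pi>.H.ord (proj ?T) = 2 ^ i"
    using divides_primepow_nat[OF two_is_prime_nat] by blast
  ultimately have "\<not> i \<le> e - 2" by (auto simp: le_imp_power_dvd)
  then have ord: "\<pi>.H.ord (proj ?T) = 2 ^ (e - 1)" 
  proof -
    have "i = e - 1" using i(1) \<open>\<not> i \<le> e - 2\<close> by linarith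
    then show ?thesis using i(2) by simp
  qed
  have "(2::nat) ^ 2 \<le> 2 ^ (e - 1)" using e_ge by (intro power_increasing) auto
  then show ?thesis
    using S T ord ss sts by (intro \<pi>.H.dihedral_embedding[of "proj ?T" "proj ?S"]) auto
qed

text \<open>
  Let \<open>c h\<close> be the multiplier of \<open>\<phi> h\<close>. Since the order \<open>m\<close> of the complement is odd, \<open>c h\<close> has the
  square root \<open>g h = c h ^ ((m + 1) / 2)\<close>, and \<open>diag (g h, 1 / g h)\<close> acts on the upper transvections
  as multiplication by \<open>c h\<close>.
\<close>
lemma frobenius_in_PSL2:
  assumes \<phi>: "\<phi> \<in> mon (integer_mod_group ((p - 1) div 2)) (AutoGroup (integer_mod_group p))"
  defines "F \<equiv> semidirect_product (integer_mod_group p) (integer_mod_group ((p - 1) div 2)) \<phi>"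
  shows "\<exists>\<alpha>. group_hom F (PSL 2 p) \<alpha> \<and> inj_on \<alpha> (carrier F)"
proof -
  define m where "m = (p - 1) div 2"
  let ?C = "integer_mod_group p" and ?M = "integer_mod_group m"
  have m: "m > 0" "odd m" using half_p(4) p_ge by (auto simp: m_def)
  have hom: "\<phi> \<in> hom ?M (AutoGroup ?C)" and inj: "inj_on \<phi> (carrier ?M)"
    using \<phi> by (auto simp: mon_def m_def)
  note \<phi>D = hom_AutoGroupD[OF hom]
  have carC: "carrier ?C = {0..<int p}" and carM: "carrier ?M = {0..<int m}"
    using p_gt_1 m by (auto simp: carrier_integer_mod_group)
  have one_C: "1 \<in> carrier ?C" using p_gt_1 by simp
  define c where "c h = \<phi> h 1" for h
  \<comment> \<open>An endomorphism of a cyclic group multiplies by its value at the generator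
    1.\<close>
  have \<phi>_eq: "\<phi> h a = (a * c h) mod int p" if h: "h \<in> carrier ?M" and a: "a \<in> carrier ?C" for h a
  proof -
    interpret f: group_hom ?C ?C "\<phi> h"
      unfolding group_hom_def group_hom_axioms_def using \<phi>D(1)[OF h] by simp
    have "\<phi> h (1 [^]\<^bsub>?C\<^esub> nat a) = c h [^]\<^bsub>?C\<^esub> nat a"
      unfolding c_def by (rule f.hom_nat_pow[OF one_C])
    moreover have "0 \<le> a" "a < int p" using a unfolding carC by auto
    ultimately show ?thesis by simp
  qed
  have c_mult: "[c ((h + k) mod int m) = c h * c k] (mod int p)" if hk: "h \<in> carrier ?M" "k \<in> carrier ?M" for h k
  proof -
    have "c ((h + k) mod int m) = \<phi> h (c k)" using \<phi>D(3)[OF hk(1) one_C hk(2)] by (simp add: c_def)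
    moreover have "c k \<in> carrier ?C" using \<phi>D(1)[OF hk(2)] one_C by (auto simp: c_def hom_def)
    ultimately show ?thesis using \<phi>_eq[OF hk(1)] by (simp add: cong_def mult.commute)
  qed
  have zM: "0 \<in> carrier ?M" by simp
  have c0: "c 0 = 1"
  proof -
    interpret P: group_hom ?M "AutoGroup ?C" \<phi>
      unfolding group_hom_def group_hom_axioms_def using hom group.AutoGroup[of ?C] by simp
    have "\<phi> 0 = \<one>\<^bsub>AutoGroup ?C\<^esub>" using P.hom_one by simp
    then show ?thesis using one_C by (simp add: c_def AutoGroup_def BijGroup_def)
  qed
  have c_pow: "[c h ^ m = 1] (mod int p)" if h: "h \<in> carrier ?M" for h
  proof -
    have "[c h ^ k = c (int k * h mod int m)] (mod int p)" for k :: nat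
    proof (induction k)
      case (Suc k)
      have "int k * h mod int m \<in> carrier ?M" using m carM by simp
      from c_mult[OF h this] have "[c h * c (int k * h mod int m) = c (int (Suc k) * h mod int m)] (mod int p)"
        by (simp add: cong_sym mod_add_right_eq algebra_simps)
      then show ?case using cong_mult[OF cong_refl[of "c h"] Suc] by (auto intro: cong_trans)
    qed (simp add: c0)
    from this[of m] show ?thesis by (simp add: c0)
  qed
  define r where "r = (m + 1) div 2"
  \<comment> \<open>Together with c^m = 1 this makes c^r a square root of c that is still
    multiplicative in h.\<close>
  have r: "r + r = Suc m" using m(2) unfolding r_def by presburger
  define g where "g h = c h ^ r" for h
  have g_mult: "[g ((h + k) mod int m) = g h * g k] (mod int p)" if "h \<in> carrier ?M" "k \<in> carrier ?M" for h k
    unfolding g_def power_mult_distrib[symmetric] by (intro cong_pow c_mult that)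
  have g_sq: "[g h * g h = c h] (mod int p)" if "h \<in> carrier ?M" for h
  proof -
    have "g h * g h = c h * c h ^ m" unfolding g_def power_add[symmetric] r by simp
    then show ?thesis using cong_mult[OF cong_refl c_pow[OF that], of "c h"] by simp
  qed
  define g' where "g' h = g ((- h) mod int m)" for h
  have negM: "(- h) mod int m \<in> carrier ?M" for h using m carM by simp
  have gg': "[g h * g' h = 1] (mod int p)" if h: "h \<in> carrier ?M" for h
  proof -
    have "(h + (- h) mod int m) mod int m = 0" by (simp add: mod_add_right_eq)
    then show ?thesis using g_mult[OF h negM[of h]] by (simp add: g'_def cong_sym g_def c0)
  qed
  have g'_mult: "[g' ((h + k) mod int m) = g' h * g' k] (mod int p)" for h k
  proof -
    have "(- ((h + k) mod int m)) mod int m = ((- h) mod int m + (- k) mod int m) mod int m"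
      by (simp add: mod_minus_eq mod_add_eq)
    then show ?thesis using g_mult[OF negM[of h] negM[of k]] by (simp add: g'_def)
  qed
  let ?a = "\<lambda>a. sl2 p 1 a 0 1" and ?b = "\<lambda>h. sl2 p (g h) 0 0 (g' h)"
  have SL: "group (SL 2 p)" by (rule group_SL[OF p_gt_1])
  have aG: "?a a \<in> carrier (SL 2 p)" for a by (rule sl2_in_carrier[OF p_gt_1]) simp
  have bG: "?b h \<in> carrier (SL 2 p)" if "h \<in> carrier ?M" for h
    using gg'[OF that] by (intro sl2_in_carrier[OF p_gt_1]) simp
  have ahom: "group_hom ?C (SL 2 p) ?a"
    unfolding group_hom_def group_hom_axioms_def
    using SL aG by (auto simp: hom_def sl2_mult sl2_eq_iff cong_def add.commute)
  have bhom: "group_hom ?M (SL 2 p) ?b"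
    unfolding group_hom_def group_hom_axioms_def
    using SL bG g_mult g'_mult by (auto simp: hom_def sl2_mult sl2_eq_iff)
  have Fhom: "group_hom F (SL 2 p) (\<lambda>(a, h). ?a a \<otimes>\<^bsub>SL 2 p\<^esub> ?b h)"
    unfolding F_def m_def[symmetric]
  proof (rule semidirect_product_hom[OF _ _ hom ahom bhom])
    fix a h assume a: "a \<in> carrier ?C" and h: "h \<in> carrier ?M"
    have 1: "[\<phi> h a * g' h = (a * c h) * g' h] (mod int p)"
      using \<phi>_eq[OF h a] by (intro cong_mult) (auto simp: cong_def)
    have "[g h * a = (a * c h) * g' h] (mod int p)"
      using g_sq[OF h] gg'[OF h] unfolding cong_iff_dvd_diff by Groebner_Basis.algebra
    from cong_trans[OF this cong_sym[OF 1]]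
    show "?b h \<otimes>\<^bsub>SL 2 p\<^esub> ?a a = ?a (\<phi> h a) \<otimes>\<^bsub>SL 2 p\<^esub> ?b h"
      by (simp add: sl2_mult sl2_eq_iff)
  qed simp_all
  have \<pi>: "group_hom (SL 2 p) (PSL 2 p) proj" using PSL_projection(1)[OF p_gt_1] by simp
  let ?\<alpha> = "proj \<circ> (\<lambda>(a, h). ?a a \<otimes>\<^bsub>SL 2 p\<^esub> ?b h)"
  interpret \<alpha>: group_hom F "PSL 2 p" ?\<alpha> by (rule group_hom_trans[OF Fhom \<pi>])
  have "inj_on ?\<alpha> (carrier F)"
    unfolding \<alpha>.inj_on_one_iff
  proof (intro allI impI)
    fix x assume "x \<in> carrier F" and one: "?\<alpha> x = \<one>\<^bsub>PSL 2 p\<^esub>"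
    then obtain a h where x: "x = (a, h)" and a: "a \<in> carrier ?C" and h: "h \<in> carrier ?M"
      by (auto simp: F_def semidirect_product_simps m_def)
    have eq: "?a a \<otimes>\<^bsub>SL 2 p\<^esub> ?b h = sl2 p (g h) (a * g' h) 0 (g' h)" by (simp add: sl2_mult)
    have det: "[g h * g' h - (a * g' h) * 0 = 1] (mod int p)" using gg'[OF h] by simp
    have "sl2 p (g h) (a * g' h) 0 (g' h) \<in> SL_scalars 2 p"
      using one PSL_projection(2)[OF p_gt_1, of 2] sl2_in_carrier[OF p_gt_1 det]
      unfolding x o_def split eq by simp
    \<comment> \<open>Either sign gives c h = 1, so \<phi> h is the identity and h = 0 by
      faithfulness; then a = 0. Hence passing to the projective group loses nothing.\<close>
    then have gh: "[g h = 1] (mod int p) \<or> [g h = - 1] (mod int p)" and ag: "[a * g' h = 0] (mod int p)"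
      unfolding sl2_scalar_iff[OF prime det] by (auto simp: sl2_eq_iff)
    have "[g h * g h = 1] (mod int p)"
      using gh cong_mult[of "g h" 1 "int p" "g h" 1] cong_mult[of "g h" "- 1" "int p" "g h" "- 1"] by auto
    then have "[c h = 1] (mod int p)" using g_sq[OF h] by (metis cong_sym cong_trans)
    moreover have "c h \<in> carrier ?C" using \<phi>D(1)[OF h] one_C by (auto simp: c_def hom_def)
    ultimately have ch: "c h = 1" using p_gt_1 by (simp add: carC cong_def)
    have "\<phi> h = \<phi> 0"
    proof (rule extensionalityI[of _ "carrier ?C"])
      show "\<phi> h \<in> extensional (carrier ?C)" "\<phi> 0 \<in> extensional (carrier ?C)"
        using \<phi>D(2)[OF h] \<phi>D(2)[OF zM] by (auto simp: Bij_def)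
    qed (simp add: \<phi>_eq h zM ch c0 del: mult_integer_mod_group)
    then have h0: "h = 0" using inj h zM by (auto simp: inj_on_def)
    have "[a * 1 = 0] (mod int p)"
      using ag by (simp add: h0 g'_def g_def c0)
    then have "a = 0" using a carC by (auto simp: cong_def)
    then show "x = \<one>\<^bsub>F\<^esub>" using x h0 by (simp add: F_def semidirect_product_simps)
  qed
  with \<alpha>.group_hom_axioms show ?thesis by blast
qed

theorem hopf_galois_structure_PSL2:
  assumes \<phi>: "\<phi> \<in> mon (integer_mod_group ((p - 1) div 2)) (AutoGroup (integer_mod_group p))"
  defines "F \<equiv> semidirect_product (integer_mod_group p) (integer_mod_group ((p - 1) div 2)) \<phi>"
  shows "solvable (F \<times>\<times> dihedral_group (2 ^ (e - 1)))"
    and "galois_extension L K \<Longrightarrow> galois_group L K \<cong> F \<times>\<times> dihedral_group (2 ^ (e - 1)) \<Longrightarrow>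
      admits_hopf_galois_structure_of_type L K (PSL 2 p)"
proof -
  have hom: "\<phi> \<in> hom (integer_mod_group ((p - 1) div 2)) (AutoGroup (integer_mod_group p))"
    using \<phi> by (simp add: mon_def)
  show "solvable (F \<times>\<times> dihedral_group (2 ^ (e - 1)))"
    unfolding F_def
    by (intro solvable_DirProd solvable_semidirect_product group_semidirect_product hom
        solvable_integer_mod_group group_dihedral solvable_dihedral) simp_all
  assume ext: "galois_extension L K" "galois_group L K \<cong> F \<times>\<times> dihedral_group (2 ^ (e - 1))"
  obtain \<alpha> where \<alpha>: "group_hom F (PSL 2 p) \<alpha>" "inj_on \<alpha> (carrier F)"
    using frobenius_in_PSL2[OF \<phi>] unfolding F_def by blast
  obtain \<delta> where \<delta>: "group_hom (dihedral_group (2 ^ (e - 1))) (PSL 2 p) \<delta>"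
      "inj_on \<delta> (carrier (dihedral_group (2 ^ (e - 1))))"
    using dihedral_in_PSL2 by blast
  have m: "(p - 1) div 2 > 0" using p_ge by simp
  have oF: "order F = p * ((p - 1) div 2)"
    using p_gt_1 m by (simp add: F_def order_def semidirect_product_simps carrier_integer_mod_group card_cartesian_product)
  have oD: "order (dihedral_group (2 ^ (e - 1))) = 2 ^ e"
    using e_ge by (cases e) (simp_all add: order_dihedral)
  have "coprime (order F) (order (dihedral_group (2 ^ (e - 1))))"
    unfolding oF oD using half_p(3,4) by simp
  moreover have "order (PSL 2 p) \<le> order F * order (dihedral_group (2 ^ (e - 1)))"
  proof -
    have "(p - 1) * p * (p + 1) div 2 = p * ((p - 1) div 2) * (p + 1)"
      using half_p(3) by (auto elim!: oddE)
    then show ?thesis using order_PSL2[OF prime] p_ge unfolding oF oD p_Suc[symmetric] by simp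
  qed
  ultimately show "admits_hopf_galois_structure_of_type L K (PSL 2 p)"
    using exact_factorization_hopf_galois[OF ext finite_carrier_PSL \<alpha>(1) \<delta>(1) \<alpha>(2) \<delta>(2)] by blast
qed

end

section \<open>Simplicity of \<open>alt_group 5\<close>\<close>

fun arrangements :: "nat \<Rightarrow> 'a list \<Rightarrow> 'a list list" where
  "arrangements 0 xs = [[]]"
| "arrangements (Suc n) xs = concat (map (\<lambda>a. map (Cons a) (arrangements n (remove1 a xs))) xs)"

lemma in_arrangements:
  "\<lbrakk>distinct xs; set xs \<subseteq> set ys; distinct ys\<rbrakk> \<Longrightarrow> xs \<in> set (arrangements (length xs) ys)"
proof (induction xs arbitrary: ys)
  case (Cons x xs)
  then have "xs \<in> set (arrangements (length xs) (remove1 x ys))" by (intro Cons.IH) auto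
  then show ?case using Cons.prems by auto
qed simp

text \<open>A permutation of \<open>{1..5}\<close> is represented by the list of its values.\<close>
definition perm_of_list :: "nat list \<Rightarrow> nat \<Rightarrow> nat" where
  "perm_of_list xs i = (if i \<in> {1..length xs} then xs ! (i - 1) else i)"

definition comp_list :: "nat list \<Rightarrow> nat list \<Rightarrow> nat list" where
  "comp_list xs ys = map (\<lambda>i. xs ! (i - 1)) ys"

definition cycle_list5 :: "nat \<times> nat \<times> nat \<Rightarrow> nat list" where
  "cycle_list5 = (\<lambda>(a, b, c). map (\<lambda>i. if i = a then b else if i = b then c else if i = c then a else i) [1, 2, 3, 4, 5])"

text \<open>One orientation of each of the ten three-element subsets; the other orientation is added
  in \<open>is_three_cycle_list\<close>.\<close>

definition triples5 :: "(nat \<times> nat \<times> nat) list" where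
  "triples5 = [(1, 2, 3), (1, 2, 4), (1, 2, 5), (1, 3, 4), (1, 3, 5), (1, 4, 5), (2, 3, 4), (2, 3, 5), (2, 4, 5), (3, 4, 5)]"

definition is_three_cycle_list :: "nat list \<Rightarrow> bool" where
  "is_three_cycle_list s \<longleftrightarrow> list_ex (\<lambda>(a, b, c). s = cycle_list5 (a, b, c) \<or> s = cycle_list5 (a, c, b)) triples5"

text \<open>Here s is u v^-1 = t x t^-1 x^-1, with v inverted by a search for positions. The
  equation u = s v is tested as well, so the correctness of the search needs no proof.\<close>

definition commutator_is_three_cycle :: "nat list \<Rightarrow> nat list \<Rightarrow> bool" where
  "commutator_is_three_cycle xs t \<longleftrightarrow>
     (let u = comp_list t xs; v = comp_list xs t;
          s = map (\<lambda>i. u ! length (takeWhile (\<lambda>j. j \<noteq> i) v)) [1, 2, 3, 4, 5]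
      in u = comp_list s v \<and> is_three_cycle_list s)"

text \<open>The square is needed for the odd permutations of cycle type \<open>(2, 3)\<close>.\<close>
lemma three_cycle_from_perm_list:
  "list_all (\<lambda>xs. xs = [1, 2, 3, 4, 5] \<or>
       list_ex (\<lambda>c. commutator_is_three_cycle xs (cycle_list5 c)) triples5 \<or>
       is_three_cycle_list (comp_list xs xs))
     (arrangements 5 [1, 2, 3, 4, 5])"
  by code_simp

lemma perm_of_list_comp:
  assumes "length xs = 5" "length ys = 5" "set ys \<subseteq> {1..5}"
  shows "perm_of_list (comp_list xs ys) = perm_of_list xs \<circ> perm_of_list ys"
proof
  fix i
  have "ys ! (i - 1) \<in> {1..5}" if "i \<in> {1..5}"
    using that assms(2,3) nth_mem[of "i - 1" ys] by fastforce
  then show "perm_of_list (comp_list xs ys) i = (perm_of_list xs \<circ> perm_of_list ys) i"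
    using assms by (auto simp: perm_of_list_def comp_list_def)
qed

lemma perm_of_list_map: "perm_of_list (map f [1, 2, 3, 4, 5]) i = (if i \<in> {1..5} then f i else i)"
proof -
  have "i \<in> {1, 2, 3, 4, 5} \<or> i \<notin> {1..5}" by auto
  then show ?thesis by (auto simp: perm_of_list_def)
qed

lemma perm_of_list_permutes:
  assumes "x permutes {1..5}"
  shows "perm_of_list (map x [1, 2, 3, 4, 5]) = x"
proof
  fix i
  show "perm_of_list (map x [1, 2, 3, 4, 5]) i = x i"
    unfolding perm_of_list_map using permutes_not_in[OF assms, of i] by auto
qed

lemma perm_of_cycle_list5:
  assumes "{a, b, c} \<subseteq> {1..5}" "distinct [a, b, c]"
  shows "perm_of_list (cycle_list5 (a, b, c)) = cycle_of_list [a, b, c]"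
proof
  fix i :: nat
  have "perm_of_list (cycle_list5 (a, b, c)) i = (if i = a then b else if i = b then c else if i = c then a else i)"
    unfolding cycle_list5_def split perm_of_list_map using assms(1) by auto
  also have "\<dots> = cycle_of_list [a, b, c] i"
    using assms(2) by (simp add: transpose_def)
  finally show "perm_of_list (cycle_list5 (a, b, c)) i = cycle_of_list [a, b, c] i" .
qed

lemma triples5_distinct: "(a, b, c) \<in> set triples5 \<Longrightarrow> {a, b, c} \<subseteq> {1..5} \<and> distinct [a, b, c]"
  by (auto simp: triples5_def)

lemma cycle_list5_valid:
  "length (cycle_list5 c) = 5" "(a, b, d) \<in> set triples5 \<Longrightarrow> set (cycle_list5 (a, b, d)) \<subseteq> {1..5}"
proof -
  show "length (cycle_list5 c) = 5" by (simp add: cycle_list5_def split_def)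
  assume "(a, b, d) \<in> set triples5"
  then have "{a, b, d} \<subseteq> {1..5}" using triples5_distinct by blast
  moreover have "(\<lambda>i. if i = a then b else if i = b then d else if i = d then a else i) ` S \<subseteq> {a, b, d} \<union> S" for S
    by auto
  then have "set (cycle_list5 (a, b, d)) \<subseteq> {a, b, d} \<union> set [1, 2, 3, 4, 5]"
    unfolding cycle_list5_def split set_map .
  moreover have "set [1, 2, 3, 4, 5] \<subseteq> {1..5 :: nat}" by simp
  ultimately show "set (cycle_list5 (a, b, d)) \<subseteq> {1..5}" by blast
qed

lemma is_three_cycle_listD:
  assumes "is_three_cycle_list s"
  shows "length s = 5" "perm_of_list s \<in> three_cycles 5"
proof -
  obtain a b c where abc: "(a, b, c) \<in> set triples5" and s: "s = cycle_list5 (a, b, c) \<or> s = cycle_list5 (a, c, b)"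
    using assms by (auto simp: is_three_cycle_list_def list_ex_iff)
  note d = triples5_distinct[OF abc]
  have "perm_of_list s = cycle_of_list [a, b, c] \<or> perm_of_list s = cycle_of_list [a, c, b]"
    using s d perm_of_cycle_list5[of a b c] perm_of_cycle_list5[of a c b] by auto
  moreover have "cycle [a, b, c]" "cycle [a, c, b]" "set [a, b, c] \<subseteq> {1..5}" "set [a, c, b] \<subseteq> {1..5}"
    using d by auto
  ultimately show "perm_of_list s \<in> three_cycles 5"
    by (smt (verit, best) length_Cons list.size(3) mem_Collect_eq numeral_3_eq_3)
  show "length s = 5" using s cycle_list5_valid(1) by auto
qed

text \<open>Transfers the enumeration from lists to permutations. The commutator relation is written
  without inverse functions, which matches the equation tested on lists.\<close>

lemma three_cycle_from_perm:
  assumes x: "x permutes {1..5}" "x \<noteq> id"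
  shows "x \<circ> x \<in> three_cycles 5 \<or>
    (\<exists>\<tau>\<in>three_cycles 5. \<exists>\<sigma>\<in>three_cycles 5. \<tau> \<circ> x = \<sigma> \<circ> (x \<circ> \<tau>))"
proof -
  define l where "l = map x [1, 2, 3, 4, 5]"
  have px: "perm_of_list l = x" unfolding l_def by (rule perm_of_list_permutes[OF x(1)])
  have len: "length l = 5" by (simp add: l_def)
  have "set [1, 2, 3, 4, 5] \<subseteq> {1..5 :: nat}" by simp
  then have sub: "set l \<subseteq> {1..5}"
    unfolding l_def set_map using permutes_image[OF x(1)] by (metis image_mono)
  have "distinct l" unfolding l_def distinct_map using permutes_inj[OF x(1)] by (simp add: inj_eq)
  moreover have "{1..5} \<subseteq> set [1, 2, 3, 4, 5 :: nat]" by auto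
  then have "set l \<subseteq> set [1, 2, 3, 4, 5]" using sub by blast
  ultimately have "l \<in> set (arrangements 5 [1, 2, 3, 4, 5])" using in_arrangements[of l "[1, 2, 3, 4, 5]"] len by simp
  moreover have "l \<noteq> [1, 2, 3, 4, 5]"
  proof
    assume "l = [1, 2, 3, 4, 5]"
    then have "x = perm_of_list (map id [1, 2, 3, 4, 5])" using px by simp
    then show False using x(2) perm_of_list_permutes[OF permutes_id] by simp
  qed
  ultimately consider c where "c \<in> set triples5" "commutator_is_three_cycle l (cycle_list5 c)"
    | "is_three_cycle_list (comp_list l l)"
    using three_cycle_from_perm_list unfolding list_all_iff list_ex_iff by blast
  then show ?thesis
  proof cases
    case 1
    obtain a b c' where c: "c = (a, b, c')" by (cases c)
    let ?t = "cycle_list5 c"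
    obtain s where s: "comp_list ?t l = comp_list s (comp_list l ?t)" "is_three_cycle_list s"
      using 1(2) by (auto simp: commutator_is_three_cycle_def Let_def)
    have t: "length ?t = 5" "set ?t \<subseteq> {1..5}" using 1(1) cycle_list5_valid c by auto
    have "is_three_cycle_list ?t" using 1(1) c by (auto simp: is_three_cycle_list_def list_ex_iff)
    note tD = is_three_cycle_listD[OF this] and sD = is_three_cycle_listD[OF s(2)]
    have v: "length (comp_list l ?t) = 5" "set (comp_list l ?t) \<subseteq> {1..5}"
    proof -
      have "l ! (i - 1) \<in> set l" if "i \<in> {1..5}" for i using that len by (intro nth_mem) auto
      then show "set (comp_list l ?t) \<subseteq> {1..5}" unfolding comp_list_def set_map using t(2) sub by blast
    qed (simp add: comp_list_def t)
    have "perm_of_list ?t \<circ> x = perm_of_list s \<circ> (x \<circ> perm_of_list ?t)"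
      using perm_of_list_comp[OF t(1) len sub] perm_of_list_comp[OF sD(1) v] perm_of_list_comp[OF len t] s(1)
      by (simp add: px)
    then show ?thesis using tD sD by blast
  next
    case 2
    then show ?thesis using is_three_cycle_listD(2)[OF 2] perm_of_list_comp[OF len len sub] px by simp
  qed
qed

text \<open>Any two 3-cycles are conjugate by a permutation, and by an even one because two points remain free.\<close>
lemma three_cycles_conjugate:
  assumes \<sigma>: "\<sigma> \<in> three_cycles n" and \<tau>: "\<tau> \<in> three_cycles n" and n: "n \<ge> 5"
  shows "\<exists>q\<in>carrier (alt_group n). q \<circ> \<sigma> \<circ> inv' q = \<tau>"
proof -
  obtain a b c where s: "\<sigma> = cycle_of_list [a, b, c]" "distinct [a, b, c]" "{a, b, c} \<subseteq> {1..n}"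
    using \<sigma> by (auto simp: length_Suc_conv numeral_3_eq_3)
  obtain a' b' c' where t: "\<tau> = cycle_of_list [a', b', c']" "distinct [a', b', c']" "{a', b', c'} \<subseteq> {1..n}"
    using \<tau> by (auto simp: length_Suc_conv numeral_3_eq_3)
  have "\<exists>q. q permutes {1..n} \<and> q a = a' \<and> q b = b' \<and> q c = c'"
  proof -
    \<comment> \<open>Each further transposition sends the next point to its target and fixes the
      targets already reached.\<close>
    define q1 where "q1 = transpose a a'"
    define q2 where "q2 = transpose (q1 b) b' \<circ> q1"
    define q3 where "q3 = transpose (q2 c) c' \<circ> q2"
    have q1: "q1 permutes {1..n}" unfolding q1_def using s(3) t(3) by (intro permutes_swap_id) auto
    have q2: "q2 permutes {1..n}" unfolding q2_def using s(3) t(3) permutes_in_image[OF q1, of b]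
      by (intro permutes_compose[OF q1] permutes_swap_id) auto
    have q3: "q3 permutes {1..n}" unfolding q3_def using s(3) t(3) permutes_in_image[OF q2, of c]
      by (intro permutes_compose[OF q2] permutes_swap_id) auto
    have 1: "q1 a = a'" "q1 b \<noteq> a'" using s(2) by (auto simp: q1_def transpose_def split: if_splits)
    have 2: "q2 a = a'" "q2 b = b'" using 1 t(2) by (auto simp: q2_def transpose_def)
    have "q2 c \<noteq> a'" "q2 c \<noteq> b'" using 2 permutes_inj[OF q2] s(2) by (metis distinct_length_2_or_more injD)+
    then have "q3 a = a'" "q3 b = b'" "q3 c = c'" using 2 t(2) by (auto simp: q3_def transpose_def)
    then show ?thesis using q3 by blast
  qed
  then obtain q where q: "q permutes {1..n}" "q a = a'" "q b = b'" "q c = c'" by blast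
  \<comment> \<open>Composing with the transposition of two points outside the target cycle corrects
    the parity without changing the images of a, b, c.\<close>
  have "card ({1..n} - {a', b', c'}) \<ge> 2" using t(2,3) n by (simp add: card_Diff_subset)
  then obtain d e where de: "d \<in> {1..n} - {a', b', c'}" "e \<in> {1..n} - {a', b', c'}" "d \<noteq> e"
    by (rule obtain_subset_with_card_n) (auto simp: card_2_iff)
  define r where "r = (if evenperm q then q else transpose d e \<circ> q)"
  have r: "r permutes {1..n}" "r a = a'" "r b = b'" "r c = c'"
    using q de by (auto simp: r_def intro!: permutes_compose permutes_swap_id)
  have "evenperm r"
    using de evenperm_comp[OF permutation_swap_id, of q d e] permutes_imp_permutation[OF _ q(1)]
    by (auto simp: r_def evenperm_swap)
  then have "r \<in> carrier (alt_group n)" using r by (simp add: alt_group_carrier)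
  moreover have "r \<circ> \<sigma> \<circ> inv' r = \<tau>"
    using conjugation_of_cycle[of "[a, b, c]" r] s t r permutes_bij[OF r(1)] by simp
  ultimately show ?thesis by blast
qed

text \<open>A nontrivial x in N has a square or a commutator with a 3-cycle that is itself a
  3-cycle, and both lie in N. All 3-cycles are conjugate in the group and generate it.\<close>

lemma simple_alt_group_5: "simple_group (alt_group 5)"
proof (intro simple_group.intro simple_group_axioms.intro)
  show grp: "group (alt_group 5)" by (rule alt_group_is_group)
  interpret A: group "alt_group 5" by (rule grp)
  have "2 * order (alt_group 5) = fact 5"
    using alt_group_card_carrier[of 5] by (simp add: order_def)
  then show "order (alt_group 5) > 1" by (simp add: fact_numeral)
  fix N assume N: "N \<lhd> alt_group 5"
  interpret N: normal N "alt_group 5" by (rule N)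
  note closed = subgroup.m_closed[OF N.subgroup_axioms] and inv_closed = subgroup.m_inv_closed[OF N.subgroup_axioms]
  have car: "\<tau> \<in> carrier (alt_group 5)" if "\<tau> \<in> three_cycles 5" for \<tau>
    using that three_cycles_incl by blast
  show "N = carrier (alt_group 5) \<or> N = {\<one>\<^bsub>alt_group 5\<^esub>}"
  proof (cases "N \<subseteq> {\<one>\<^bsub>alt_group 5\<^esub>}")
    case True
    then show ?thesis using N.one_closed by blast
  next
    case False
    then obtain x where x: "x \<in> N" "x \<noteq> id" by (auto simp: alt_group_one)
    have xA: "x \<in> carrier (alt_group 5)" using x(1) N.subset by blast
    then have "x permutes {1..5}" by (simp add: alt_group_carrier)
    from three_cycle_from_perm[OF this x(2)] have "\<exists>\<sigma>\<in>three_cycles 5. \<sigma> \<in> N"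
    proof (elim disjE bexE)
      assume "x \<circ> x \<in> three_cycles 5"
      then show ?thesis using closed[OF x(1) x(1)] by (auto simp: alt_group_mult)
    next
      fix \<tau> \<sigma> assume ts: "\<tau> \<in> three_cycles 5" "\<sigma> \<in> three_cycles 5" "\<tau> \<circ> x = \<sigma> \<circ> (x \<circ> \<tau>)"
      have "\<tau> \<otimes>\<^bsub>alt_group 5\<^esub> x = \<sigma> \<otimes>\<^bsub>alt_group 5\<^esub> (x \<otimes>\<^bsub>alt_group 5\<^esub> \<tau>)"
        using ts(3) by (simp add: alt_group_mult)
      then have "\<sigma> = \<tau> \<otimes>\<^bsub>alt_group 5\<^esub> x \<otimes>\<^bsub>alt_group 5\<^esub> inv\<^bsub>alt_group 5\<^esub> (x \<otimes>\<^bsub>alt_group 5\<^esub> \<tau>)"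
        using car ts(1,2) xA by (simp add: A.inv_solve_right)
      also have "\<dots> = (\<tau> \<otimes>\<^bsub>alt_group 5\<^esub> x \<otimes>\<^bsub>alt_group 5\<^esub> inv\<^bsub>alt_group 5\<^esub> \<tau>) \<otimes>\<^bsub>alt_group 5\<^esub> inv\<^bsub>alt_group 5\<^esub> x"
        using car ts(1) xA by (simp add: A.inv_mult_group A.m_assoc)
      also have "\<dots> \<in> N"
        using closed[OF N.inv_op_closed2[OF car[OF ts(1)] x(1)] inv_closed[OF x(1)]] .
      finally show ?thesis using ts(2) by blast
    qed
    then obtain \<sigma> where \<sigma>: "\<sigma> \<in> three_cycles 5" "\<sigma> \<in> N" by blast
    have "\<tau> \<in> N" if \<tau>: "\<tau> \<in> three_cycles 5" for \<tau>
    proof -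
      obtain q where q: "q \<in> carrier (alt_group 5)" "q \<circ> \<sigma> \<circ> inv' q = \<tau>"
        using three_cycles_conjugate[OF \<sigma>(1) \<tau>] by auto
      then show ?thesis
        using N.inv_op_closed2[OF q(1) \<sigma>(2)] by (simp add: alt_group_mult alt_group_inv_equality)
    qed
    then have "generate (alt_group 5) (three_cycles 5) \<subseteq> N"
      by (intro A.generate_subgroup_incl N.subgroup_axioms) blast
    then show ?thesis using alt_group_carrier_as_three_cycles[of 5] N.subset by blast
  qed
qed

section \<open>Solvability of \<open>sym_group 4\<close> and the factorization of \<open>alt_group 5\<close>\<close>

text \<open>Sylow's theorem with exponent 1 gives a subgroup of order q, in which every nontrivial
  element has order q.\<close>

lemma (in group) cauchy_ord:
  assumes fin: "finite (carrier G)" and q: "Factorial_Ring.prime q" "q dvd order G"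
  shows "\<exists>x\<in>carrier G. ord x = q"
proof -
  obtain m where m: "order G = q ^ 1 * m" using q(2) by auto
  obtain H where H: "subgroup H G" "card H = q"
    using sylow_thm[OF q(1) is_group m fin] by auto
  have "\<not> H \<subseteq> {\<one>}"
    using H(2) prime_gt_1_nat[OF q(1)] card_mono[of "{\<one>}" H] by auto
  then obtain x where x: "x \<in> H" "x \<noteq> \<one>" by blast
  interpret H: group "G\<lparr>carrier := H\<rparr>" using subgroup_imp_group[OF H(1)] .
  have "x [^] q = \<one>"
    using H.pow_order_eq_1[of x] x(1) H(2) nat_pow_consistent[of x q H] by (simp add: order_def)
  then show ?thesis using ord_prime[of x q] x q(1) subgroup.subset[OF H(1)] by blast
qed

lemma (in group) comm_group_if_involutive:
  assumes inv: "\<And>x. x \<in> carrier G \<Longrightarrow> x \<otimes> x = \<one>"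
  shows "comm_group G"
proof (rule group_comm_groupI)
  fix x y assume xy: "x \<in> carrier G" "y \<in> carrier G"
  have self: "inv z = z" if "z \<in> carrier G" for z using inv_equality[OF inv[OF that] that that] .
  have "x \<otimes> y = inv (x \<otimes> y)" using self[of "x \<otimes> y"] xy by simp
  also have "\<dots> = inv y \<otimes> inv x" using xy by (simp add: inv_mult_group)
  also have "\<dots> = y \<otimes> x" using xy self by simp
  finally show "x \<otimes> y = y \<otimes> x" .
qed

lemma solvable_sym_group_if_alt_group:
  assumes "solvable (alt_group n)"
  shows "solvable (sym_group n)"
proof -
  interpret S: group_hom "sym_group n" sign_img sign by (rule sign_group_hom)
  interpret A: group "alt_group n" by (rule alt_group_is_group)
  \<comment> \<open>The image is taken as codomain because \<open>sign\<close> is not onto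
    \<open>sign_img\<close> when n is at most 1.\<close>
  let ?I = "sign_img\<lparr>carrier := sign ` carrier (sym_group n)\<rparr>"
  have sub: "subgroup (sign ` carrier (sym_group n)) sign_img" by (rule S.img_is_subgroup)
  have I: "group ?I" by (rule S.H.subgroup_imp_group[OF sub])
  have "comm_group ?I"
    by (rule group.comm_group_if_involutive[OF I]) (auto simp: sign_img_def sign_def split: if_splits)
  show ?thesis
  proof (rule solvable_condition[of "alt_group n" _ id ?I sign])
    show "group_hom (alt_group n) (sym_group n) id"
      unfolding group_hom_def group_hom_axioms_def
      using alt_group_is_group sym_group_is_group
      by (auto simp: hom_def alt_group_mult sym_group_mult alt_group_carrier sym_group_carrier)
    show "group_hom (sym_group n) ?I sign"
      unfolding group_hom_def group_hom_axioms_def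
      using sym_group_is_group I S.hom_mult by (auto simp: hom_def)
    show "kernel (sym_group n) ?I sign \<subseteq> id ` carrier (alt_group n)"
      by (auto simp: alt_group_is_sign_kernel kernel_def)
  qed (use assms comm_group.solvable_comm_group[OF \<open>comm_group ?I\<close>] in auto)
qed

lemma solvable_sym_group_3: "solvable (sym_group 3)"
proof (rule solvable_sym_group_if_alt_group)
  interpret A: group "alt_group 3" by (rule alt_group_is_group)
  have "2 * order (alt_group 3) = fact 3" using alt_group_card_carrier[of 3] by (simp add: order_def)
  then have o3: "order (alt_group 3) = 3" by (simp add: fact_numeral)
  then have fin: "finite (carrier (alt_group 3))" by (metis A.order_gt_0_iff_finite zero_less_numeral)
  obtain x where x: "x \<in> carrier (alt_group 3)" "x \<noteq> \<one>\<^bsub>alt_group 3\<^esub>"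
  proof -
    have "\<not> carrier (alt_group 3) \<subseteq> {\<one>\<^bsub>alt_group 3\<^esub>}"
      using o3 card_mono[of "{\<one>\<^bsub>alt_group 3\<^esub>}" "carrier (alt_group 3)"] by (auto simp: order_def)
    then show ?thesis using that by blast
  qed
  have "x [^]\<^bsub>alt_group 3\<^esub> (3::nat) = \<one>\<^bsub>alt_group 3\<^esub>" using A.pow_order_eq_1[OF x(1)] o3 by simp
  then have ord: "A.ord x = 3" using A.ord_prime[OF x] by simp
  interpret h: group_hom "integer_mod_group 3" "alt_group 3" "\<lambda>k. x [^]\<^bsub>alt_group 3\<^esub> k"
    using A.integer_mod_group_hom[OF x(1), of 3] \<open>x [^]\<^bsub>alt_group 3\<^esub> (3::nat) = \<one>\<^bsub>alt_group 3\<^esub>\<close> by simp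
  have inj: "inj_on (\<lambda>k::int. x [^]\<^bsub>alt_group 3\<^esub> k) (carrier (integer_mod_group 3))"
    using A.inj_integer_mod_group_hom[OF x(1) _ ord] by simp
  have "(\<lambda>k::int. x [^]\<^bsub>alt_group 3\<^esub> k) ` carrier (integer_mod_group 3) = carrier (alt_group 3)"
    using card_image[OF inj] o3 h.hom_closed
    by (intro card_subset_eq[OF fin]) (auto simp: order_def carrier_integer_mod_group)
  then show "solvable (alt_group 3)" by (rule h.surj_hom_imp_solvable[OF _ solvable_integer_mod_group])
qed

text \<open>The three partitions of \<open>{1..4}\<close> into two pairs are indexed by the partner of \<open>4\<close>;
  \<open>pairing a b\<close> is the index of the partition containing the pair \<open>{a, b}\<close>.\<close>
definition pairing :: "nat \<Rightarrow> nat \<Rightarrow> nat" where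
  "pairing a b = (if b = 4 then a else if a = 4 then b else 6 - (a + b))"

text \<open>The action on the three partitions, known from the cubic resolvent of a quartic:
  partition i contains the pair i, 4, so its image contains s i, s 4.\<close>

definition resolvent :: "(nat \<Rightarrow> nat) \<Rightarrow> nat \<Rightarrow> nat" where
  "resolvent s i = (if i \<in> {1..3} then pairing (s i) (s 4) else i)"

lemma pairing_4 [simp]: "pairing a 4 = a" "pairing 4 b = b"
  by (simp_all add: pairing_def)

lemma pairing_range:
  "\<lbrakk>a \<in> {1..4}; b \<in> {1..4}; a \<noteq> b\<rbrakk> \<Longrightarrow> pairing a b \<in> {1..3}"
  by (auto simp: pairing_def)

lemma pairing_inj:
  "\<lbrakk>a \<in> {1..4}; b \<in> {1..4}; c \<in> {1..4}; a \<noteq> c; b \<noteq> c; pairing a c = pairing b c\<rbrakk> \<Longrightarrow> a = b"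
  by (auto simp: pairing_def split: if_splits; presburger)

text \<open>Two complementary pairs form one partition. In the formulas this holds because the four
  points sum to 10, so 6 - (a + b) is the partner of 4.\<close>

lemma pairing_complement:
  assumes "{a, b, c, d} \<subseteq> {1..4}" "distinct [a, b, c, d]"
  shows "pairing a b = pairing c d"
proof -
  have eq: "{a, b, c, d} = {1..4}" using assms by (intro card_subset_eq) auto
  then have four: "a = 4 \<or> b = 4 \<or> c = 4 \<or> d = 4" by auto
  note eq
  also have "{1..4} = {1, 2, 3, 4 :: nat}" by auto
  finally have "\<Sum>{a, b, c, d} = \<Sum>{1, 2, 3, 4}" by simp
  then have "a + b + c + d = 10" using assms(2) by simp
  then show ?thesis using assms four by (auto simp: pairing_def)
qed

lemma sym4_range: "\<lbrakk>s permutes {1..4}; i \<in> {1..4}\<rbrakk> \<Longrightarrow> s i \<in> {1..4::nat}"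
  using permutes_in_image[of s "{1..4}" i] by blast

lemma resolvent_permutes:
  assumes s: "s permutes {1..4}"
  shows "resolvent s permutes {1..3}"
proof (rule bij_imp_permutes)
  have ne: "s i \<noteq> s 4" if "i \<in> {1..3}" for i using permutes_inj[OF s] that by (auto simp: inj_eq)
  have r: "s i \<in> {1..4}" if "i \<in> {1..4}" for i using sym4_range[OF s that] .
  have "inj_on (resolvent s) {1..3}"
  proof (rule inj_onI)
    fix i j :: nat assume ij: "i \<in> {1..3}" "j \<in> {1..3}" "resolvent s i = resolvent s j"
    have "s i = s j"
      using ij ne[OF ij(1)] ne[OF ij(2)] r[of i] r[of j] r[of 4]
      by (intro pairing_inj[of "s i" "s j" "s 4"]) (simp_all add: resolvent_def)
    then show "i = j" using permutes_inj[OF s] by (auto simp: inj_eq)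
  qed
  moreover have "resolvent s ` {1..3} \<subseteq> {1..3}"
  proof (rule image_subsetI)
    fix i :: nat assume i: "i \<in> {1..3}"
    then have "i \<in> {1..4}" by simp
    then show "resolvent s i \<in> {1..3}" using pairing_range[OF r r ne[OF i]] i by (simp add: resolvent_def)
  qed
  ultimately show "bij_betw (resolvent s) {1..3} {1..3}" by (simp add: inj_on_finite endo_inj_surj bij_betw_def)
qed (auto simp: resolvent_def)

lemma resolvent_comp:
  assumes s: "s permutes {1..4}" and t: "t permutes {1..4}"
  shows "resolvent (s \<circ> t) = resolvent s \<circ> resolvent t"
proof
  fix i
  show "resolvent (s \<circ> t) i = (resolvent s \<circ> resolvent t) i"
  proof (cases "i \<in> {1..3}")
    case True
    define a b where "a = t i" and "b = t 4"
    have ab: "a \<in> {1..4}" "b \<in> {1..4}" "a \<noteq> b"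
      using sym4_range[OF t, of i] sym4_range[OF t, of 4] True permutes_inj[OF t] by (auto simp: a_def b_def inj_eq)
    have "pairing (s a) (s b) = resolvent s (pairing a b)"
    proof -
      consider "b = 4" | "a = 4" | "a \<noteq> 4" "b \<noteq> 4" by blast
      then show ?thesis
      proof cases
        case 1
        then show ?thesis using ab by (auto simp: resolvent_def)
      next
        case 2
        then have "pairing (s a) (s b) = pairing (s b) (s a)" by (simp add: pairing_def add.commute)
        then show ?thesis using 2 ab by (auto simp: resolvent_def)
      next
        case 3
        \<comment> \<open>The pair a, b avoids 4, so it is traded for the complementary pair c, 4;
          their images under s are complementary again.\<close>
        define c where "c = 6 - (a + b)"
        have ab3: "1 \<le> a" "a \<le> 3" "1 \<le> b" "b \<le> 3" using ab 3 by auto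
        then have "a = 1 \<or> a = 2 \<or> a = 3" "b = 1 \<or> b = 2 \<or> b = 3" by linarith+
        then have c: "c \<in> {1..3}" "c \<noteq> a" "c \<noteq> b" using ab(3) unfolding c_def by auto
        have "distinct [s a, s b, s c, s 4]"
          using ab 3 c permutes_inj[OF s] by (auto simp: inj_eq)
        moreover have "{s a, s b, s c, s 4} \<subseteq> {1..4}"
          using ab c sym4_range[OF s] by auto
        ultimately have "pairing (s a) (s b) = pairing (s c) (s 4)" by (intro pairing_complement)
        then show ?thesis using 3 c by (simp add: resolvent_def pairing_def[of a] c_def)
      qed
    qed
    moreover have "pairing a b \<in> {1..3}" using pairing_range ab by blast
    ultimately show ?thesis using True by (simp add: resolvent_def a_def b_def)
  next
    case False
    then have "resolvent f i = i" for f by (simp only: resolvent_def if_False)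
    then show ?thesis by simp
  qed
qed

text \<open>An s preserving all three partitions is the identity if it fixes 4. Otherwise it swaps 4
  with k = s 4 and swaps the two remaining points.\<close>

lemma resolvent_kernel_involutive:
  assumes s: "s permutes {1..4}" and id: "resolvent s = id"
  shows "s \<circ> s = id"
proof -
  have r: "s i \<in> {1..4}" if "i \<in> {1..4}" for i using sym4_range[OF s that] .
  have p: "pairing (s i) (s 4) = i" if "i \<in> {1..3}" for i
    using fun_cong[OF id, of i] that by (simp add: resolvent_def)
  have ne: "s i \<noteq> s j" if "i \<noteq> j" for i j using permutes_inj[OF s] that by (simp add: inj_eq)
  show ?thesis
  proof (cases "s 4 = 4")
    case True
    then have "s i = i" if "i \<in> {1..4}" for i
      using p[of i] that by (cases "i = 4") (auto simp: pairing_def)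
    then have "s i = i" for i using permutes_not_in[OF s] by blast
    then show ?thesis by auto
  next
    case False
    define k where "k = s 4"
    have k: "k \<in> {1..3}" using r[of 4] False by (auto simp: k_def)
    have "s k = 4"
    proof (rule ccontr)
      assume "s k \<noteq> 4"
      then have "6 - (s k + k) = k" using p[OF k] False by (simp add: pairing_def k_def[symmetric])
      moreover have "s k \<noteq> k" using ne[of k 4] k by (auto simp: k_def)
      moreover have "s k \<in> {1..3}" using r[of k] k \<open>s k \<noteq> 4\<close> by auto
      ultimately show False using k by auto presburger
    qed
    have si: "s i = 6 - (i + k) \<and> i + k < 6 \<and> s i \<in> {1..3} - {k}" if i: "i \<in> {1..3} - {k}" for i
    proof -
      have "s i \<noteq> 4" using ne[of i k] i \<open>s k = 4\<close> by auto
      moreover have "s i \<noteq> k" using ne[of i 4] i by (auto simp: k_def)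
      moreover have "s i \<in> {1..4}" using r[of i] i by auto
      moreover from calculation have "6 - (s i + k) = i" using p[of i] i False by (simp add: pairing_def k_def[symmetric])
      ultimately show ?thesis using i k by auto
    qed
    have "s (s i) = i" if i: "i \<in> {1..4}" for i
    proof -
      consider "i = 4" | "i = k" | "i \<in> {1..3} - {k}" using i by force
      then show ?thesis
      proof cases
        case 3
        then show ?thesis using si[of i] si[of "s i"] by auto
      qed (use \<open>s k = 4\<close> k_def in auto)
    qed
    moreover have "s (s i) = i" if "i \<notin> {1..4}" for i using permutes_not_in[OF s that] by simp
    ultimately show ?thesis by (intro ext) (metis comp_apply id_apply)
  qed
qed

text \<open>The kernel of the resolvent is the Klein four-group, its image lies in \<open>sym_group 3\<close>.\<close>
lemma solvable_sym_group_4: "solvable (sym_group 4)"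
proof -
  have hom: "group_hom (sym_group 4) (sym_group 3) resolvent"
    unfolding group_hom_def group_hom_axioms_def
    using sym_group_is_group resolvent_permutes resolvent_comp
    by (auto simp: hom_def sym_group_carrier sym_group_mult)
  interpret h: group_hom "sym_group 4" "sym_group 3" resolvent by (rule hom)
  let ?K = "kernel (sym_group 4) (sym_group 3) resolvent"
  let ?I = "(sym_group 3)\<lparr>carrier := resolvent ` carrier (sym_group 4)\<rparr>"
  have K: "group ((sym_group 4)\<lparr>carrier := ?K\<rparr>)" by (rule h.G.subgroup_imp_group[OF h.subgroup_kernel])
  have "comm_group ((sym_group 4)\<lparr>carrier := ?K\<rparr>)"
    by (rule group.comm_group_if_involutive[OF K])
      (auto simp: kernel_def sym_group_mult sym_group_one sym_group_carrier resolvent_kernel_involutive)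
  then have solK: "solvable ((sym_group 4)\<lparr>carrier := ?K\<rparr>)" by (rule comm_group.solvable_comm_group)
  have I: "group ?I" by (rule h.H.subgroup_imp_group[OF h.img_is_subgroup])
  interpret i: group_hom ?I "sym_group 3" id
    unfolding group_hom_def group_hom_axioms_def using I h.H.is_group h.hom_closed by (auto simp: hom_def)
  have solI: "solvable ?I" by (rule i.inj_hom_imp_solvable[OF _ solvable_sym_group_3]) simp
  show ?thesis
  proof (rule solvable_condition[OF _ _ _ _ solK solI])
    show "group_hom ((sym_group 4)\<lparr>carrier := ?K\<rparr>) (sym_group 4) id"
      unfolding group_hom_def group_hom_axioms_def using K h.G.is_group by (auto simp: hom_def kernel_def)
    show "group_hom (sym_group 4) ?I resolvent"
      unfolding group_hom_def group_hom_axioms_def using I h.G.is_group h.hom_mult by (auto simp: hom_def)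
  qed (auto simp: kernel_def)
qed

lemma solvable_alt_group_4: "solvable (alt_group 4)"
proof -
  interpret group_hom "alt_group 4" "sym_group 4" id
    unfolding group_hom_def group_hom_axioms_def
    using alt_group_is_group sym_group_is_group
    by (auto simp: hom_def alt_group_mult sym_group_mult alt_group_carrier sym_group_carrier)
  show ?thesis by (rule inj_hom_imp_solvable[OF _ solvable_sym_group_4]) simp
qed

theorem hopf_galois_structure_alt_group_5:
  assumes ext: "galois_extension L K" "galois_group L K \<cong> alt_group 4 \<times>\<times> integer_mod_group 5"
  shows "admits_hopf_galois_structure_of_type L K (alt_group 5)"
proof -
  interpret A: group "alt_group 5" by (rule alt_group_is_group)
  have "2 * order (alt_group 5) = fact 5" "2 * order (alt_group 4) = fact 4"
    using alt_group_card_carrier[of 5] alt_group_card_carrier[of 4] by (simp_all add: order_def)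
  then have ord: "order (alt_group 5) = 60" "order (alt_group 4) = 12" by (simp_all add: fact_numeral)
  have o5: "order (integer_mod_group 5) = 5" by (rule order_integer_mod_group) simp
  have fin: "finite (carrier (alt_group 5))" using ord A.order_gt_0_iff_finite by simp
  have \<alpha>: "group_hom (alt_group 4) (alt_group 5) id"
    unfolding group_hom_def group_hom_axioms_def
    using alt_group_is_group permutes_subset[of _ "{1..4::nat}" "{1..5}"]
    by (auto simp: hom_def alt_group_mult alt_group_carrier)
  obtain x where x: "x \<in> carrier (alt_group 5)" "A.ord x = 5"
    using A.cauchy_ord[OF fin, of 5] ord by auto
  interpret h: group_hom "integer_mod_group 5" "alt_group 5" "\<lambda>k. x [^]\<^bsub>alt_group 5\<^esub> k"
    using A.integer_mod_group_hom[OF x(1), of 5] x A.pow_ord_eq_1[OF x(1)] by simp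
  have "inj_on (\<lambda>k::int. x [^]\<^bsub>alt_group 5\<^esub> k) (carrier (integer_mod_group 5))"
    using A.inj_integer_mod_group_hom[OF x(1) _ x(2)] by simp
  moreover have "coprime (12::nat) 5" by code_simp
  ultimately show ?thesis
    using exact_factorization_hopf_galois[OF ext fin \<alpha> h.group_hom_axioms] ord o5 by simp
qed

section \<open>The 3-dimensional binary representation of \<open>SL 2 7\<close>\<close>

text \<open>No determinant has to be computed: those of f x and f (x^-1) multiply to 1 modulo p, and
  \<open>unit\<close> says that 1 is the only unit. It is applied with p = 2.\<close>

lemma hom_into_SL:
  fixes f :: "'a \<Rightarrow> int mat"
  assumes G: "group G" and p: "p > 1"
    and f: "\<And>x. x \<in> carrier G \<Longrightarrow> f x \<in> carrier_mat m m"
    and red: "\<And>x. x \<in> carrier G \<Longrightarrow> reduce_mat p (f x) = f x"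
    and one: "f \<one>\<^bsub>G\<^esub> = 1\<^sub>m m"
    and mult: "\<And>x y. x \<in> carrier G \<Longrightarrow> y \<in> carrier G \<Longrightarrow> f (x \<otimes>\<^bsub>G\<^esub> y) = reduce_mat p (f x * f y)"
    and unit: "\<And>u v :: int. [u * v = 1] (mod int p) \<Longrightarrow> [u = 1] (mod int p)"
  shows "group_hom G (SL m p) f"
proof -
  interpret G: group G by fact
  have "f x \<in> carrier (SL m p)" if x: "x \<in> carrier G" for x
  proof -
    have ix: "inv\<^bsub>G\<^esub> x \<in> carrier G" using x by simp
    have "[det (f x) * det (f (inv\<^bsub>G\<^esub> x)) = det (reduce_mat p (f x * f (inv\<^bsub>G\<^esub> x)))] (mod int p)"
      using det_reduce_mat[of "f x * f (inv\<^bsub>G\<^esub> x)" m p] f[OF x] f[OF ix] det_mult[OF f[OF x] f[OF ix]]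
      by (simp add: cong_sym)
    also have "reduce_mat p (f x * f (inv\<^bsub>G\<^esub> x)) = 1\<^sub>m m" using mult[OF x ix] x one by simp
    finally have "[det (f x) = 1] (mod int p)" using unit by simp
    then show ?thesis using reduce_mat_in_SL[OF f[OF x] _ p] red[OF x] by simp
  qed
  then show ?thesis
    unfolding group_hom_def group_hom_axioms_def
    using G group_SL[OF p] mult by (auto simp: hom_def mult_SL)
qed

lemma odd_factor_cong: "[u * v = 1] (mod int 2) \<Longrightarrow> [u = 1] (mod int 2)" for u v :: int
proof -
  assume "[u * v = 1] (mod int 2)"
  then have "odd (u * v)" by (auto simp: cong_def)
  then have "odd u" by simp
  then show ?thesis by (simp add: cong_def odd_iff_mod_2_eq_one)
qed

text \<open>
  \<open>qr_word k\<close> is the indicator of the points \<open>(u : v)\<close> of the affine line over the field of 7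
  elements for which \<open>u/v - k\<close>, or equivalently \<open>(u - k v) v\<close>, is a square; the value at the point
  \<open>(1 : 0)\<close> is \<open>0\<close>. Together with the constants these words span the extended binary quadratic
  residue code of length 8, which \<open>SL 2 7\<close> preserves. Modulo the constants the words for
  \<open>k = 0, 1, 2\<close> are a basis, dual to the differences of the evaluations at \<open>0, 5, 6\<close> and at \<open>(1 : 0)\<close>.
\<close>
definition qr_word :: "int \<Rightarrow> int \<Rightarrow> int \<Rightarrow> int" where
  "qr_word k u v = (if v mod 7 \<noteq> 0 \<and> ((u - k * v) * v) mod 7 \<in> {0, 1, 2, 4} then 1 else 0)"

definition dual_point :: "nat \<Rightarrow> int" where
  "dual_point j = (if j = 0 then 0 else int j + 4)"

text \<open>The coefficient at word j of the transformed word i. The second summand is the value of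
  the transformed word at (1 : 0), which removes the constant part modulo 2.\<close>

definition qr_entry :: "int \<Rightarrow> int \<Rightarrow> int \<Rightarrow> int \<Rightarrow> nat \<Rightarrow> nat \<Rightarrow> int" where
  "qr_entry a b c d j i =
     (qr_word (int i) (d * dual_point j - b) (a - c * dual_point j) + qr_word (int i) d (- c)) mod 2"

text \<open>
  The matrix \<open>a, b, c, d\<close> acts on words through its inverse, which maps \<open>(u, v)\<close> to
  \<open>(d u - b v, a v - c u)\<close>; evaluation at the dual points shows that the matrix of this action
  must be \<open>qr_entry a b c d\<close>.
\<close>
definition preserves_qr_code :: "int \<Rightarrow> int \<Rightarrow> int \<Rightarrow> int \<Rightarrow> bool" where
  "preserves_qr_code a b c d \<longleftrightarrow>
     (\<forall>i<3. \<forall>u v. \<not> (7 dvd u \<and> 7 dvd v) \<longrightarrow>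
       [qr_word (int i) (d * u - b * v) (a * v - c * u) =
        (\<Sum>k<3. qr_entry a b c d k i * qr_word (int k) u v) + qr_word (int i) d (- c)] (mod 2))"

lemma qr_word_cong:
  assumes "[u = u'] (mod 7)" "[v = v'] (mod 7)"
  shows "qr_word k u v = qr_word k u' v'"
proof -
  have "[(u - k * v) * v = (u' - k * v') * v'] (mod 7)"
    using assms by (intro cong_mult cong_diff cong_refl)
  then show ?thesis using assms(2) by (simp add: qr_word_def cong_def)
qed

lemma qr_entry_cong:
  assumes "[a = a'] (mod 7)" "[b = b'] (mod 7)" "[c = c'] (mod 7)" "[d = d'] (mod 7)"
  shows "qr_entry a b c d j i = qr_entry a' b' c' d' j i"
proof -
  have "qr_word k (d * x - b) (a - c * x) = qr_word k (d' * x - b') (a' - c' * x)"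
    "qr_word k d (- c) = qr_word k d' (- c')" for k x
    using assms by (intro qr_word_cong cong_diff cong_mult cong_refl; simp add: cong_minus_minus_iff)+
  then show ?thesis by (simp add: qr_entry_def)
qed

lemma qr_entry_mod_2: "[qr_entry a b c d j i =
    qr_word (int i) (d * dual_point j - b) (a - c * dual_point j) + qr_word (int i) d (- c)] (mod 2)"
  by (simp add: qr_entry_def cong_def)

lemma not_both_dvd_7:
  fixes a b c d u v :: int
  assumes "[a * d - b * c = 1] (mod 7)" "\<not> (7 dvd u \<and> 7 dvd v)"
  shows "\<not> (7 dvd d * u - b * v \<and> 7 dvd a * v - c * u)"
proof
  assume *: "7 dvd d * u - b * v \<and> 7 dvd a * v - c * u"
  have det: "7 dvd a * d - b * c - 1" using assms(1) by (simp add: cong_iff_dvd_diff)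
  have "u = a * (d * u - b * v) + b * (a * v - c * u) - u * (a * d - b * c - 1)"
    "v = c * (d * u - b * v) + d * (a * v - c * u) - v * (a * d - b * c - 1)"
    by (simp_all add: algebra_simps)
  then have "7 dvd u \<and> 7 dvd v" using det * by (metis dvd_add dvd_diff dvd_mult)
  then show False using assms(2) by simp
qed

text \<open>Expand word i under the second matrix and evaluate at dual point j and at (1 : 0), both
  moved by the first matrix. The constant of the expansion occurs twice and vanishes modulo 2; what
  is left pairs up into entries of the first matrix.\<close>

lemma qr_entry_mult:
  assumes x: "[a * d - b * c = 1] (mod 7)" and y: "preserves_qr_code a' b' c' d'" and i: "i < 3"
  shows "[qr_entry (a * a' + b * c') (a * b' + b * d') (c * a' + d * c') (c * b' + d * d') j i =
      (\<Sum>k<3. qr_entry a b c d j k * qr_entry a' b' c' d' k i)] (mod 2)"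
proof -
  let ?q = "dual_point j"
  have act: "qr_word (int i) (d' * (d * u - b * v) - b' * (a * v - c * u)) (a' * (a * v - c * u) - c' * (d * u - b * v))
     = qr_word (int i) ((c * b' + d * d') * u - (a * b' + b * d') * v) ((a * a' + b * c') * v - (c * a' + d * c') * u)" for u v
    by (intro qr_word_cong) (simp_all add: algebra_simps)
  have P: "[qr_word (int i) ((c * b' + d * d') * u - (a * b' + b * d') * v) ((a * a' + b * c') * v - (c * a' + d * c') * u)
      = (\<Sum>k<3. qr_entry a' b' c' d' k i * qr_word (int k) (d * u - b * v) (a * v - c * u)) + qr_word (int i) d' (- c')] (mod 2)"
    if "\<not> (7 dvd u \<and> 7 dvd v)" for u v
    using y i not_both_dvd_7[OF x that] unfolding preserves_qr_code_def act[symmetric] by blast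
  let ?W = "\<lambda>k. qr_word (int k) (d * ?q - b) (a - c * ?q) + qr_word (int k) d (- c)"
  have "[qr_entry (a * a' + b * c') (a * b' + b * d') (c * a' + d * c') (c * b' + d * d') j i =
      ((\<Sum>k<3. qr_entry a' b' c' d' k i * qr_word (int k) (d * ?q - b) (a - c * ?q)) + qr_word (int i) d' (- c')) +
      ((\<Sum>k<3. qr_entry a' b' c' d' k i * qr_word (int k) d (- c)) + qr_word (int i) d' (- c'))] (mod 2)"
  proof (rule cong_trans[OF qr_entry_mod_2 cong_add])
    show "[qr_word (int i) ((c * b' + d * d') * ?q - (a * b' + b * d')) (a * a' + b * c' - (c * a' + d * c') * ?q)
      = (\<Sum>k<3. qr_entry a' b' c' d' k i * qr_word (int k) (d * ?q - b) (a - c * ?q)) + qr_word (int i) d' (- c')] (mod 2)"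
      using P[of ?q 1] by simp
    show "[qr_word (int i) (c * b' + d * d') (- (c * a' + d * c'))
      = (\<Sum>k<3. qr_entry a' b' c' d' k i * qr_word (int k) d (- c)) + qr_word (int i) d' (- c')] (mod 2)"
      using P[of 1 0] by simp
  qed
  also have "((\<Sum>k<3. qr_entry a' b' c' d' k i * qr_word (int k) (d * ?q - b) (a - c * ?q)) + qr_word (int i) d' (- c')) +
      ((\<Sum>k<3. qr_entry a' b' c' d' k i * qr_word (int k) d (- c)) + qr_word (int i) d' (- c'))
      = (\<Sum>k<3. qr_entry a' b' c' d' k i * ?W k) + 2 * qr_word (int i) d' (- c')"
    by (simp only: sum.distrib distrib_left mult_2 ac_simps)
  also have "[(\<Sum>k<3. qr_entry a' b' c' d' k i * ?W k) + 2 * qr_word (int i) d' (- c')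
      = (\<Sum>k<3. qr_entry a' b' c' d' k i * ?W k)] (mod 2)" by (simp add: cong_def)
  also have "[(\<Sum>k<3. qr_entry a' b' c' d' k i * ?W k) = (\<Sum>k<3. qr_entry a' b' c' d' k i * qr_entry a b c d j k)] (mod 2)"
    by (intro cong_sum cong_mult cong_refl cong_sym[OF qr_entry_mod_2])
  finally show ?thesis by (simp add: mult.commute)
qed

lemma preserves_qr_code_mult:
  assumes x: "[a * d - b * c = 1] (mod 7)" "preserves_qr_code a b c d" and y: "preserves_qr_code a' b' c' d'"
  shows "preserves_qr_code (a * a' + b * c') (a * b' + b * d') (c * a' + d * c') (c * b' + d * d')"
  unfolding preserves_qr_code_def
proof (intro allI impI)
  fix i :: nat and u v :: int
  assume i: "i < 3" and uv: "\<not> (7 dvd u \<and> 7 dvd v)"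
  let ?A = "a * a' + b * c'" and ?B = "a * b' + b * d'" and ?C = "c * a' + d * c'" and ?D = "c * b' + d * d'"
  let ?e = "\<lambda>k. qr_entry a' b' c' d' k i"
  have act: "qr_word (int i) (d' * (d * u - b * v) - b' * (a * v - c * u)) (a' * (a * v - c * u) - c' * (d * u - b * v))
     = qr_word (int i) (?D * u - ?B * v) (?A * v - ?C * u)" for u v
    by (intro qr_word_cong) (simp_all add: algebra_simps)
  have P: "[qr_word (int i) (?D * u - ?B * v) (?A * v - ?C * u)
      = (\<Sum>k<3. ?e k * qr_word (int k) (d * u - b * v) (a * v - c * u)) + qr_word (int i) d' (- c')] (mod 2)"
    if "\<not> (7 dvd u \<and> 7 dvd v)" for u v
    using y i not_both_dvd_7[OF x(1) that] unfolding preserves_qr_code_def act[symmetric] by blast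
  have inf: "[qr_word (int i) ?D (- ?C) = (\<Sum>k<3. ?e k * qr_word (int k) d (- c)) + qr_word (int i) d' (- c')] (mod 2)"
    using P[of 1 0] by simp
  have "[(\<Sum>k<3. ?e k * qr_word (int k) (d * u - b * v) (a * v - c * u)) =
      (\<Sum>k<3. ?e k * ((\<Sum>l<3. qr_entry a b c d l k * qr_word (int l) u v) + qr_word (int k) d (- c)))] (mod 2)"
    using x(2) uv unfolding preserves_qr_code_def by (intro cong_sum cong_mult cong_refl) simp
  also have "(\<Sum>k<3. ?e k * ((\<Sum>l<3. qr_entry a b c d l k * qr_word (int l) u v) + qr_word (int k) d (- c)))
      = (\<Sum>l<3. (\<Sum>k<3. qr_entry a b c d l k * ?e k) * qr_word (int l) u v) + (\<Sum>k<3. ?e k * qr_word (int k) d (- c))"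
    by (simp add: numeral_3_eq_3 algebra_simps)
  finally have "[(\<Sum>k<3. ?e k * qr_word (int k) (d * u - b * v) (a * v - c * u)) + qr_word (int i) d' (- c') =
      (\<Sum>l<3. (\<Sum>k<3. qr_entry a b c d l k * ?e k) * qr_word (int l) u v)
       + ((\<Sum>k<3. ?e k * qr_word (int k) d (- c)) + qr_word (int i) d' (- c'))] (mod 2)"
    by (simp add: cong_add_rcancel flip: add.assoc)
  moreover have "[(\<Sum>l<3. (\<Sum>k<3. qr_entry a b c d l k * ?e k) * qr_word (int l) u v)
       + ((\<Sum>k<3. ?e k * qr_word (int k) d (- c)) + qr_word (int i) d' (- c'))
     = (\<Sum>l<3. qr_entry ?A ?B ?C ?D l i * qr_word (int l) u v) + qr_word (int i) ?D (- ?C)] (mod 2)"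
    by (intro cong_add cong_sum cong_mult cong_refl cong_sym[OF inf] cong_sym[OF qr_entry_mult[OF x(1) y i]])
  ultimately show "[qr_word (int i) (?D * u - ?B * v) (?A * v - ?C * u) =
      (\<Sum>l<3. qr_entry ?A ?B ?C ?D l i * qr_word (int l) u v) + qr_word (int i) ?D (- ?C)] (mod 2)"
    using P[OF uv] by (blast intro: cong_trans)
qed

lemma preserves_qr_code_cong:
  assumes "[a = a'] (mod 7)" "[b = b'] (mod 7)" "[c = c'] (mod 7)" "[d = d'] (mod 7)"
  shows "preserves_qr_code a b c d \<longleftrightarrow> preserves_qr_code a' b' c' d'"
proof -
  have "qr_word k (d * u - b * v) (a * v - c * u) = qr_word k (d' * u - b' * v) (a' * v - c' * u)"
    "qr_word k d (- c) = qr_word k d' (- c')" for k u v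
    using assms by (intro qr_word_cong cong_diff cong_mult cong_refl; simp add: cong_minus_minus_iff)+
  moreover have "qr_entry a b c d = qr_entry a' b' c' d'"
    using qr_entry_cong[OF assms] by blast
  ultimately show ?thesis by (simp only: preserves_qr_code_def)
qed

text \<open>Since \<open>qr_word\<close> depends only on residues modulo 7, a check at 48 points for
  each of the three words suffices, and this can be evaluated.\<close>

lemma preserves_qr_code_residues:
  assumes "\<forall>i\<in>{0, 1, 2}. \<forall>u\<in>{0, 1, 2, 3, 4, 5, 6}. \<forall>v\<in>{0, 1, 2, 3, 4, 5, 6}. u \<noteq> 0 \<or> v \<noteq> 0 \<longrightarrow>
    (qr_word (int i) (d * u - b * v) (a * v - c * u) -
     (qr_entry a b c d 0 i * qr_word 0 u v + (qr_entry a b c d 1 i * qr_word 1 u v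
       + (qr_entry a b c d 2 i * qr_word 2 u v + qr_word (int i) d (- c))))) mod 2 = 0"
  shows "preserves_qr_code a b c d"
  unfolding preserves_qr_code_def
proof (intro allI impI)
  fix i :: nat and u v :: int
  assume i: "i < 3" and uv: "\<not> (7 dvd u \<and> 7 dvd v)"
  define u' v' where "u' = u mod 7" and "v' = v mod 7"
  have uv': "[u = u'] (mod 7)" "[v = v'] (mod 7)" by (simp_all add: u'_def v'_def cong_def)
  have "u' \<in> {0, 1, 2, 3, 4, 5, 6}" "v' \<in> {0, 1, 2, 3, 4, 5, 6}" unfolding u'_def v'_def by auto
  moreover have "u' \<noteq> 0 \<or> v' \<noteq> 0" using uv by (auto simp: u'_def v'_def dvd_eq_mod_eq_0)
  moreover have "i \<in> {0, 1, 2}" using i by auto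
  ultimately have "(qr_word (int i) (d * u' - b * v') (a * v' - c * u') -
     (qr_entry a b c d 0 i * qr_word 0 u' v' + (qr_entry a b c d 1 i * qr_word 1 u' v'
       + (qr_entry a b c d 2 i * qr_word 2 u' v' + qr_word (int i) d (- c))))) mod 2 = 0"
    using assms by blast
  moreover have "qr_word k (d * u - b * v) (a * v - c * u) = qr_word k (d * u' - b * v') (a * v' - c * u')"
    "qr_word k u v = qr_word k u' v'" for k
    using uv' by (intro qr_word_cong cong_diff cong_mult cong_refl; simp)+
  ultimately show "[qr_word (int i) (d * u - b * v) (a * v - c * u) =
        (\<Sum>k<3. qr_entry a b c d k i * qr_word (int k) u v) + qr_word (int i) d (- c)] (mod 2)"
    by (simp add: numeral_3_eq_3 numeral_2_eq_2 cong_iff_dvd_diff dvd_eq_mod_eq_0 add.assoc)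
qed

lemma preserves_qr_code_generators: "preserves_qr_code 1 1 0 1" "preserves_qr_code 1 0 1 1"
  by (rule preserves_qr_code_residues, code_simp)+

section \<open>The groups \<open>PSL 3 2\<close> and \<open>PSL 2 7\<close>\<close>

lemma preserves_qr_code_SL2:
  assumes "[a * d - b * c = 1] (mod 7)"
  shows "preserves_qr_code a b c d"
proof -
  have p7: "Factorial_Ring.prime (7::nat)" by simp
  let ?H = "{A. \<exists>a b c d. A = sl2 7 a b c d \<and> [a * d - b * c = 1] (mod 7) \<and> preserves_qr_code a b c d}"
  have upper: "preserves_qr_code 1 (int (Suc n)) 0 1" for n
  proof (induction n)
    case (Suc n)
    then show ?case
      using preserves_qr_code_mult[of 1 1 "int (Suc n)" 0 1 1 0 1] preserves_qr_code_generators(1)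
      by (simp add: add.commute)
  qed (use preserves_qr_code_generators in simp)
  have lower: "preserves_qr_code 1 0 (int (Suc n)) 1" for n
  proof (induction n)
    case (Suc n)
    then show ?case
      using preserves_qr_code_mult[of 1 1 0 "int (Suc n)" 1 0 1 1] preserves_qr_code_generators(2)
      by (simp add: add.commute)
  qed (use preserves_qr_code_generators in simp)
  have nat_rep: "\<exists>n. [t = int (Suc n)] (mod 7)" for t :: int
    by (rule exI[of _ "nat ((t - 1) mod 7)"]) (simp add: cong_def mod_add_right_eq)
  have "carrier (SL 2 7) \<subseteq> ?H"
  proof (rule transvections_generate_SL2[OF p7])
    fix t :: int
    obtain n where n: "[t = int (Suc n)] (mod 7)" using nat_rep by blast
    show "sl2 7 1 t 0 1 \<in> ?H"
      using upper[of n] preserves_qr_code_cong[OF cong_refl n cong_refl cong_refl]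
      by (intro CollectI exI[of _ 1] exI[of _ t] exI[of _ 0] conjI) simp_all
    show "sl2 7 1 0 t 1 \<in> ?H"
      using lower[of n] preserves_qr_code_cong[OF cong_refl cong_refl n cong_refl]
      by (intro CollectI exI[of _ 1] exI[of _ t] exI[of _ 0] conjI) simp_all
  next
    fix A B assume "A \<in> ?H" "B \<in> ?H"
    then obtain a b c d a' b' c' d' where
      A: "A = sl2 7 a b c d" "[a * d - b * c = 1] (mod 7)" "preserves_qr_code a b c d" and
      B: "B = sl2 7 a' b' c' d'" "[a' * d' - b' * c' = 1] (mod 7)" "preserves_qr_code a' b' c' d'" by blast
    have "(a * a' + b * c') * (c * b' + d * d') - (a * b' + b * d') * (c * a' + d * c')
        = (a * d - b * c) * (a' * d' - b' * c')" by (simp add: algebra_simps)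
    then have "[(a * a' + b * c') * (c * b' + d * d') - (a * b' + b * d') * (c * a' + d * c') = 1] (mod 7)"
      using cong_mult[OF A(2) B(2)] by simp
    then show "A \<otimes>\<^bsub>SL 2 7\<^esub> B \<in> ?H"
      unfolding A(1) B(1) sl2_mult using preserves_qr_code_mult[OF A(2,3) B(3)] by blast
  qed
  moreover have "sl2 7 a b c d \<in> carrier (SL 2 7)" using assms by (intro sl2_in_carrier) simp_all
  ultimately obtain a' b' c' d' where "sl2 7 a b c d = sl2 7 a' b' c' d'" "preserves_qr_code a' b' c' d'" by blast
  then show ?thesis using preserves_qr_code_cong[of a a' b b' c c' d d'] by (simp add: sl2_eq_iff)
qed

definition qr_representation :: "int mat \<Rightarrow> int mat" where
  "qr_representation A = mat 3 3 (\<lambda>(j, i). qr_entry (A $$ (0, 0)) (A $$ (0, 1)) (A $$ (1, 0)) (A $$ (1, 1)) j i)"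

lemma qr_representation_sl2: "qr_representation (sl2 7 a b c d) = mat 3 3 (\<lambda>(j, i). qr_entry a b c d j i)"
  unfolding qr_representation_def
  by (intro cong_mat refl) (auto simp: sl2_def cong_def intro!: qr_entry_cong)

lemma less_3_cases_iff: "(\<forall>i<3. P i) \<longleftrightarrow> P 0 \<and> P 1 \<and> P (2::nat)"
  by (auto simp: numeral_3_eq_3 less_Suc_eq numeral_2_eq_2)

lemma mat_3_eq_one_iff: "mat 3 3 f = 1\<^sub>m 3 \<longleftrightarrow>
    (\<forall>i<3. \<forall>j<3. f (i, j) = (if i = j then 1 else 0))"
  by (auto simp: mat_eq_iff)

lemma qr_representation_hom: "group_hom (SL 2 7) (SL 3 2) qr_representation"
proof (rule hom_into_SL[OF group_SL])
  show "qr_representation A \<in> carrier_mat 3 3" for A by (simp add: qr_representation_def)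
  show "reduce_mat 2 (qr_representation A) = qr_representation A" for A
    by (rule eq_matI) (auto simp: qr_representation_def qr_entry_def)
  have "\<forall>i\<in>{0,1,2}. \<forall>j\<in>{0,1,2}. qr_entry 1 0 0 1 i j = (if i = j then 1 else 0)" by code_simp
  then have "mat 3 3 (\<lambda>(j, i). qr_entry 1 0 0 1 j i) = 1\<^sub>m 3"
    by (simp only: mat_3_eq_one_iff less_3_cases_iff split) simp
  then show "qr_representation \<one>\<^bsub>SL 2 7\<^esub> = 1\<^sub>m 3" by (simp add: sl2_one qr_representation_sl2)
  fix A B assume A: "A \<in> carrier (SL 2 7)" and B: "B \<in> carrier (SL 2 7)"
  obtain a b c d where a: "A = sl2 7 a b c d" "[a * d - b * c = 1] (mod int 7)" using A by (rule sl2_cases)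
  obtain a' b' c' d' where b: "B = sl2 7 a' b' c' d'" "[a' * d' - b' * c' = 1] (mod int 7)" using B by (rule sl2_cases)
  note entry = qr_entry_mult[OF _ preserves_qr_code_SL2, of a d b c a' d' b' c']
  show "qr_representation (A \<otimes>\<^bsub>SL 2 7\<^esub> B) = reduce_mat 2 (qr_representation A * qr_representation B)"
    unfolding a(1) b(1) sl2_mult qr_representation_sl2
  proof (rule eq_matI)
    fix j i
    let ?P = "mat 3 3 (\<lambda>(j, i). qr_entry a b c d j i) * mat 3 3 (\<lambda>(j, i). qr_entry a' b' c' d' j i)"
    assume "j < dim_row (reduce_mat 2 ?P)" "i < dim_col (reduce_mat 2 ?P)"
    then have ij: "j < 3" "i < 3" by simp_all
    have "reduce_mat 2 ?P $$ (j, i) = (\<Sum>k<3. qr_entry a b c d j k * qr_entry a' b' c' d' k i) mod 2"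
      using ij by (simp add: scalar_prod_def atLeast0LessThan)
    also have "\<dots> = qr_entry (a * a' + b * c') (a * b' + b * d') (c * a' + d * c') (c * b' + d * d') j i mod 2"
      using entry[of i j] a(2) b(2) ij by (simp add: cong_def)
    finally show "mat 3 3 (\<lambda>(j, i). qr_entry (a * a' + b * c') (a * b' + b * d') (c * a' + d * c') (c * b' + d * d') j i) $$ (j, i)
        = reduce_mat 2 ?P $$ (j, i)"
      using ij by (simp add: qr_entry_def)
  qed simp_all
qed (use odd_factor_cong in simp_all)

text \<open>One transvection acts nontrivially, so the kernel is a proper normal subgroup and
  contains only scalars. Conversely -1 acts trivially, as (u - k v) v does not change when u and v
  change sign.\<close>

lemma kernel_qr_representation: "kernel (SL 2 7) (SL 3 2) qr_representation = SL_scalars 2 7"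
proof -
  interpret h: group_hom "SL 2 7" "SL 3 2" qr_representation by (rule qr_representation_hom)
  let ?K = "kernel (SL 2 7) (SL 3 2) qr_representation"
  have p7: "Factorial_Ring.prime (7::nat)" by simp
  have T: "sl2 7 1 1 0 1 \<in> carrier (SL 2 7)" by (rule sl2_in_carrier) simp_all
  have "\<not> (\<forall>i\<in>{0,1,2}. \<forall>j\<in>{0,1,2}. qr_entry 1 1 0 1 i j = (if i = j then 1 else 0))" by code_simp
  then have "qr_representation (sl2 7 1 1 0 1) \<noteq> 1\<^sub>m 3"
    unfolding qr_representation_sl2 mat_3_eq_one_iff less_3_cases_iff split by simp
  then have "?K \<noteq> carrier (SL 2 7)" using T by (auto simp: kernel_def one_SL)
  then have sub: "?K \<subseteq> SL_scalars 2 7"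
    using normal_SL2_nonscalar[OF p7 _ h.normal_kernel] by auto
  have "\<forall>i\<in>{0,1,2}. \<forall>j\<in>{0,1,2}. qr_entry (- 1) 0 0 (- 1) i j = (if i = j then 1 else 0)" by code_simp
  then have minus: "qr_representation (sl2 7 (- 1) 0 0 (- 1)) = 1\<^sub>m 3"
    unfolding qr_representation_sl2 mat_3_eq_one_iff less_3_cases_iff split by simp
  have one: "qr_representation (sl2 7 1 0 0 1) = 1\<^sub>m 3" using h.hom_one unfolding one_SL[of 3] by (simp add: sl2_one)
  have "A \<in> ?K" if A: "A \<in> SL_scalars 2 7" for A
  proof -
    have AG: "A \<in> carrier (SL 2 7)" using A by (simp add: SL_scalars_def)
    obtain a b c d where a: "A = sl2 7 a b c d" "[a * d - b * c = 1] (mod int 7)" using AG by (rule sl2_cases)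
    have "A = sl2 7 1 0 0 1 \<or> A = sl2 7 (- 1) 0 0 (- 1)" using sl2_scalar_iff[OF p7 a(2)] A a(1) by simp
    then show ?thesis using AG one minus by (auto simp: kernel_def one_SL)
  qed
  with sub show ?thesis by blast
qed

section \<open>The order of \<open>SL 3 2\<close> and the isomorphism with
  \<open>PSL 2 7\<close>\<close>

lemma det_3:
  assumes "A \<in> carrier_mat 3 3"
  shows "det A = A $$ (0, 0) * (A $$ (1, 1) * A $$ (2, 2) - A $$ (1, 2) * A $$ (2, 1))
    - A $$ (0, 1) * (A $$ (1, 0) * A $$ (2, 2) - A $$ (1, 2) * A $$ (2, 0))
    + A $$ (0, 2) * (A $$ (1, 0) * A $$ (2, 1) - A $$ (1, 1) * A $$ (2, 0))"
proof -
  have m: "mat_delete A 0 j \<in> carrier_mat 2 2" for j using assms by (simp add: mat_delete_def)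
  have "det A = (\<Sum>j<3. A $$ (0, j) * ((- 1) ^ (0 + j) * det (mat_delete A 0 j)))"
    using assms by (simp add: laplace_expansion_row[of A 3 0] cofactor_def)
  also have "\<dots> = (\<Sum>j<3. A $$ (0, j) * ((- 1) ^ (0 + j) *
      (mat_delete A 0 j $$ (0, 0) * mat_delete A 0 j $$ (1, 1) - mat_delete A 0 j $$ (0, 1) * mat_delete A 0 j $$ (1, 0))))"
    by (simp only: det_2[OF m])
  finally show ?thesis
    using assms by (simp add: mat_delete_def numeral_3_eq_3 numeral_2_eq_2 right_diff_distrib)
qed

definition det3_list :: "int list \<Rightarrow> int" where
  "det3_list xs = (case xs of [a, b, c, d, e, f, g, h, i] \<Rightarrow>
     a * (e * i - f * h) - b * (d * i - f * g) + c * (d * h - e * g) | _ \<Rightarrow> 0)"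

lemma count_det3_list:
  "length (filter (\<lambda>xs. det3_list xs mod 2 = 1) (product_lists (replicate 9 [0, 1]))) = 168"
  by code_simp

lemma in_product_lists_replicate:
  "length xs = n \<Longrightarrow> set xs \<subseteq> set ys \<Longrightarrow> xs \<in> set (product_lists (replicate n ys))"
  by (auto simp: product_lists_set list_all2_conv_all_nth)

text \<open>An upper bound suffices, because the image of \<open>SL 2 7\<close> will supply 168
  elements. So the enumerated matrices need not be shown distinct.\<close>

lemma order_SL_3_2_le: "order (SL 3 2) \<le> 168"
proof -
  let ?L = "filter (\<lambda>xs. det3_list xs mod 2 = 1) (product_lists (replicate 9 [0, 1]))"
  let ?m = "\<lambda>xs. mat 3 3 (\<lambda>(i, j). (xs :: int list) ! (3 * i + j))"
  have "carrier (SL 3 2) \<subseteq> ?m ` set ?L"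
  proof
    fix A assume "A \<in> carrier (SL 3 2)"
    then have A: "A \<in> carrier_mat 3 3" and R2: "\<And>i j. i < 3 \<Longrightarrow> j < 3 \<Longrightarrow> A $$ (i, j) \<in> {0..<2}"
      and det: "det A mod 2 = 1"
      by (simp_all add: carrier_SL_iff)
    have "{0..<2} = {0, 1 :: int}" by auto
    then have R: "\<And>i j. i < 3 \<Longrightarrow> j < 3 \<Longrightarrow> A $$ (i, j) = 0 \<or> A $$ (i, j) = 1" using R2 by auto
    define xs where "xs = [A $$ (0, 0), A $$ (0, 1), A $$ (0, 2), A $$ (1, 0), A $$ (1, 1), A $$ (1, 2),
      A $$ (2, 0), A $$ (2, 1), A $$ (2, 2)]"
    have "A = ?m xs"
    proof (rule eq_matI)
      have "\<forall>i<3. \<forall>j<3. A $$ (i, j) = ?m xs $$ (i, j)"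
        unfolding less_3_cases_iff by (simp add: xs_def)
      then show "A $$ (i, j) = ?m xs $$ (i, j)" if "i < dim_row (?m xs)" "j < dim_col (?m xs)" for i j
        using that by simp
    qed (use A in simp_all)
    moreover have "xs \<in> set (product_lists (replicate 9 [0, 1]))"
      using R by (intro in_product_lists_replicate) (simp_all add: xs_def)
    moreover have "det3_list xs mod 2 = 1" using det det_3[OF A] by (simp add: det3_list_def xs_def)
    ultimately show "A \<in> ?m ` set ?L" by auto
  qed
  then have "order (SL 3 2) \<le> card (?m ` set ?L)" unfolding order_def by (intro card_mono) auto
  also have "\<dots> \<le> card (set ?L)" by (rule card_image_le) simp
  also have "\<dots> \<le> 168" using card_length[of ?L] count_det3_list by simp
  finally show ?thesis .
qed

lemma SL_scalars_3_2: "SL_scalars 3 2 = {1\<^sub>m 3}"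
proof -
  have "A = 1\<^sub>m 3" if A: "A \<in> SL_scalars 3 2" for A
  proof -
    obtain a where a: "A = a \<cdot>\<^sub>m 1\<^sub>m 3" using A by (auto simp: SL_scalars_def)
    have AG: "A \<in> carrier (SL 3 2)" using A by (simp add: SL_scalars_def)
    then have "A $$ (0, 0) \<in> {0..<2}" "det A mod 2 = 1" by (simp_all add: carrier_SL_iff)
    then have "a \<in> {0..<2}" "a ^ 3 mod 2 = 1" by (simp_all add: a)
    then have "a = 1" by (cases "a = 0") auto
    then show ?thesis unfolding a by (intro eq_matI) auto
  qed
  moreover have "1\<^sub>m 3 \<in> SL_scalars 3 2"
    using monoid.one_closed[OF group.is_monoid[OF group_SL[of 2 3]]]
    by (auto simp: SL_scalars_def one_SL intro!: exI[of _ 1])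
  ultimately show ?thesis by blast
qed

lemma PSL_3_2_iso_SL_3_2: "PSL 3 2 \<cong> SL 3 2"
proof -
  have "SL_scalars 3 2 = {\<one>\<^bsub>SL 3 2\<^esub>}" by (simp add: SL_scalars_3_2 one_SL)
  then show ?thesis
    unfolding PSL_def using group.trivial_factor_iso[OF group_SL[of 2 3]] is_isoI by simp
qed

lemma order_PSL_2_7: "order (PSL 2 7) = 168"
  using order_PSL2[of 7] by simp

lemma PSL_2_7_iso_SL_3_2: "PSL 2 7 \<cong> SL 3 2"
proof -
  interpret h: group_hom "SL 2 7" "SL 3 2" qr_representation by (rule qr_representation_hom)
  let ?I = "qr_representation ` carrier (SL 2 7)"
  let ?H = "(SL 3 2)\<lparr>carrier := ?I\<rparr>"
  have H: "group ?H" by (rule h.H.subgroup_imp_group[OF h.img_is_subgroup])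
  interpret i: group_hom "SL 2 7" ?H qr_representation
    unfolding group_hom_def group_hom_axioms_def using H h.G.is_group h.hom_mult by (auto simp: hom_def)
  have "kernel (SL 2 7) ?H qr_representation = SL_scalars 2 7"
    using kernel_qr_representation by (simp add: kernel_def)
  then have iso: "PSL 2 7 \<cong> ?H" using i.FactGroup_iso by (simp add: PSL_def)
  then have "card ?I = 168" using iso_same_card[OF iso] order_PSL_2_7 by (simp add: order_def)
  moreover have "?I \<subseteq> carrier (SL 3 2)" using h.hom_closed by blast
  ultimately have "?I = carrier (SL 3 2)"
    using order_SL_3_2_le by (intro card_seteq finite_carrier_SL) (simp_all add: order_def)
  then show ?thesis using iso by simp
qed

lemma PSL_3_2_iso_PSL_2_7: "PSL 3 2 \<cong> PSL 2 7"
  using iso_trans[OF PSL_3_2_iso_SL_3_2 group.iso_sym[OF group_PSL PSL_2_7_iso_SL_3_2]] by simp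

lemma simple_PSL_3_2: "simple_group (PSL 3 2)"
proof -
  have "simple_group (PSL 2 7)" by (rule simple_PSL2) simp_all
  moreover have "PSL 2 7 \<cong> PSL 3 2"
    using group.iso_sym[OF group_PSL PSL_3_2_iso_PSL_2_7] by simp
  ultimately show ?thesis
    using simple_group.iso_simple[of "PSL 2 7" "PSL 3 2"] group_PSL[of 2 3] by (auto simp: is_iso_def)
qed

lemma order_PSL_3_2: "order (PSL 3 2) = 168"
  using iso_same_card[OF PSL_3_2_iso_PSL_2_7] order_PSL_2_7 by (simp add: order_def)

section \<open>The embedding of \<open>sym_group 4\<close> and the factorization of
  \<open>PSL 3 2\<close>\<close>

text \<open>The action on the even subsets of \<open>{1..4}\<close>, in the basis \<open>{i, 4}\<close>, \<open>i \<le> 3\<close>.\<close>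
definition sym4_matrix :: "(nat \<Rightarrow> nat) \<Rightarrow> int mat" where
  "sym4_matrix s = mat 3 3 (\<lambda>(i, j). (of_bool (s (Suc j) = Suc i) + of_bool (s 4 = Suc i)) mod 2)"

lemma sym4_matrix_hom: "group_hom (sym_group 4) (SL 3 2) sym4_matrix"
proof (rule hom_into_SL[OF sym_group_is_group])
  show "sym4_matrix s \<in> carrier_mat 3 3" for s by (simp add: sym4_matrix_def)
  show "reduce_mat 2 (sym4_matrix s) = sym4_matrix s" for s
    by (rule eq_matI) (auto simp: sym4_matrix_def)
  show "sym4_matrix \<one>\<^bsub>sym_group 4\<^esub> = 1\<^sub>m 3"
    by (rule eq_matI) (auto simp: sym4_matrix_def sym_group_one)
  fix s t assume "s \<in> carrier (sym_group 4)" "t \<in> carrier (sym_group 4)"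
  then have t: "t permutes {1..4}" by (simp add: sym_group_carrier)
  show "sym4_matrix (s \<otimes>\<^bsub>sym_group 4\<^esub> t) = reduce_mat 2 (sym4_matrix s * sym4_matrix t)"
  proof (rule eq_matI)
    fix i j assume "i < dim_row (reduce_mat 2 (sym4_matrix s * sym4_matrix t))"
      "j < dim_col (reduce_mat 2 (sym4_matrix s * sym4_matrix t))"
    then have ij: "i < 3" "j < 3" by (simp_all add: sym4_matrix_def)
    define g :: "nat \<Rightarrow> int" where "g m = of_bool (s m = Suc i)" for m
    \<comment> \<open>Coordinate i of the image of the even set {x} + {4}. For x = 4 the set is
      empty: the sum is 0 and the right side is 2 g 4.\<close>
    have key: "[(\<Sum>k<3. (g (Suc k) + g 4) * of_bool (x = Suc k)) = g x + g 4] (mod 2)" if "x \<in> {1..4}" for x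
    proof -
      have "x = 1 \<or> x = 2 \<or> x = 3 \<or> x = 4" using that by auto
      then show ?thesis by (auto simp: numeral_3_eq_3 numeral_2_eq_2 cong_def)
    qed
    have "[(\<Sum>k<3. ((g (Suc k) + g 4) mod 2) * ((of_bool (t (Suc j) = Suc k) + of_bool (t 4 = Suc k)) mod 2))
        = (\<Sum>k<3. (g (Suc k) + g 4) * (of_bool (t (Suc j) = Suc k) + of_bool (t 4 = Suc k)))] (mod 2)"
      by (intro cong_sum cong_mult) (simp_all add: cong_def)
    also have "(\<Sum>k<3. (g (Suc k) + g 4) * (of_bool (t (Suc j) = Suc k) + of_bool (t 4 = Suc k)))
        = (\<Sum>k<3. (g (Suc k) + g 4) * of_bool (t (Suc j) = Suc k)) + (\<Sum>k<3. (g (Suc k) + g 4) * of_bool (t 4 = Suc k))"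
      by (simp only: distrib_left sum.distrib)
    also have "[(\<Sum>k<3. (g (Suc k) + g 4) * of_bool (t (Suc j) = Suc k)) + (\<Sum>k<3. (g (Suc k) + g 4) * of_bool (t 4 = Suc k))
        = (g (t (Suc j)) + g 4) + (g (t 4) + g 4)] (mod 2)"
      using sym4_range[OF t] ij by (intro cong_add key) simp_all
    also have "(g (t (Suc j)) + g 4) + (g (t 4) + g 4) = g (t (Suc j)) + g (t 4) + 2 * g 4" by simp
    also have "[g (t (Suc j)) + g (t 4) + 2 * g 4 = g (t (Suc j)) + g (t 4)] (mod 2)" by (simp add: cong_def)
    finally show "sym4_matrix (s \<otimes>\<^bsub>sym_group 4\<^esub> t) $$ (i, j) = reduce_mat 2 (sym4_matrix s * sym4_matrix t) $$ (i, j)"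
      using ij by (simp add: sym4_matrix_def sym_group_mult scalar_prod_def atLeast0LessThan cong_def g_def)
  qed (simp_all add: sym4_matrix_def)
qed (use odd_factor_cong in simp_all)

lemma inj_sym4_matrix: "inj_on sym4_matrix (carrier (sym_group 4))"
proof -
  interpret h: group_hom "sym_group 4" "SL 3 2" sym4_matrix by (rule sym4_matrix_hom)
  show ?thesis
    unfolding h.inj_on_one_iff
  proof (intro allI impI)
    fix s assume "s \<in> carrier (sym_group 4)" and one: "sym4_matrix s = \<one>\<^bsub>SL 3 2\<^esub>"
    then have s: "s permutes {1..4}" by (simp add: sym_group_carrier)
    have e: "(of_bool (s (Suc j) = Suc i) + of_bool (s 4 = Suc i)) mod 2 = (of_bool (i = j) :: int)"
      if "i < 3" "j < 3" for i j
      using one that by (auto simp: sym4_matrix_def one_SL mat_eq_iff)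
    have s4: "s 4 = 4"
    proof (rule ccontr)
      assume "s 4 \<noteq> 4"
      then obtain i where i: "s 4 = Suc i" "i < 3" using sym4_range[OF s, of 4] by (cases "s 4") auto
      \<comment> \<open>The off-diagonal entry in row i and column j vanishes although its second
        indicator is 1, so the first must be 1 as well. Then s takes the value \<open>Suc i\<close>
        twice.\<close>
      obtain j where j: "j < 3" "j \<noteq> i" using that[of 0] that[of 1] by (cases "i = 0") auto
      have "s (Suc j) = Suc i" using e[OF i(2) j(1)] i(1) j(2) by (auto split: if_splits)
      then have "Suc j = 4" using i(1) permutes_inj[OF s] by (metis injD)
      then show False using j(1) by simp
    qed
    have "s (Suc j) = Suc j" if "j < 3" for j
      using e[OF that that] s4 that by (auto split: if_splits)
    moreover have "x = 4 \<or> (\<exists>j<3. x = Suc j)" if "x \<in> {1..4}" for x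
      using that by (cases x) auto
    ultimately have "s x = x" for x using s4 permutes_not_in[OF s, of x] by (cases "x \<in> {1..4}") auto
    then show "s = \<one>\<^bsub>sym_group 4\<^esub>" by (simp add: sym_group_one fun_eq_iff)
  qed
qed

theorem hopf_galois_structure_PSL_3_2:
  assumes ext: "galois_extension L K" "galois_group L K \<cong> sym_group 4 \<times>\<times> integer_mod_group 7"
  shows "admits_hopf_galois_structure_of_type L K (PSL 3 2)"
proof -
  interpret P: group "PSL 3 2" by (rule group_PSL) simp_all
  obtain \<iota> where \<iota>: "\<iota> \<in> iso (SL 3 2) (PSL 3 2)"
    using group.iso_sym[OF P.is_group PSL_3_2_iso_SL_3_2] by (auto simp: is_iso_def)
  then have "group_hom (SL 3 2) (PSL 3 2) \<iota>" and inj: "inj_on \<iota> (carrier (SL 3 2))"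
    unfolding group_hom_def group_hom_axioms_def using group_SL[of 2 3] P.is_group
    by (auto simp: iso_def bij_betw_def)
  then have \<alpha>: "group_hom (sym_group 4) (PSL 3 2) (\<iota> \<circ> sym4_matrix)"
    using group_hom_trans[OF sym4_matrix_hom] by blast
  interpret h: group_hom "sym_group 4" "SL 3 2" sym4_matrix by (rule sym4_matrix_hom)
  have inj\<alpha>: "inj_on (\<iota> \<circ> sym4_matrix) (carrier (sym_group 4))"
    using h.hom_closed by (intro comp_inj_on inj_sym4_matrix inj_on_subset[OF inj]) blast
  obtain x where x: "x \<in> carrier (PSL 3 2)" "P.ord x = 7"
    using P.cauchy_ord[OF finite_carrier_PSL, of 7] order_PSL_3_2 by auto
  interpret c: group_hom "integer_mod_group 7" "PSL 3 2" "\<lambda>k. x [^]\<^bsub>PSL 3 2\<^esub> k"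
    using P.integer_mod_group_hom[OF x(1), of 7] x P.pow_ord_eq_1[OF x(1)] by simp
  have inj\<beta>: "inj_on (\<lambda>k::int. x [^]\<^bsub>PSL 3 2\<^esub> k) (carrier (integer_mod_group 7))"
    using P.inj_integer_mod_group_hom[OF x(1) _ x(2)] by simp
  have o4: "order (sym_group 4) = 24"
    using sym_group_card_carrier[of 4] by (simp add: order_def fact_numeral)
  have o7: "order (integer_mod_group 7) = 7" by (rule order_integer_mod_group) simp
  have "coprime (24::nat) 7" by code_simp
  then show ?thesis
    using exact_factorization_hopf_galois[OF ext finite_carrier_PSL \<alpha> c.group_hom_axioms inj\<alpha> inj\<beta>]
      o4 o7 order_PSL_3_2 by simp
qed

theorem corollary1:
  shows
    "(solvable (alt_group 4 \<times>\<times> integer_mod_group 5) \<and> simple_group (alt_group 5) \<and>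
      (\<forall>(L :: ('a, 'b) ring_scheme) K.
         galois_extension L K \<and> extension_degree L K = 60 \<and>
         galois_group L K \<cong> alt_group 4 \<times>\<times> integer_mod_group 5 \<longrightarrow>
         admits_hopf_galois_structure_of_type L K (alt_group 5)))
   \<and> (solvable (sym_group 4 \<times>\<times> integer_mod_group 7) \<and> simple_group (PSL 3 2) \<and>
      PSL 3 2 \<cong> PSL 2 7 \<and>
      (\<forall>(L :: ('a, 'b) ring_scheme) K.
         galois_extension L K \<and> extension_degree L K = 168 \<and>
         galois_group L K \<cong> sym_group 4 \<times>\<times> integer_mod_group 7 \<longrightarrow>
         admits_hopf_galois_structure_of_type L K (PSL 3 2)))
   \<and> (\<forall>(p :: nat) (e :: nat). Factorial_Ring.prime p \<and> p = 2 ^ e - 1 \<and> p \<ge> 7 \<longrightarrow>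
      simple_group (PSL 2 p) \<and>
      (\<forall>\<phi> \<in> mon (integer_mod_group ((p - 1) div 2)) (AutoGroup (integer_mod_group p)).
         let \<Gamma> = semidirect_product (integer_mod_group p) (integer_mod_group ((p - 1) div 2)) \<phi>
                   \<times>\<times> dihedral_group (2 ^ (e - 1))
         in solvable \<Gamma> \<and>
            (\<forall>(L :: ('a, 'b) ring_scheme) K.
               galois_extension L K \<and> extension_degree L K = (p - 1) * p * (p + 1) div 2 \<and>
               galois_group L K \<cong> \<Gamma> \<longrightarrow>
               admits_hopf_galois_structure_of_type L K (PSL 2 p))))"
proof -
  have "simple_group (PSL 2 p) \<and>
      (\<forall>\<phi> \<in> mon (integer_mod_group ((p - 1) div 2)) (AutoGroup (integer_mod_group p)).
         let \<Gamma> = semidirect_product (integer_mod_group p) (integer_mod_group ((p - 1) div 2)) \<phi>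
                   \<times>\<times> dihedral_group (2 ^ (e - 1))
         in solvable \<Gamma> \<and>
            (\<forall>(L :: ('a, 'b) ring_scheme) K.
               galois_extension L K \<and> extension_degree L K = (p - 1) * p * (p + 1) div 2 \<and>
               galois_group L K \<cong> \<Gamma> \<longrightarrow>
               admits_hopf_galois_structure_of_type L K (PSL 2 p)))"
    if "Factorial_Ring.prime p \<and> p = 2 ^ e - 1 \<and> p \<ge> 7" for p e :: nat
  proof -
    interpret mersenne_prime p e using that by unfold_locales auto
    show ?thesis
      unfolding Let_def using simple_PSL2[OF prime p_ge] hopf_galois_structure_PSL2 by blast
  qed
  moreover have "solvable (alt_group 4 \<times>\<times> integer_mod_group 5)"
    by (intro solvable_DirProd alt_group_is_group solvable_alt_group_4 solvable_integer_mod_group) simp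
  moreover have "solvable (sym_group 4 \<times>\<times> integer_mod_group 7)"
    by (intro solvable_DirProd sym_group_is_group solvable_sym_group_4 solvable_integer_mod_group) simp
  ultimately show ?thesis
    using simple_alt_group_5 hopf_galois_structure_alt_group_5 simple_PSL_3_2 PSL_3_2_iso_PSL_2_7
      hopf_galois_structure_PSL_3_2 by blast
qed

end
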